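(* Let $C$ and $E$ be cocomplete categories with finite limits, let $S$ be a finitary cartesian monad on $C$ and $T$ a finitary cartesian monad on $E$. Let $w:C\to E$ be a functor with left adjoint $c$, and let $d:Alg_S\to Alg_T$ be a functor with $U^Td=wU^S$; let $p$ denote the left adjoint of $d$. Put $G=F^Sc:E\to Alg_S$ and assume that the canonical right action $F^Sc\,U^TF^T\Rightarrow F^Sc$ of the monad $T$ on $G$ is a cartesian natural transformation. Then the 2-functor $IAlg^S_T:\mathbf{CAlg}_S\to Cat$, $A\mapsto IAlg_T(d(A))$, is representable. The representing categorical $S$-algebra $\mathbf h^T=p(\mathbf H^T)$ has the characteristic property that its nerve coincides with the two-sided bar construction $B_\star(G,T,1)$, i.e. with the image under $p$ of the cotriple resolution of the terminal categorical $T$-algebra.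
   Context: A monad $(T,\mu,\epsilon)$ is cartesian if $T$ preserves pullbacks and all naturality squares of $\mu$ and $\epsilon$ are pullbacks; a natural transformation is cartesian if its naturality squares are pullbacks. $U^T:Alg_T\to E$, $U^S:Alg_S\to C$ are the forgetful functors and $F^T,F^S$ their left adjoints. Under the stated hypotheses $d$ has a left adjoint $p$ with $pF^T\cong F^Sc$. The canonical action is constructed as follows: $U^Td=wU^S$ induces a natural transformation (a map of monads) $T=U^TF^T\Rightarrow wU^SF^Sc$, whose adjoint transforms give $F^Sc\,U^TF^T\Rightarrow F^Sc$ (equivalently, $pF^TU^TF^T\Rightarrow pF^T$ induced by the counit of $F^T\dashv U^T$). A cartesian monad $T$ extends levelwise to internal categories; categorical $T$-algebras are internal categories in $Alg_T$, forming the 2-category $\mathbf{CAlg}_T$ (strict morphisms and transformations). The functor $d$ preserves limits and so extends levelwise to $d:\mathbf{CAlg}_S\to\mathbf{CAlg}_T$. For categorical $T$-algebras $(A,\alpha)$, $(B,\beta)$ a lax morphism $(f,\phi):A\to B$ is an internal functor $f$ with an internal natural transformation $\phi:\beta\circ T(f)\Rightarrow f\circ\alpha$ such that $\phi*\epsilon_A=\mathrm{id}_f$ and $\phi*\mu_A=(\phi*T\alpha)\circ(\beta*T\phi)$; a transformation $(f,\phi)\Rightarrow(g,\psi)$ is $\tau:f\Rightarrow g$ with $\psi\circ(\beta*T\tau)=(\tau*\alpha)\circ\phi$. An internal $T$-algebra in a categorical $T$-algebra $B$ is a lax morphism $1\to B$ from the terminal categorical $T$-algebra; these form the category $IAlg_T(B)$.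 An internal $T$-algebra in a categorical $S$-algebra $A$ is an internal $T$-algebra in $d(A)$. $\mathbf H^T$ is the categorical $T$-algebra representing $IAlg_T$ on $\mathbf{CAlg}_T$; its nerve is $B_\star(T,T,1)$, $B_k=T^{k+1}(1)$, with source map $\mu_1:T^2(1)\to T(1)$ and target map $T(!)$. $B_\star(G,T,1)$ has $B_k=GT^k(1)$, with faces given by the action of $T$ on $G$, by $\mu$ and by $T(1)\to1$, and degeneracies by $\epsilon$. $p(\mathbf H^T)$ is the internal category whose nerve is obtained by applying $p$ levelwise. *)

theory Defs
  imports Main
begin

section \<open>Categories, functors, natural transformations\<close>

record ('o, 'm) cat =
  Ob :: "'o set"
  Ar :: "'m set"
  Dom :: "'m \<Rightarrow> 'o"
  Cod :: "'m \<Rightarrow> 'o"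
  Idt :: "'o \<Rightarrow> 'm"
  Comp :: "'m \<Rightarrow> 'm \<Rightarrow> 'm"  (infixr "\<cdot>\<index>" 70)

definition hom :: "('o, 'm) cat \<Rightarrow> 'o \<Rightarrow> 'o \<Rightarrow> 'm set" where
  "hom C a b = {f \<in> Ar C. Dom C f = a \<and> Cod C f = b}"

locale category =
  fixes C :: "('o, 'm) cat"
  assumes dom_in: "f \<in> Ar C \<Longrightarrow> Dom C f \<in> Ob C"
    and cod_in: "f \<in> Ar C \<Longrightarrow> Cod C f \<in> Ob C"
    and id_in: "a \<in> Ob C \<Longrightarrow> Idt C a \<in> hom C a a"
    and comp_in: "f \<in> hom C a b \<Longrightarrow> g \<in> hom C b c \<Longrightarrow> g \<cdot>\<^bsub>C\<^esub> f \<in> hom C a c"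
    and id_left: "f \<in> hom C a b \<Longrightarrow> Idt C b \<cdot>\<^bsub>C\<^esub> f = f"
    and id_right: "f \<in> hom C a b \<Longrightarrow> f \<cdot>\<^bsub>C\<^esub> Idt C a = f"
    and assoc: "f \<in> hom C a b \<Longrightarrow> g \<in> hom C b c \<Longrightarrow> h \<in> hom C c e
      \<Longrightarrow> h \<cdot>\<^bsub>C\<^esub> (g \<cdot>\<^bsub>C\<^esub> f) = (h \<cdot>\<^bsub>C\<^esub> g) \<cdot>\<^bsub>C\<^esub> f"

definition is_iso :: "('o, 'm) cat \<Rightarrow> 'm \<Rightarrow> bool" where
  "is_iso C f \<longleftrightarrow> f \<in> Ar C \<and> (\<exists>g \<in> hom C (Cod C f) (Dom C f).
     g \<cdot>\<^bsub>C\<^esub> f = Idt C (Dom C f) \<and> f \<cdot>\<^bsub>C\<^esub> g = Idt C (Cod C f))"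

record ('o, 'm, 'p, 'n) fnc =
  fo :: "'o \<Rightarrow> 'p"
  fa :: "'m \<Rightarrow> 'n"

locale is_functor = A: category A + B: category B
  for A :: "('o, 'm) cat" and B :: "('p, 'n) cat" +
  fixes F :: "('o, 'm, 'p, 'n) fnc"
  assumes fo_in: "a \<in> Ob A \<Longrightarrow> fo F a \<in> Ob B"
    and fa_in: "f \<in> hom A a b \<Longrightarrow> fa F f \<in> hom B (fo F a) (fo F b)"
    and fa_id: "a \<in> Ob A \<Longrightarrow> fa F (Idt A a) = Idt B (fo F a)"
    and fa_comp: "f \<in> hom A a b \<Longrightarrow> g \<in> hom A b c
      \<Longrightarrow> fa F (g \<cdot>\<^bsub>A\<^esub> f) = fa F g \<cdot>\<^bsub>B\<^esub> fa F f"

definition id_fnc :: "('o, 'm, 'o, 'm) fnc" where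
  "id_fnc = \<lparr>fo = \<lambda>a. a, fa = \<lambda>f. f\<rparr>"

definition comp_fnc :: "('p, 'n, 'q, 'k) fnc \<Rightarrow> ('o, 'm, 'p, 'n) fnc \<Rightarrow> ('o, 'm, 'q, 'k) fnc" where
  "comp_fnc G F = \<lparr>fo = \<lambda>a. fo G (fo F a), fa = \<lambda>f. fa G (fa F f)\<rparr>"

text \<open>Only the values on the objects and arrows of the source category matter.\<close>

definition eq_fnc :: "('o, 'm) cat \<Rightarrow> ('o, 'm, 'p, 'n) fnc \<Rightarrow> ('o, 'm, 'p, 'n) fnc \<Rightarrow> bool" where
  "eq_fnc A F G \<longleftrightarrow> (\<forall>a \<in> Ob A. fo F a = fo G a) \<and> (\<forall>f \<in> Ar A. fa F f = fa G f)"

definition cat_iso :: "('o, 'm) cat \<Rightarrow> ('p, 'n) cat \<Rightarrow> ('o, 'm, 'p, 'n) fnc \<Rightarrow> bool" where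
  "cat_iso A B F \<longleftrightarrow> is_functor A B F \<and> (\<exists>G. is_functor B A G
     \<and> eq_fnc A (comp_fnc G F) id_fnc \<and> eq_fnc B (comp_fnc F G) id_fnc)"

definition nat_trans :: "('o, 'm) cat \<Rightarrow> ('p, 'n) cat \<Rightarrow> ('o, 'm, 'p, 'n) fnc
    \<Rightarrow> ('o, 'm, 'p, 'n) fnc \<Rightarrow> ('o \<Rightarrow> 'n) \<Rightarrow> bool" where
  "nat_trans A B F G \<tau> \<longleftrightarrow> is_functor A B F \<and> is_functor A B G
     \<and> (\<forall>a \<in> Ob A. \<tau> a \<in> hom B (fo F a) (fo G a))
     \<and> (\<forall>f \<in> Ar A. fa G f \<cdot>\<^bsub>B\<^esub> \<tau> (Dom A f) = \<tau> (Cod A f) \<cdot>\<^bsub>B\<^esub> fa F f)"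

text \<open>The functor \<open>F : A \<rightarrow> B\<close> is left adjoint to \<open>U : B \<rightarrow> A\<close>, with unit \<open>u\<close> and counit \<open>v\<close>.\<close>

definition adjunction :: "('o, 'm) cat \<Rightarrow> ('p, 'n) cat \<Rightarrow> ('o, 'm, 'p, 'n) fnc
    \<Rightarrow> ('p, 'n, 'o, 'm) fnc \<Rightarrow> ('o \<Rightarrow> 'm) \<Rightarrow> ('p \<Rightarrow> 'n) \<Rightarrow> bool" where
  "adjunction A B F U u v \<longleftrightarrow> is_functor A B F \<and> is_functor B A U
     \<and> nat_trans A A id_fnc (comp_fnc U F) u
     \<and> nat_trans B B (comp_fnc F U) id_fnc v
     \<and> (\<forall>a \<in> Ob A. v (fo F a) \<cdot>\<^bsub>B\<^esub> fa F (u a) = Idt B (fo F a))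
     \<and> (\<forall>b \<in> Ob B. fa U (v b) \<cdot>\<^bsub>A\<^esub> u (fo U b) = Idt A (fo U b))"


section \<open>Limits and colimits\<close>

definition terminal :: "('o, 'm) cat \<Rightarrow> 'o \<Rightarrow> bool" where
  "terminal C t \<longleftrightarrow> t \<in> Ob C \<and> (\<forall>a \<in> Ob C. \<exists>!f. f \<in> hom C a t)"

definition bang :: "('o, 'm) cat \<Rightarrow> 'o \<Rightarrow> 'o \<Rightarrow> 'm" where
  "bang C t a = (THE f. f \<in> hom C a t)"

text \<open>\<open>pullback C f g p q\<close>: the square \<open>f \<cdot> p = g \<cdot> q\<close> is a pullback of \<open>f\<close> and \<open>g\<close>.\<close>

definition pullback :: "('o, 'm) cat \<Rightarrow> 'm \<Rightarrow> 'm \<Rightarrow> 'm \<Rightarrow> 'm \<Rightarrow> bool" where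
  "pullback C f g p q \<longleftrightarrow> f \<in> Ar C \<and> g \<in> Ar C \<and> p \<in> Ar C \<and> q \<in> Ar C
     \<and> Cod C f = Cod C g \<and> Dom C p = Dom C q \<and> Cod C p = Dom C f \<and> Cod C q = Dom C g
     \<and> f \<cdot>\<^bsub>C\<^esub> p = g \<cdot>\<^bsub>C\<^esub> q
     \<and> (\<forall>x. \<forall>h \<in> hom C x (Dom C f). \<forall>k \<in> hom C x (Dom C g). f \<cdot>\<^bsub>C\<^esub> h = g \<cdot>\<^bsub>C\<^esub> k
          \<longrightarrow> (\<exists>!u. u \<in> hom C x (Dom C p) \<and> p \<cdot>\<^bsub>C\<^esub> u = h \<and> q \<cdot>\<^bsub>C\<^esub> u = k))"

definition cone :: "('i, 'j) cat \<Rightarrow> ('o, 'm) cat \<Rightarrow> ('i, 'j, 'o, 'm) fnc \<Rightarrow> 'o \<Rightarrow> ('i \<Rightarrow> 'm) \<Rightarrow> bool" where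
  "cone J C D x \<pi> \<longleftrightarrow> x \<in> Ob C \<and> (\<forall>i \<in> Ob J. \<pi> i \<in> hom C x (fo D i))
     \<and> (\<forall>j \<in> Ar J. fa D j \<cdot>\<^bsub>C\<^esub> \<pi> (Dom J j) = \<pi> (Cod J j))"

definition limit_cone :: "('i, 'j) cat \<Rightarrow> ('o, 'm) cat \<Rightarrow> ('i, 'j, 'o, 'm) fnc \<Rightarrow> 'o \<Rightarrow> ('i \<Rightarrow> 'm) \<Rightarrow> bool" where
  "limit_cone J C D x \<pi> \<longleftrightarrow> cone J C D x \<pi>
     \<and> (\<forall>y \<rho>. cone J C D y \<rho> \<longrightarrow> (\<exists>!u. u \<in> hom C y x \<and> (\<forall>i \<in> Ob J. \<pi> i \<cdot>\<^bsub>C\<^esub> u = \<rho> i)))"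

definition cocone :: "('i, 'j) cat \<Rightarrow> ('o, 'm) cat \<Rightarrow> ('i, 'j, 'o, 'm) fnc \<Rightarrow> 'o \<Rightarrow> ('i \<Rightarrow> 'm) \<Rightarrow> bool" where
  "cocone J C D x \<iota> \<longleftrightarrow> x \<in> Ob C \<and> (\<forall>i \<in> Ob J. \<iota> i \<in> hom C (fo D i) x)
     \<and> (\<forall>j \<in> Ar J. \<iota> (Cod J j) \<cdot>\<^bsub>C\<^esub> fa D j = \<iota> (Dom J j))"

definition colimit_cocone :: "('i, 'j) cat \<Rightarrow> ('o, 'm) cat \<Rightarrow> ('i, 'j, 'o, 'm) fnc \<Rightarrow> 'o \<Rightarrow> ('i \<Rightarrow> 'm) \<Rightarrow> bool" where
  "colimit_cocone J C D x \<iota> \<longleftrightarrow> cocone J C D x \<iota>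
     \<and> (\<forall>y \<kappa>. cocone J C D y \<kappa> \<longrightarrow> (\<exists>!u. u \<in> hom C x y \<and> (\<forall>i \<in> Ob J. u \<cdot>\<^bsub>C\<^esub> \<iota> i = \<kappa> i)))"

text \<open>Every finite category is isomorphic to one whose objects and arrows are natural numbers.\<close>

definition has_finite_limits :: "('o, 'm) cat \<Rightarrow> bool" where
  "has_finite_limits C \<longleftrightarrow> (\<forall>(J :: (nat, nat) cat) D. finite (Ob J) \<and> finite (Ar J) \<and> is_functor J C D
     \<longrightarrow> (\<exists>x \<pi>. limit_cone J C D x \<pi>))"

text \<open>The type \<open>'u\<close> fixes the meaning of ``small'': the small categories are those that can be
  carried by subsets of \<open>'u\<close>.\<close>

definition cocomplete :: "'u itself \<Rightarrow> ('o, 'm) cat \<Rightarrow> bool" where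
  "cocomplete _ C \<longleftrightarrow> (\<forall>(J :: ('u, 'u) cat) D. is_functor J C D \<longrightarrow> (\<exists>x \<iota>. colimit_cocone J C D x \<iota>))"

definition filtered :: "('i, 'j) cat \<Rightarrow> bool" where
  "filtered J \<longleftrightarrow> Ob J \<noteq> {}
     \<and> (\<forall>a \<in> Ob J. \<forall>b \<in> Ob J. \<exists>c. hom J a c \<noteq> {} \<and> hom J b c \<noteq> {})
     \<and> (\<forall>a b. \<forall>f \<in> hom J a b. \<forall>g \<in> hom J a b. \<exists>c. \<exists>h \<in> hom J b c. h \<cdot>\<^bsub>J\<^esub> f = h \<cdot>\<^bsub>J\<^esub> g)"

definition finitary :: "'u itself \<Rightarrow> ('o, 'm) cat \<Rightarrow> ('p, 'n) cat \<Rightarrow> ('o, 'm, 'p, 'n) fnc \<Rightarrow> bool" where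
  "finitary _ A B F \<longleftrightarrow> (\<forall>(J :: ('u, 'u) cat) D x \<iota>.
     filtered J \<and> is_functor J A D \<and> colimit_cocone J A D x \<iota>
     \<longrightarrow> colimit_cocone J B (comp_fnc F D) (fo F x) (\<lambda>i. fa F (\<iota> i)))"

definition preserves_pullbacks :: "('o, 'm) cat \<Rightarrow> ('p, 'n) cat \<Rightarrow> ('o, 'm, 'p, 'n) fnc \<Rightarrow> bool" where
  "preserves_pullbacks A B F \<longleftrightarrow> (\<forall>f g p q. pullback A f g p q
     \<longrightarrow> pullback B (fa F f) (fa F g) (fa F p) (fa F q))"

definition cartesian_nat_trans :: "('o, 'm) cat \<Rightarrow> ('p, 'n) cat \<Rightarrow> ('o, 'm, 'p, 'n) fnc
    \<Rightarrow> ('o, 'm, 'p, 'n) fnc \<Rightarrow> ('o \<Rightarrow> 'n) \<Rightarrow> bool" where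
  "cartesian_nat_trans A B F G \<tau> \<longleftrightarrow> nat_trans A B F G \<tau>
     \<and> (\<forall>f \<in> Ar A. pullback B (fa G f) (\<tau> (Cod A f)) (\<tau> (Dom A f)) (fa F f))"


section \<open>Monads and their algebras\<close>

record ('o, 'm) mnd =
  mfn :: "('o, 'm, 'o, 'm) fnc"
  mult :: "'o \<Rightarrow> 'm"
  unt :: "'o \<Rightarrow> 'm"

abbreviation mo :: "('o, 'm) mnd \<Rightarrow> 'o \<Rightarrow> 'o" where "mo T \<equiv> fo (mfn T)"
abbreviation ma :: "('o, 'm) mnd \<Rightarrow> 'm \<Rightarrow> 'm" where "ma T \<equiv> fa (mfn T)"

definition monad :: "('o, 'm) cat \<Rightarrow> ('o, 'm) mnd \<Rightarrow> bool" where
  "monad C T \<longleftrightarrow> is_functor C C (mfn T)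
     \<and> nat_trans C C (comp_fnc (mfn T) (mfn T)) (mfn T) (mult T)
     \<and> nat_trans C C id_fnc (mfn T) (unt T)
     \<and> (\<forall>x \<in> Ob C. mult T x \<cdot>\<^bsub>C\<^esub> unt T (mo T x) = Idt C (mo T x)
          \<and> mult T x \<cdot>\<^bsub>C\<^esub> ma T (unt T x) = Idt C (mo T x)
          \<and> mult T x \<cdot>\<^bsub>C\<^esub> mult T (mo T x) = mult T x \<cdot>\<^bsub>C\<^esub> ma T (mult T x))"

definition cartesian_monad :: "('o, 'm) cat \<Rightarrow> ('o, 'm) mnd \<Rightarrow> bool" where
  "cartesian_monad C T \<longleftrightarrow> monad C T
     \<and> preserves_pullbacks C C (mfn T)
     \<and> cartesian_nat_trans C C (comp_fnc (mfn T) (mfn T)) (mfn T) (mult T)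
     \<and> cartesian_nat_trans C C id_fnc (mfn T) (unt T)"

type_synonym ('o, 'm) alg = "'o \<times> 'm"
type_synonym ('o, 'm) alg_mor = "('o, 'm) alg \<times> 'm \<times> ('o, 'm) alg"

definition Alg_ob :: "('o, 'm) cat \<Rightarrow> ('o, 'm) mnd \<Rightarrow> ('o, 'm) alg set" where
  "Alg_ob C T = {(x, a). x \<in> Ob C \<and> a \<in> hom C (mo T x) x
     \<and> a \<cdot>\<^bsub>C\<^esub> unt T x = Idt C x \<and> a \<cdot>\<^bsub>C\<^esub> mult T x = a \<cdot>\<^bsub>C\<^esub> ma T a}"

definition Alg :: "('o, 'm) cat \<Rightarrow> ('o, 'm) mnd \<Rightarrow> (('o, 'm) alg, ('o, 'm) alg_mor) cat" where
  "Alg C T = \<lparr>Ob = Alg_ob C T,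
     Ar = {(A, f, B). A \<in> Alg_ob C T \<and> B \<in> Alg_ob C T \<and> f \<in> hom C (fst A) (fst B)
             \<and> f \<cdot>\<^bsub>C\<^esub> snd A = snd B \<cdot>\<^bsub>C\<^esub> ma T f},
     Dom = (\<lambda>(A, f, B). A), Cod = (\<lambda>(A, f, B). B),
     Idt = (\<lambda>A. (A, Idt C (fst A), A)),
     Comp = (\<lambda>(A', g, B') (A, f, B). (A, g \<cdot>\<^bsub>C\<^esub> f, B'))\<rparr>"

definition forget :: "(('o, 'm) alg, ('o, 'm) alg_mor, 'o, 'm) fnc" where
  "forget = \<lparr>fo = fst, fa = (\<lambda>(A, f, B). f)\<rparr>"

definition free_alg :: "('o, 'm) mnd \<Rightarrow> 'o \<Rightarrow> ('o, 'm) alg" where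
  "free_alg T x = (mo T x, mult T x)"

definition free :: "('o, 'm) cat \<Rightarrow> ('o, 'm) mnd \<Rightarrow> ('o, 'm, ('o, 'm) alg, ('o, 'm) alg_mor) fnc" where
  "free C T = \<lparr>fo = free_alg T,
     fa = (\<lambda>f. (free_alg T (Dom C f), ma T f, free_alg T (Cod C f)))\<rparr>"

text \<open>The right action \<open>F\<^sup>T U\<^sup>T F\<^sup>T \<Rightarrow> F\<^sup>T\<close> of \<open>T\<close> on the free functor, given by the
  counit of the adjunction between \<open>F\<^sup>T\<close> and \<open>U\<^sup>T\<close>.\<close>

definition free_action :: "('o, 'm) mnd \<Rightarrow> 'o \<Rightarrow> ('o, 'm) alg_mor" where
  "free_action T x = (free_alg T (mo T x), mult T x, free_alg T x)"

text \<open>Let \<open>c\<close> be left adjoint to \<open>w\<close> with unit \<open>u\<close> and counit \<open>v\<close>, and let \<open>U\<^sup>T d = w U\<^sup>S\<close>.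
  The map \<open>w(\<eta>\<^sub>c\<^sub>x) u\<^sub>x : x \<rightarrow> w S c x = U\<^sup>T d F\<^sup>S c x\<close> extends along the unit of \<open>T\<close> to a map of
  \<open>T\<close>-algebras \<open>F\<^sup>T x \<rightarrow> d F\<^sup>S c x\<close>; \<open>monad_map\<close> is the underlying map \<open>T x \<rightarrow> w S c x\<close>.
  Transposing it first along \<open>c\<close>, \<open>w\<close> to \<open>c T x \<rightarrow> S c x\<close>, and then along \<open>F\<^sup>S\<close>, \<open>U\<^sup>S\<close>,
  yields the action \<open>F\<^sup>S c T x \<rightarrow> F\<^sup>S c x\<close>.\<close>

definition monad_map :: "('p, 'n) cat \<Rightarrow> ('o, 'm) mnd \<Rightarrow> ('p, 'n) mnd \<Rightarrow> ('o, 'm, 'p, 'n) fnc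
    \<Rightarrow> ('p, 'n, 'o, 'm) fnc \<Rightarrow> ('p \<Rightarrow> 'n)
    \<Rightarrow> (('o, 'm) alg, ('o, 'm) alg_mor, ('p, 'n) alg, ('p, 'n) alg_mor) fnc \<Rightarrow> 'p \<Rightarrow> 'n" where
  "monad_map E S T w c u d x =
     snd (fo d (free_alg S (fo c x))) \<cdot>\<^bsub>E\<^esub> ma T (fa w (unt S (fo c x)) \<cdot>\<^bsub>E\<^esub> u x)"

definition canonical_action :: "('o, 'm) cat \<Rightarrow> ('p, 'n) cat \<Rightarrow> ('o, 'm) mnd \<Rightarrow> ('p, 'n) mnd
    \<Rightarrow> ('o, 'm, 'p, 'n) fnc \<Rightarrow> ('p, 'n, 'o, 'm) fnc \<Rightarrow> ('p \<Rightarrow> 'n) \<Rightarrow> ('o \<Rightarrow> 'm)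
    \<Rightarrow> (('o, 'm) alg, ('o, 'm) alg_mor, ('p, 'n) alg, ('p, 'n) alg_mor) fnc
    \<Rightarrow> 'p \<Rightarrow> ('o, 'm) alg_mor" where
  "canonical_action C E S T w c u v d x =
     (free_alg S (fo c (mo T x)),
      mult S (fo c x) \<cdot>\<^bsub>C\<^esub>
        ma S (v (mo S (fo c x)) \<cdot>\<^bsub>C\<^esub> fa c (monad_map E S T w c u d x)),
      free_alg S (fo c x))"


section \<open>Internal categories\<close>

text \<open>The pullback \<open>ic2\<close> of composable pairs \<open>(g, f)\<close>, \<open>source g = target f\<close>, is part of the
  data; \<open>ipr1\<close> projects to \<open>g\<close>, \<open>ipr2\<close> to \<open>f\<close>, and \<open>icmp\<close> is \<open>(g, f) \<mapsto> g \<circ> f\<close>.\<close>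

record ('o, 'm) icat =
  ic0 :: 'o
  ic1 :: 'o
  ic2 :: 'o
  isrc :: 'm
  itgt :: 'm
  iide :: 'm
  ipr1 :: 'm
  ipr2 :: 'm
  icmp :: 'm

definition icomp :: "('o, 'm) cat \<Rightarrow> ('o, 'm) icat \<Rightarrow> 'm \<Rightarrow> 'm \<Rightarrow> 'm" where
  "icomp C D g f = icmp D \<cdot>\<^bsub>C\<^esub>
     (THE k. k \<in> hom C (Dom C g) (ic2 D) \<and> ipr1 D \<cdot>\<^bsub>C\<^esub> k = g \<and> ipr2 D \<cdot>\<^bsub>C\<^esub> k = f)"

text \<open>The unit and associativity laws are stated for generalized elements \<open>x \<rightarrow> ic1 D\<close>.\<close>

definition internal_category :: "('o, 'm) cat \<Rightarrow> ('o, 'm) icat \<Rightarrow> bool" where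
  "internal_category C D \<longleftrightarrow> ic0 D \<in> Ob C \<and> ic1 D \<in> Ob C \<and> ic2 D \<in> Ob C
     \<and> isrc D \<in> hom C (ic1 D) (ic0 D) \<and> itgt D \<in> hom C (ic1 D) (ic0 D)
     \<and> iide D \<in> hom C (ic0 D) (ic1 D)
     \<and> ipr1 D \<in> hom C (ic2 D) (ic1 D) \<and> ipr2 D \<in> hom C (ic2 D) (ic1 D)
     \<and> icmp D \<in> hom C (ic2 D) (ic1 D)
     \<and> pullback C (isrc D) (itgt D) (ipr1 D) (ipr2 D)
     \<and> isrc D \<cdot>\<^bsub>C\<^esub> iide D = Idt C (ic0 D) \<and> itgt D \<cdot>\<^bsub>C\<^esub> iide D = Idt C (ic0 D)
     \<and> isrc D \<cdot>\<^bsub>C\<^esub> icmp D = isrc D \<cdot>\<^bsub>C\<^esub> ipr2 D \<and> itgt D \<cdot>\<^bsub>C\<^esub> icmp D = itgt D \<cdot>\<^bsub>C\<^esub> ipr1 D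
     \<and> (\<forall>x. \<forall>f \<in> hom C x (ic1 D).
          icomp C D f (iide D \<cdot>\<^bsub>C\<^esub> isrc D \<cdot>\<^bsub>C\<^esub> f) = f \<and> icomp C D (iide D \<cdot>\<^bsub>C\<^esub> itgt D \<cdot>\<^bsub>C\<^esub> f) f = f)
     \<and> (\<forall>x. \<forall>f \<in> hom C x (ic1 D). \<forall>g \<in> hom C x (ic1 D). \<forall>h \<in> hom C x (ic1 D).
          isrc D \<cdot>\<^bsub>C\<^esub> h = itgt D \<cdot>\<^bsub>C\<^esub> g \<and> isrc D \<cdot>\<^bsub>C\<^esub> g = itgt D \<cdot>\<^bsub>C\<^esub> f
          \<longrightarrow> icomp C D h (icomp C D g f) = icomp C D (icomp C D h g) f)"

record 'm ifun =
  if0 :: 'm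
  if1 :: 'm

definition internal_functor :: "('o, 'm) cat \<Rightarrow> ('o, 'm) icat \<Rightarrow> ('o, 'm) icat \<Rightarrow> 'm ifun \<Rightarrow> bool" where
  "internal_functor C D D' f \<longleftrightarrow> if0 f \<in> hom C (ic0 D) (ic0 D') \<and> if1 f \<in> hom C (ic1 D) (ic1 D')
     \<and> isrc D' \<cdot>\<^bsub>C\<^esub> if1 f = if0 f \<cdot>\<^bsub>C\<^esub> isrc D \<and> itgt D' \<cdot>\<^bsub>C\<^esub> if1 f = if0 f \<cdot>\<^bsub>C\<^esub> itgt D
     \<and> if1 f \<cdot>\<^bsub>C\<^esub> iide D = iide D' \<cdot>\<^bsub>C\<^esub> if0 f
     \<and> if1 f \<cdot>\<^bsub>C\<^esub> icmp D = icomp C D' (if1 f \<cdot>\<^bsub>C\<^esub> ipr1 D) (if1 f \<cdot>\<^bsub>C\<^esub> ipr2 D)"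

definition internal_nat :: "('o, 'm) cat \<Rightarrow> ('o, 'm) icat \<Rightarrow> ('o, 'm) icat
    \<Rightarrow> 'm ifun \<Rightarrow> 'm ifun \<Rightarrow> 'm \<Rightarrow> bool" where
  "internal_nat C D D' f g \<tau> \<longleftrightarrow> internal_functor C D D' f \<and> internal_functor C D D' g
     \<and> \<tau> \<in> hom C (ic0 D) (ic1 D')
     \<and> isrc D' \<cdot>\<^bsub>C\<^esub> \<tau> = if0 f \<and> itgt D' \<cdot>\<^bsub>C\<^esub> \<tau> = if0 g
     \<and> icomp C D' (if1 g) (\<tau> \<cdot>\<^bsub>C\<^esub> isrc D) = icomp C D' (\<tau> \<cdot>\<^bsub>C\<^esub> itgt D) (if1 f)"

definition id_ifun :: "('o, 'm) cat \<Rightarrow> ('o, 'm) icat \<Rightarrow> 'm ifun" where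
  "id_ifun C D = \<lparr>if0 = Idt C (ic0 D), if1 = Idt C (ic1 D)\<rparr>"

definition comp_ifun :: "('o, 'm) cat \<Rightarrow> 'm ifun \<Rightarrow> 'm ifun \<Rightarrow> 'm ifun" where
  "comp_ifun C g f = \<lparr>if0 = if0 g \<cdot>\<^bsub>C\<^esub> if0 f, if1 = if1 g \<cdot>\<^bsub>C\<^esub> if1 f\<rparr>"

definition map_icat :: "('o, 'm, 'p, 'n) fnc \<Rightarrow> ('o, 'm) icat \<Rightarrow> ('p, 'n) icat" where
  "map_icat F D = \<lparr>ic0 = fo F (ic0 D), ic1 = fo F (ic1 D), ic2 = fo F (ic2 D),
     isrc = fa F (isrc D), itgt = fa F (itgt D), iide = fa F (iide D),
     ipr1 = fa F (ipr1 D), ipr2 = fa F (ipr2 D), icmp = fa F (icmp D)\<rparr>"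

definition map_ifun :: "('o, 'm, 'p, 'n) fnc \<Rightarrow> 'm ifun \<Rightarrow> 'n ifun" where
  "map_ifun F f = \<lparr>if0 = fa F (if0 f), if1 = fa F (if1 f)\<rparr>"

definition discrete_icat :: "('o, 'm) cat \<Rightarrow> 'o \<Rightarrow> ('o, 'm) icat" where
  "discrete_icat C x = \<lparr>ic0 = x, ic1 = x, ic2 = x, isrc = Idt C x, itgt = Idt C x, iide = Idt C x,
     ipr1 = Idt C x, ipr2 = Idt C x, icmp = Idt C x\<rparr>"


section \<open>Strict 2-categories and representable 2-functors to Cat\<close>

text \<open>A 2-category in the Cat-enriched style: \<open>Hom2 K A B\<close> has the 1-cells as objects and the
  2-cells as arrows; \<open>comp1\<close> and \<open>comp2\<close> (horizontal composition) are the two parts of the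
  composition functor \<open>Hom2 K B C \<times> Hom2 K A B \<rightarrow> Hom2 K A C\<close>.\<close>

record ('a, 'x, 'y) twocat =
  Ob2 :: "'a set"
  Hom2 :: "'a \<Rightarrow> 'a \<Rightarrow> ('x, 'y) cat"
  id1 :: "'a \<Rightarrow> 'x"
  comp1 :: "'a \<Rightarrow> 'a \<Rightarrow> 'a \<Rightarrow> 'x \<Rightarrow> 'x \<Rightarrow> 'x"
  comp2 :: "'a \<Rightarrow> 'a \<Rightarrow> 'a \<Rightarrow> 'y \<Rightarrow> 'y \<Rightarrow> 'y"

definition id2 :: "('a, 'x, 'y) twocat \<Rightarrow> 'a \<Rightarrow> 'y" where
  "id2 K A = Idt (Hom2 K A A) (id1 K A)"

locale two_category =
  fixes K :: "('a, 'x, 'y) twocat"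
  assumes hom_category: "A \<in> Ob2 K \<Longrightarrow> B \<in> Ob2 K \<Longrightarrow> category (Hom2 K A B)"
    and id1_in: "A \<in> Ob2 K \<Longrightarrow> id1 K A \<in> Ob (Hom2 K A A)"
    and comp1_in: "\<lbrakk>A \<in> Ob2 K; B \<in> Ob2 K; C \<in> Ob2 K; f \<in> Ob (Hom2 K A B); g \<in> Ob (Hom2 K B C)\<rbrakk>
      \<Longrightarrow> comp1 K A B C g f \<in> Ob (Hom2 K A C)"
    and comp2_in: "\<lbrakk>A \<in> Ob2 K; B \<in> Ob2 K; C \<in> Ob2 K;
        \<tau> \<in> hom (Hom2 K A B) f f'; \<sigma> \<in> hom (Hom2 K B C) g g'\<rbrakk>
      \<Longrightarrow> comp2 K A B C \<sigma> \<tau> \<in> hom (Hom2 K A C) (comp1 K A B C g f) (comp1 K A B C g' f')"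
    and comp2_id: "\<lbrakk>A \<in> Ob2 K; B \<in> Ob2 K; C \<in> Ob2 K; f \<in> Ob (Hom2 K A B); g \<in> Ob (Hom2 K B C)\<rbrakk>
      \<Longrightarrow> comp2 K A B C (Idt (Hom2 K B C) g) (Idt (Hom2 K A B) f)
          = Idt (Hom2 K A C) (comp1 K A B C g f)"
    and interchange: "\<lbrakk>A \<in> Ob2 K; B \<in> Ob2 K; C \<in> Ob2 K;
        \<tau> \<in> hom (Hom2 K A B) f f'; \<tau>' \<in> hom (Hom2 K A B) f' f'';
        \<sigma> \<in> hom (Hom2 K B C) g g'; \<sigma>' \<in> hom (Hom2 K B C) g' g''\<rbrakk>
      \<Longrightarrow> comp2 K A B C (\<sigma>' \<cdot>\<^bsub>Hom2 K B C\<^esub> \<sigma>) (\<tau>' \<cdot>\<^bsub>Hom2 K A B\<^esub> \<tau>)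
          = comp2 K A B C \<sigma>' \<tau>' \<cdot>\<^bsub>Hom2 K A C\<^esub> comp2 K A B C \<sigma> \<tau>"
    and comp1_assoc: "\<lbrakk>A \<in> Ob2 K; B \<in> Ob2 K; C \<in> Ob2 K; D \<in> Ob2 K;
        f \<in> Ob (Hom2 K A B); g \<in> Ob (Hom2 K B C); h \<in> Ob (Hom2 K C D)\<rbrakk>
      \<Longrightarrow> comp1 K A C D h (comp1 K A B C g f) = comp1 K A B D (comp1 K B C D h g) f"
    and comp2_assoc: "\<lbrakk>A \<in> Ob2 K; B \<in> Ob2 K; C \<in> Ob2 K; D \<in> Ob2 K;
        \<tau> \<in> Ar (Hom2 K A B); \<sigma> \<in> Ar (Hom2 K B C); \<rho> \<in> Ar (Hom2 K C D)\<rbrakk>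
      \<Longrightarrow> comp2 K A C D \<rho> (comp2 K A B C \<sigma> \<tau>) = comp2 K A B D (comp2 K B C D \<rho> \<sigma>) \<tau>"
    and comp1_units: "\<lbrakk>A \<in> Ob2 K; B \<in> Ob2 K; f \<in> Ob (Hom2 K A B)\<rbrakk>
      \<Longrightarrow> comp1 K A A B f (id1 K A) = f \<and> comp1 K A B B (id1 K B) f = f"
    and comp2_units: "\<lbrakk>A \<in> Ob2 K; B \<in> Ob2 K; \<tau> \<in> Ar (Hom2 K A B)\<rbrakk>
      \<Longrightarrow> comp2 K A A B \<tau> (id2 K A) = \<tau> \<and> comp2 K A B B (id2 K B) \<tau> = \<tau>"

text \<open>Cat-valued 2-functors; \<open>on1\<close> and \<open>on2\<close> take the source and target 0-cell as arguments, and
  \<open>on2 F A B \<tau>\<close> is the family of components of a natural transformation.\<close>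

record ('a, 'x, 'y, 'p, 'q) catfun =
  on0 :: "'a \<Rightarrow> ('p, 'q) cat"
  on1 :: "'a \<Rightarrow> 'a \<Rightarrow> 'x \<Rightarrow> ('p, 'q, 'p, 'q) fnc"
  on2 :: "'a \<Rightarrow> 'a \<Rightarrow> 'y \<Rightarrow> 'p \<Rightarrow> 'q"

locale two_functor = two_category K
  for K :: "('a, 'x, 'y) twocat" +
  fixes F :: "('a, 'x, 'y, 'p, 'q) catfun"
  assumes on0_category: "A \<in> Ob2 K \<Longrightarrow> category (on0 F A)"
    and on1_functor: "\<lbrakk>A \<in> Ob2 K; B \<in> Ob2 K; f \<in> Ob (Hom2 K A B)\<rbrakk>
      \<Longrightarrow> is_functor (on0 F A) (on0 F B) (on1 F A B f)"
    and on1_id: "A \<in> Ob2 K \<Longrightarrow> eq_fnc (on0 F A) (on1 F A A (id1 K A)) id_fnc"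
    and on1_comp: "\<lbrakk>A \<in> Ob2 K; B \<in> Ob2 K; C \<in> Ob2 K; f \<in> Ob (Hom2 K A B); g \<in> Ob (Hom2 K B C)\<rbrakk>
      \<Longrightarrow> eq_fnc (on0 F A) (on1 F A C (comp1 K A B C g f)) (comp_fnc (on1 F B C g) (on1 F A B f))"
    and on2_nat: "\<lbrakk>A \<in> Ob2 K; B \<in> Ob2 K; \<tau> \<in> hom (Hom2 K A B) f g\<rbrakk>
      \<Longrightarrow> nat_trans (on0 F A) (on0 F B) (on1 F A B f) (on1 F A B g) (on2 F A B \<tau>)"
    and on2_id: "\<lbrakk>A \<in> Ob2 K; B \<in> Ob2 K; f \<in> Ob (Hom2 K A B); x \<in> Ob (on0 F A)\<rbrakk>
      \<Longrightarrow> on2 F A B (Idt (Hom2 K A B) f) x = Idt (on0 F B) (fo (on1 F A B f) x)"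
    and on2_vert: "\<lbrakk>A \<in> Ob2 K; B \<in> Ob2 K; \<tau> \<in> hom (Hom2 K A B) f g; \<sigma> \<in> hom (Hom2 K A B) g h;
        x \<in> Ob (on0 F A)\<rbrakk>
      \<Longrightarrow> on2 F A B (\<sigma> \<cdot>\<^bsub>Hom2 K A B\<^esub> \<tau>) x = on2 F A B \<sigma> x \<cdot>\<^bsub>on0 F B\<^esub> on2 F A B \<tau> x"
    and on2_horiz: "\<lbrakk>A \<in> Ob2 K; B \<in> Ob2 K; C \<in> Ob2 K;
        \<tau> \<in> hom (Hom2 K A B) f f'; \<sigma> \<in> hom (Hom2 K B C) g g'; x \<in> Ob (on0 F A)\<rbrakk>
      \<Longrightarrow> on2 F A C (comp2 K A B C \<sigma> \<tau>) x
          = on2 F B C \<sigma> (fo (on1 F A B f') x) \<cdot>\<^bsub>on0 F C\<^esub> fa (on1 F B C g) (on2 F A B \<tau> x)"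

text \<open>\<open>\<Phi>\<close> is a 2-natural isomorphism \<open>Hom2 K h (-) \<cong> F\<close>: the first naturality condition is the
  one for 1-cells \<open>k\<close> (as an equality of functors \<open>Hom2 K h A \<rightarrow> F B\<close>), the second the one for
  2-cells \<open>\<tau>\<close>, which acts on \<open>Hom2 K h A\<close> by whiskering with the 1-cells \<open>f : h \<rightarrow> A\<close>.\<close>

definition represents :: "('a, 'x, 'y) twocat \<Rightarrow> ('a, 'x, 'y, 'p, 'q) catfun \<Rightarrow> 'a \<Rightarrow> bool" where
  "represents K F h \<longleftrightarrow> two_functor K F \<and> h \<in> Ob2 K \<and> (\<exists>\<Phi>.
     (\<forall>A \<in> Ob2 K. cat_iso (Hom2 K h A) (on0 F A) (\<Phi> A))
     \<and> (\<forall>A \<in> Ob2 K. \<forall>B \<in> Ob2 K. \<forall>k \<in> Ob (Hom2 K A B).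
          eq_fnc (Hom2 K h A)
            (comp_fnc (on1 F A B k) (\<Phi> A))
            (comp_fnc (\<Phi> B) \<lparr>fo = comp1 K h A B k, fa = comp2 K h A B (Idt (Hom2 K A B) k)\<rparr>))
     \<and> (\<forall>A \<in> Ob2 K. \<forall>B \<in> Ob2 K. \<forall>\<tau> \<in> Ar (Hom2 K A B). \<forall>f \<in> Ob (Hom2 K h A).
          on2 F A B \<tau> (fo (\<Phi> A) f) = fa (\<Phi> B) (comp2 K h A B \<tau> (Idt (Hom2 K h A) f))))"


section \<open>The 2-category of internal categories and categorical algebras\<close>

type_synonym 'm itrans = "'m ifun \<times> 'm \<times> 'm ifun"

definition ICat_hom :: "('o, 'm) cat \<Rightarrow> ('o, 'm) icat \<Rightarrow> ('o, 'm) icat \<Rightarrow> ('m ifun, 'm itrans) cat" where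
  "ICat_hom C A B = \<lparr>Ob = {f. internal_functor C A B f},
     Ar = {(f, \<tau>, g). internal_nat C A B f g \<tau>},
     Dom = (\<lambda>(f, \<tau>, g). f), Cod = (\<lambda>(f, \<tau>, g). g),
     Idt = (\<lambda>f. (f, iide B \<cdot>\<^bsub>C\<^esub> if0 f, f)),
     Comp = (\<lambda>(f', \<sigma>, g') (f, \<tau>, g). (f, icomp C B \<sigma> \<tau>, g'))\<rparr>"

definition ICat :: "('o, 'm) cat \<Rightarrow> (('o, 'm) icat, 'm ifun, 'm itrans) twocat" where
  "ICat C = \<lparr>Ob2 = {D. internal_category C D},
     Hom2 = ICat_hom C,
     id1 = id_ifun C,
     comp1 = (\<lambda>A B D. comp_ifun C),
     comp2 = (\<lambda>A B D (k, \<sigma>, k') (f, \<tau>, f').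
       (comp_ifun C k f, icomp C D (\<sigma> \<cdot>\<^bsub>C\<^esub> if0 f') (if1 k \<cdot>\<^bsub>C\<^esub> \<tau>), comp_ifun C k' f'))\<rparr>"

type_synonym ('o, 'm) cat_alg = "(('o, 'm) alg, ('o, 'm) alg_mor) icat"

definition CAlg :: "('o, 'm) cat \<Rightarrow> ('o, 'm) mnd
    \<Rightarrow> (('o, 'm) cat_alg, ('o, 'm) alg_mor ifun, ('o, 'm) alg_mor itrans) twocat" where
  "CAlg C T = ICat (Alg C T)"

text \<open>A categorical \<open>T\<close>-algebra \<open>A\<close> is the internal category \<open>carrier A\<close> in the base category
  together with the internal functor \<open>structure A : T (carrier A) \<rightarrow> carrier A\<close>.\<close>

definition carrier :: "('o, 'm) cat_alg \<Rightarrow> ('o, 'm) icat" where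
  "carrier A = map_icat forget A"

definition str_map :: "('o, 'm) cat_alg \<Rightarrow> 'm ifun" where
  "str_map A = \<lparr>if0 = snd (ic0 A), if1 = snd (ic1 A)\<rparr>"

text \<open>In the laws below, whiskering \<open>\<phi>\<close> with an internal functor \<open>k\<close> on the right is
  \<open>\<phi> \<cdot> if0 k\<close>, whiskering with \<open>k\<close> on the left is \<open>if1 k \<cdot> \<phi>\<close>, and the identity transformation of
  \<open>f\<close> is \<open>iide \<cdot> if0 f\<close>.\<close>

definition lax_morphism :: "('o, 'm) cat \<Rightarrow> ('o, 'm) mnd \<Rightarrow> ('o, 'm) cat_alg \<Rightarrow> ('o, 'm) cat_alg
    \<Rightarrow> 'm ifun \<Rightarrow> 'm \<Rightarrow> bool" where
  "lax_morphism C T A B f \<phi> \<longleftrightarrow> internal_functor C (carrier A) (carrier B) f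
     \<and> internal_nat C (map_icat (mfn T) (carrier A)) (carrier B)
         (comp_ifun C (str_map B) (map_ifun (mfn T) f)) (comp_ifun C f (str_map A)) \<phi>
     \<and> \<phi> \<cdot>\<^bsub>C\<^esub> unt T (ic0 (carrier A)) = iide (carrier B) \<cdot>\<^bsub>C\<^esub> if0 f
     \<and> \<phi> \<cdot>\<^bsub>C\<^esub> mult T (ic0 (carrier A))
         = icomp C (carrier B) (\<phi> \<cdot>\<^bsub>C\<^esub> ma T (if0 (str_map A))) (if1 (str_map B) \<cdot>\<^bsub>C\<^esub> ma T \<phi>)"

definition lax_transformation :: "('o, 'm) cat \<Rightarrow> ('o, 'm) mnd \<Rightarrow> ('o, 'm) cat_alg \<Rightarrow> ('o, 'm) cat_alg
    \<Rightarrow> 'm ifun \<times> 'm \<Rightarrow> 'm ifun \<times> 'm \<Rightarrow> 'm \<Rightarrow> bool" where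
  "lax_transformation C T A B F G \<tau> \<longleftrightarrow> (case F of (f, \<phi>) \<Rightarrow> case G of (g, \<psi>) \<Rightarrow>
     internal_nat C (carrier A) (carrier B) f g \<tau>
     \<and> icomp C (carrier B) \<psi> (if1 (str_map B) \<cdot>\<^bsub>C\<^esub> ma T \<tau>)
         = icomp C (carrier B) (\<tau> \<cdot>\<^bsub>C\<^esub> if0 (str_map A)) \<phi>)"

type_synonym 'm laxmor = "'m ifun \<times> 'm"

definition Lax_hom :: "('o, 'm) cat \<Rightarrow> ('o, 'm) mnd \<Rightarrow> ('o, 'm) cat_alg \<Rightarrow> ('o, 'm) cat_alg
    \<Rightarrow> ('m laxmor, 'm laxmor \<times> 'm \<times> 'm laxmor) cat" where
  "Lax_hom C T A B = \<lparr>Ob = {(f, \<phi>). lax_morphism C T A B f \<phi>},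
     Ar = {(F, \<tau>, G). lax_morphism C T A B (fst F) (snd F) \<and> lax_morphism C T A B (fst G) (snd G)
             \<and> lax_transformation C T A B F G \<tau>},
     Dom = (\<lambda>(F, \<tau>, G). F), Cod = (\<lambda>(F, \<tau>, G). G),
     Idt = (\<lambda>F. (F, iide (carrier B) \<cdot>\<^bsub>C\<^esub> if0 (fst F), F)),
     Comp = (\<lambda>(F', \<sigma>, G') (F, \<tau>, G). (F, icomp C (carrier B) \<sigma> \<tau>, G'))\<rparr>"

text \<open>Here \<open>t\<close> is a terminal object of the base category; it carries a unique \<open>T\<close>-algebra
  structure, and the discrete internal category on it is terminal.\<close>

definition terminal_cat_alg :: "('o, 'm) cat \<Rightarrow> ('o, 'm) mnd \<Rightarrow> 'o \<Rightarrow> ('o, 'm) cat_alg" where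
  "terminal_cat_alg C T t = discrete_icat (Alg C T) (t, bang C t (mo T t))"

text \<open>Strict morphisms and transformations of categorical algebras act on lax morphisms by
  composition and whiskering of their underlying internal functors and transformations.\<close>

definition push_lax :: "('o, 'm) cat \<Rightarrow> ('o, 'm) alg_mor ifun \<Rightarrow> 'm laxmor \<Rightarrow> 'm laxmor" where
  "push_lax C k F = (comp_ifun C (map_ifun forget k) (fst F), fa forget (if1 k) \<cdot>\<^bsub>C\<^esub> snd F)"

definition IAlg :: "('o, 'm) cat \<Rightarrow> ('o, 'm) mnd \<Rightarrow> 'o
    \<Rightarrow> (('o, 'm) cat_alg, ('o, 'm) alg_mor ifun, ('o, 'm) alg_mor itrans,
        'm laxmor, 'm laxmor \<times> 'm \<times> 'm laxmor) catfun" where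
  "IAlg C T t = \<lparr>on0 = Lax_hom C T (terminal_cat_alg C T t),
     on1 = (\<lambda>A B k. \<lparr>fo = push_lax C k,
       fa = (\<lambda>(F, \<tau>, G). (push_lax C k F, fa forget (if1 k) \<cdot>\<^bsub>C\<^esub> \<tau>, push_lax C k G))\<rparr>),
     on2 = (\<lambda>A B (k, \<sigma>, k') F.
       (push_lax C k F, fa forget \<sigma> \<cdot>\<^bsub>C\<^esub> if0 (fst F), push_lax C k' F))\<rparr>"

text \<open>Precomposition of a 2-functor with the levelwise extension of a functor \<open>d\<close>.\<close>

definition precomp :: "('o, 'm, 'p, 'n) fnc
    \<Rightarrow> (('p, 'n) icat, 'n ifun, 'n itrans, 'x, 'y) catfun
    \<Rightarrow> (('o, 'm) icat, 'm ifun, 'm itrans, 'x, 'y) catfun" where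
  "precomp d F = \<lparr>on0 = (\<lambda>A. on0 F (map_icat d A)),
     on1 = (\<lambda>A B k. on1 F (map_icat d A) (map_icat d B) (map_ifun d k)),
     on2 = (\<lambda>A B (k, \<sigma>, k').
       on2 F (map_icat d A) (map_icat d B) (map_ifun d k, fa d \<sigma>, map_ifun d k'))\<rparr>"


section \<open>Simplicial objects, nerves and bar constructions\<close>

text \<open>\<open>face X n i : X\<^sub>n \<rightarrow> X\<^sub>n\<^sub>-\<^sub>1\<close> (for \<open>n > 0\<close>) and \<open>degen X n i : X\<^sub>n \<rightarrow> X\<^sub>n\<^sub>+\<^sub>1\<close>, for \<open>i \<le> n\<close>.\<close>

record ('o, 'm) simp =
  sob :: "nat \<Rightarrow> 'o"
  face :: "nat \<Rightarrow> nat \<Rightarrow> 'm"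
  degen :: "nat \<Rightarrow> nat \<Rightarrow> 'm"

definition simplicial_object :: "('o, 'm) cat \<Rightarrow> ('o, 'm) simp \<Rightarrow> bool" where
  "simplicial_object C X \<longleftrightarrow> (\<forall>n. sob X n \<in> Ob C)
     \<and> (\<forall>n i. i \<le> Suc n \<longrightarrow> face X (Suc n) i \<in> hom C (sob X (Suc n)) (sob X n))
     \<and> (\<forall>n i. i \<le> n \<longrightarrow> degen X n i \<in> hom C (sob X n) (sob X (Suc n)))
     \<and> (\<forall>n i j. i < j \<and> j \<le> n + 2 \<longrightarrow>
          face X (n + 1) i \<cdot>\<^bsub>C\<^esub> face X (n + 2) j = face X (n + 1) (j - 1) \<cdot>\<^bsub>C\<^esub> face X (n + 2) i)
     \<and> (\<forall>n i j. i < j \<and> j \<le> n + 1 \<longrightarrow>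
          face X (n + 2) i \<cdot>\<^bsub>C\<^esub> degen X (n + 1) j = degen X n (j - 1) \<cdot>\<^bsub>C\<^esub> face X (n + 1) i)
     \<and> (\<forall>n j. j \<le> n \<longrightarrow> face X (n + 1) j \<cdot>\<^bsub>C\<^esub> degen X n j = Idt C (sob X n)
          \<and> face X (n + 1) (j + 1) \<cdot>\<^bsub>C\<^esub> degen X n j = Idt C (sob X n))
     \<and> (\<forall>n i j. j + 1 < i \<and> i \<le> n + 2 \<longrightarrow>
          face X (n + 2) i \<cdot>\<^bsub>C\<^esub> degen X (n + 1) j = degen X n j \<cdot>\<^bsub>C\<^esub> face X (n + 1) (i - 1))
     \<and> (\<forall>n i j. i \<le> j \<and> j \<le> n \<longrightarrow>
          degen X (n + 1) i \<cdot>\<^bsub>C\<^esub> degen X n j = degen X (n + 1) (j + 1) \<cdot>\<^bsub>C\<^esub> degen X n i)"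

definition map_simp :: "('o, 'm, 'p, 'n) fnc \<Rightarrow> ('o, 'm) simp \<Rightarrow> ('p, 'n) simp" where
  "map_simp F X = \<lparr>sob = (\<lambda>n. fo F (sob X n)), face = (\<lambda>n i. fa F (face X n i)),
     degen = (\<lambda>n i. fa F (degen X n i))\<rparr>"

definition simp_isomorphic :: "('o, 'm) cat \<Rightarrow> ('o, 'm) simp \<Rightarrow> ('o, 'm) simp \<Rightarrow> bool" where
  "simp_isomorphic C X Y \<longleftrightarrow> simplicial_object C X \<and> simplicial_object C Y \<and> (\<exists>\<theta>.
     (\<forall>n. \<theta> n \<in> hom C (sob X n) (sob Y n) \<and> is_iso C (\<theta> n))
     \<and> (\<forall>n i. i \<le> Suc n \<longrightarrow> \<theta> n \<cdot>\<^bsub>C\<^esub> face X (Suc n) i = face Y (Suc n) i \<cdot>\<^bsub>C\<^esub> \<theta> (Suc n))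
     \<and> (\<forall>n i. i \<le> n \<longrightarrow> \<theta> (Suc n) \<cdot>\<^bsub>C\<^esub> degen X n i = degen Y n i \<cdot>\<^bsub>C\<^esub> \<theta> n))"

text \<open>An \<open>n\<close>-simplex of a nerve is a chain \<open>(g\<^sub>0, \<dots>, g\<^sub>n\<^sub>-\<^sub>1)\<close> with \<open>source g\<^sub>i = target g\<^sub>i\<^sub>+\<^sub>1\<close>, listed in
  the order of composition \<open>g\<^sub>0 \<circ> \<dots> \<circ> g\<^sub>n\<^sub>-\<^sub>1\<close>; the face \<open>0\<close> drops \<open>g\<^sub>0\<close>. In particular, on
  1-simplices the face \<open>0\<close> is the source and the face \<open>1\<close> is the target. This is the convention
  under which the usual numbering of the bar construction makes the action the source map.
  \<open>edge C X n i : X\<^sub>n \<rightarrow> X\<^sub>1\<close> is the projection to \<open>g\<^sub>i\<close>, for \<open>i < n\<close>.\<close>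

fun edge :: "('o, 'm) cat \<Rightarrow> ('o, 'm) simp \<Rightarrow> nat \<Rightarrow> nat \<Rightarrow> 'm" where
  "edge C X 0 i = undefined"
| "edge C X (Suc 0) i = Idt C (sob X 1)"
| "edge C X (Suc (Suc n)) i =
     (if i \<le> n then edge C X (Suc n) i \<cdot>\<^bsub>C\<^esub> face X (n + 2) (n + 2)
      else edge C X (Suc n) n \<cdot>\<^bsub>C\<^esub> face X (n + 2) 0)"

text \<open>\<open>X\<close> is the nerve of \<open>D\<close>: \<open>X\<^sub>n\<close> is the limit \<open>D\<^sub>1 \<times>\<^bsub>D\<^sub>0\<^esub> \<dots> \<times>\<^bsub>D\<^sub>0\<^esub> D\<^sub>1\<close> of composable chains, and
  in low degrees the simplicial operators are the structure maps of \<open>D\<close>. The operators in higher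
  degrees are then determined by the simplicial identities. The limit used in degree 2 is the one
  contained in \<open>D\<close>.\<close>

definition is_nerve :: "('o, 'm) cat \<Rightarrow> ('o, 'm) icat \<Rightarrow> ('o, 'm) simp \<Rightarrow> bool" where
  "is_nerve C D X \<longleftrightarrow> internal_category C D \<and> simplicial_object C X
     \<and> sob X 0 = ic0 D \<and> sob X 1 = ic1 D \<and> sob X 2 = ic2 D
     \<and> face X 1 0 = isrc D \<and> face X 1 1 = itgt D \<and> degen X 0 0 = iide D
     \<and> face X 2 2 = ipr1 D \<and> face X 2 1 = icmp D \<and> face X 2 0 = ipr2 D
     \<and> (\<forall>n x g. 0 < n \<and> (\<forall>i < n. g i \<in> hom C x (ic1 D))
          \<and> (\<forall>i. Suc i < n \<longrightarrow> isrc D \<cdot>\<^bsub>C\<^esub> g i = itgt D \<cdot>\<^bsub>C\<^esub> g (Suc i))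
          \<longrightarrow> (\<exists>!k. k \<in> hom C x (sob X n) \<and> (\<forall>i < n. edge C X n i \<cdot>\<^bsub>C\<^esub> k = g i)))"

text \<open>The bar construction \<open>B(G, T, 1)\<close> in \<open>D\<close> for a functor \<open>G : E \<rightarrow> D\<close> with a right action
  \<open>act : G T \<Rightarrow> G\<close>, where \<open>t\<close> is a terminal object of \<open>E\<close>.\<close>

definition bar :: "('p, 'n) cat \<Rightarrow> ('p, 'n) mnd \<Rightarrow> 'p \<Rightarrow> ('p, 'n, 'o, 'm) fnc \<Rightarrow> ('p \<Rightarrow> 'm)
    \<Rightarrow> ('o, 'm) simp" where
  "bar E T t G act = \<lparr>sob = (\<lambda>k. fo G ((mo T ^^ k) t)),
     face = (\<lambda>k i.
       if i = 0 then act ((mo T ^^ (k - 1)) t)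
       else if i < k then fa G ((ma T ^^ (i - 1)) (mult T ((mo T ^^ (k - 1 - i)) t)))
       else fa G ((ma T ^^ (k - 1)) (bang E t (mo T t)))),
     degen = (\<lambda>k i. fa G ((ma T ^^ i) (unt T ((mo T ^^ (k - i)) t))))\<rparr>"

text \<open>The cotriple resolution \<open>B(T, T, 1)\<close> of the terminal \<open>T\<close>-algebra, as a simplicial \<open>T\<close>-algebra.\<close>

definition bar_TT1 :: "('p, 'n) cat \<Rightarrow> ('p, 'n) mnd \<Rightarrow> 'p \<Rightarrow> (('p, 'n) alg, ('p, 'n) alg_mor) simp" where
  "bar_TT1 E T t = bar E T t (free E T) (free_action T)"

text \<open>The internal category with nerve \<open>B(T, T, 1)\<close>: source \<open>\<mu>\<^sub>1\<close>, target \<open>T(!)\<close>, identities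
  \<open>T(\<epsilon>\<^sub>1)\<close>, composition \<open>T(\<mu>\<^sub>1) : T\<^sup>3(1) \<rightarrow> T\<^sup>2(1)\<close>.\<close>

definition HT :: "('p, 'n) cat \<Rightarrow> ('p, 'n) mnd \<Rightarrow> 'p \<Rightarrow> ('p, 'n) cat_alg" where
  "HT E T t = (let X = bar_TT1 E T t in
     \<lparr>ic0 = sob X 0, ic1 = sob X 1, ic2 = sob X 2,
      isrc = face X 1 0, itgt = face X 1 1, iide = degen X 0 0,
      ipr1 = face X 2 2, ipr2 = face X 2 0, icmp = face X 2 1\<rparr>)"

end

theory Submission
  imports Defs
begin

text \<open>
  Write \<open>U\<close>, \<open>F\<close> for the forgetful functors and their left adjoints. Two facts carry the proof.

  The first is that the values of \<open>p\<close> on free algebras are known. Both \<open>p F\<^sup>T\<close> and \<open>G = F\<^sup>S c\<close> are left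
  adjoint to the same functor \<open>V = U\<^sup>T d = w U\<^sup>S\<close>, so they are isomorphic, and under this isomorphism
  \<open>p\<close> of the free action \<open>F\<^sup>T U\<^sup>T F\<^sup>T \<Rightarrow> F\<^sup>T\<close> becomes the canonical action, since both transpose to the
  monad map \<open>T x \<rightarrow> w S c x\<close> (\<open>compare_action\<close>). Hence \<open>p\<close> takes the cotriple resolution \<open>B(T, T, 1)\<close> to
  a simplicial object isomorphic to \<open>B(G, T, 1)\<close>. The square \<open>d\<^sub>0 d\<^sub>n\<^sub>+\<^sub>2 = d\<^sub>n\<^sub>+\<^sub>1 d\<^sub>0\<close> of a bar construction is
  a naturality square of the action. If the action is cartesian, all these squares are pullbacks, and
  a simplicial object with this property is the nerve of the internal category that one reads off
  from its first three terms (\<open>segal_bar\<close>, \<open>is_nerve_trunc\<close>). This is how \<open>h = p(H\<^sup>T)\<close> is seen to be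
  an internal category although \<open>p\<close> need not preserve pullbacks.

  The second is that maps out of \<open>h\<close> are controlled by an adjunction alone. The objects of \<open>h\<close> in
  dimensions 0, 1, 2 are \<open>p F\<^sup>T 1\<close>, \<open>p F\<^sup>T T 1\<close>, \<open>p F\<^sup>T T T 1\<close>, so an internal functor \<open>h \<rightarrow> A\<close> transposes to a
  pair of arrows \<open>x : 1 \<rightarrow> V A\<^sub>0\<close> and \<open>\<phi> : T 1 \<rightarrow> V A\<^sub>1\<close>. Precomposing with \<open>p F\<^sup>T f\<close> transposes to precomposing with
  \<open>f\<close>, and precomposing with \<open>p\<close> of the free action transposes to applying \<open>T\<close> followed by the algebra
  structure of \<open>d A\<close> (\<open>transpose_action\<close>). Under these rules the conditions on source,
  target, identities and composition of an internal functor become the conditions on source and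
  target of \<open>\<phi>\<close>, the unit law and the multiplication law of an internal algebra
  (\<open>functor_iff_internal_algebra\<close>). Transformations correspond in the same way, and naturality in \<open>A\<close> is
  the naturality of transposition (\<open>represents_internal_algebras\<close>).

  That \<open>A \<mapsto> IAlg\<^sub>T(d A)\<close> is a 2-functor is obtained along the way: its categories and actions
  are identified with those of \<open>Hom(h, -)\<close>, from which the laws are inherited (\<open>representation\<close>).
\<close>

section \<open>Categories and functors\<close>

context category
begin

lemma ar_comp [simp]: "f \<in> Ar C \<Longrightarrow> g \<in> Ar C \<Longrightarrow> Cod C f = Dom C g \<Longrightarrow> g \<cdot>\<^bsub>C\<^esub> f \<in> Ar C"
  and dom_comp [simp]: "f \<in> Ar C \<Longrightarrow> g \<in> Ar C \<Longrightarrow> Cod C f = Dom C g \<Longrightarrow> Dom C (g \<cdot>\<^bsub>C\<^esub> f) = Dom C f"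
  and cod_comp [simp]: "f \<in> Ar C \<Longrightarrow> g \<in> Ar C \<Longrightarrow> Cod C f = Dom C g \<Longrightarrow> Cod C (g \<cdot>\<^bsub>C\<^esub> f) = Cod C g"
  using comp_in[of f "Dom C f" "Cod C f" g "Cod C g"] by (auto simp: hom_def)

lemma id_ar [simp]: "a \<in> Ob C \<Longrightarrow> Idt C a \<in> Ar C"
  and id_dom [simp]: "a \<in> Ob C \<Longrightarrow> Dom C (Idt C a) = a"
  and id_cod [simp]: "a \<in> Ob C \<Longrightarrow> Cod C (Idt C a) = a"
  using id_in[of a] by (auto simp: hom_def)

lemma comp_id_left [simp]: "f \<in> Ar C \<Longrightarrow> Cod C f = b \<Longrightarrow> Idt C b \<cdot>\<^bsub>C\<^esub> f = f"
  and comp_id_right [simp]: "f \<in> Ar C \<Longrightarrow> Dom C f = a \<Longrightarrow> f \<cdot>\<^bsub>C\<^esub> Idt C a = f"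
  using id_left id_right by (auto simp: hom_def)

lemma comp_assoc: "f \<in> Ar C \<Longrightarrow> g \<in> Ar C \<Longrightarrow> h \<in> Ar C \<Longrightarrow> Cod C f = Dom C g \<Longrightarrow> Cod C g = Dom C h
    \<Longrightarrow> (h \<cdot>\<^bsub>C\<^esub> g) \<cdot>\<^bsub>C\<^esub> f = h \<cdot>\<^bsub>C\<^esub> g \<cdot>\<^bsub>C\<^esub> f"
  using assoc[of f "Dom C f" "Cod C f" g "Cod C g" h "Cod C h"] by (auto simp: hom_def)

declare dom_in [simp] cod_in [simp]

text \<open>Composites are kept bracketed to the right; this turns an equation between composites into
  one that applies inside a longer right-bracketed composite.\<close>

lemma comp_reassoc: "g \<cdot>\<^bsub>C\<^esub> f = k \<Longrightarrow> f \<in> Ar C \<Longrightarrow> g \<in> Ar C \<Longrightarrow> Cod C f = Dom C g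
    \<Longrightarrow> x \<in> Ar C \<Longrightarrow> Cod C x = Dom C f \<Longrightarrow> g \<cdot>\<^bsub>C\<^esub> f \<cdot>\<^bsub>C\<^esub> x = k \<cdot>\<^bsub>C\<^esub> x"
  using comp_assoc[of x f g] by simp

lemma is_isoE:
  assumes "is_iso C f"
  obtains g where "f \<in> Ar C" "g \<in> Ar C" "Dom C g = Cod C f" "Cod C g = Dom C f"
    "g \<cdot>\<^bsub>C\<^esub> f = Idt C (Dom C f)" "f \<cdot>\<^bsub>C\<^esub> g = Idt C (Cod C f)"
  using assms by (auto simp: is_iso_def hom_def)

lemma iso_cancel_left:
  assumes "is_iso C i" "f \<in> Ar C" "g \<in> Ar C" "Cod C f = Dom C i" "Cod C g = Dom C i"
    "i \<cdot>\<^bsub>C\<^esub> f = i \<cdot>\<^bsub>C\<^esub> g"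
  shows "f = g"
proof -
  obtain j where j: "i \<in> Ar C" "j \<in> Ar C" "Dom C j = Cod C i" "Cod C j = Dom C i"
    "j \<cdot>\<^bsub>C\<^esub> i = Idt C (Dom C i)" using assms(1) by (rule is_isoE)
  have "j \<cdot>\<^bsub>C\<^esub> i \<cdot>\<^bsub>C\<^esub> f = j \<cdot>\<^bsub>C\<^esub> i \<cdot>\<^bsub>C\<^esub> g" using assms(6) by simp
  then show ?thesis using j assms(2-5) comp_reassoc[OF j(5)] by simp
qed

lemma iso_cancel_right:
  assumes "is_iso C i" "f \<in> Ar C" "g \<in> Ar C" "Dom C f = Cod C i" "Dom C g = Cod C i"
    "f \<cdot>\<^bsub>C\<^esub> i = g \<cdot>\<^bsub>C\<^esub> i"
  shows "f = g"
proof -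
  obtain j where j: "i \<in> Ar C" "j \<in> Ar C" "Dom C j = Cod C i" "Cod C j = Dom C i"
    "i \<cdot>\<^bsub>C\<^esub> j = Idt C (Cod C i)" using assms(1) by (rule is_isoE)
  have "(f \<cdot>\<^bsub>C\<^esub> i) \<cdot>\<^bsub>C\<^esub> j = (g \<cdot>\<^bsub>C\<^esub> i) \<cdot>\<^bsub>C\<^esub> j" using assms(6) by simp
  then show ?thesis using j assms(2-5) by (simp add: comp_assoc)
qed

lemma pullbackD:
  assumes "pullback C f g p q"
  shows "f \<in> Ar C" "g \<in> Ar C" "p \<in> Ar C" "q \<in> Ar C" "Cod C f = Cod C g" "Dom C p = Dom C q"
    "Cod C p = Dom C f" "Cod C q = Dom C g" "f \<cdot>\<^bsub>C\<^esub> p = g \<cdot>\<^bsub>C\<^esub> q"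
  using assms by (auto simp: pullback_def)

lemma pullback_factor:
  assumes "pullback C f g p q" "h \<in> Ar C" "k \<in> Ar C" "Dom C h = x" "Dom C k = x" "Cod C h = Dom C f"
    "Cod C k = Dom C g" "f \<cdot>\<^bsub>C\<^esub> h = g \<cdot>\<^bsub>C\<^esub> k"
  obtains m where "m \<in> Ar C" "Dom C m = x" "Cod C m = Dom C p" "p \<cdot>\<^bsub>C\<^esub> m = h" "q \<cdot>\<^bsub>C\<^esub> m = k"
proof -
  have "\<exists>!m. m \<in> hom C x (Dom C p) \<and> p \<cdot>\<^bsub>C\<^esub> m = h \<and> q \<cdot>\<^bsub>C\<^esub> m = k"
  proof -
    have "h \<in> hom C x (Dom C f)" "k \<in> hom C x (Dom C g)"
      using assms by (simp_all add: hom_def)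
    then show ?thesis using assms(1,8) unfolding pullback_def by blast
  qed
  then show ?thesis using that by (auto simp: hom_def)
qed

lemma pullback_unique:
  assumes pb: "pullback C f g p q" and m: "m \<in> Ar C" "Cod C m = Dom C p" "m' \<in> Ar C" "Cod C m' = Dom C p"
    "Dom C m = Dom C m'" and e: "p \<cdot>\<^bsub>C\<^esub> m = p \<cdot>\<^bsub>C\<^esub> m'" "q \<cdot>\<^bsub>C\<^esub> m = q \<cdot>\<^bsub>C\<^esub> m'"
  shows "m = m'"
proof -
  note ty = pullbackD[OF pb]
  have "f \<cdot>\<^bsub>C\<^esub> p \<cdot>\<^bsub>C\<^esub> m = g \<cdot>\<^bsub>C\<^esub> q \<cdot>\<^bsub>C\<^esub> m"
    using ty m by (simp flip: comp_assoc)
  moreover have "p \<cdot>\<^bsub>C\<^esub> m \<in> hom C (Dom C m) (Dom C f)" "q \<cdot>\<^bsub>C\<^esub> m \<in> hom C (Dom C m) (Dom C g)"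
    using ty m by (simp_all add: hom_def)
  ultimately have "\<exists>!n. n \<in> hom C (Dom C m) (Dom C p) \<and> p \<cdot>\<^bsub>C\<^esub> n = p \<cdot>\<^bsub>C\<^esub> m \<and> q \<cdot>\<^bsub>C\<^esub> n = q \<cdot>\<^bsub>C\<^esub> m"
    using pb unfolding pullback_def by blast
  moreover have "m \<in> hom C (Dom C m) (Dom C p)" "m' \<in> hom C (Dom C m) (Dom C p)"
    using m by (simp_all add: hom_def)
  ultimately show ?thesis using e by metis
qed

lemma pullbackI:
  assumes "f \<in> Ar C" "g \<in> Ar C" "p \<in> Ar C" "q \<in> Ar C" "Cod C f = Cod C g" "Dom C p = Dom C q"
    "Cod C p = Dom C f" "Cod C q = Dom C g" "f \<cdot>\<^bsub>C\<^esub> p = g \<cdot>\<^bsub>C\<^esub> q"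
    and ex: "\<And>x h k. h \<in> Ar C \<Longrightarrow> k \<in> Ar C \<Longrightarrow> Dom C h = x \<Longrightarrow> Dom C k = x \<Longrightarrow> Cod C h = Dom C f \<Longrightarrow> Cod C k = Dom C g
      \<Longrightarrow> f \<cdot>\<^bsub>C\<^esub> h = g \<cdot>\<^bsub>C\<^esub> k
      \<Longrightarrow> \<exists>m. m \<in> Ar C \<and> Dom C m = x \<and> Cod C m = Dom C p \<and> p \<cdot>\<^bsub>C\<^esub> m = h \<and> q \<cdot>\<^bsub>C\<^esub> m = k"
    and un: "\<And>x m m'. m \<in> Ar C \<Longrightarrow> m' \<in> Ar C \<Longrightarrow> Dom C m = x \<Longrightarrow> Dom C m' = x \<Longrightarrow> Cod C m = Dom C p
      \<Longrightarrow> Cod C m' = Dom C p \<Longrightarrow> p \<cdot>\<^bsub>C\<^esub> m = p \<cdot>\<^bsub>C\<^esub> m' \<Longrightarrow> q \<cdot>\<^bsub>C\<^esub> m = q \<cdot>\<^bsub>C\<^esub> m' \<Longrightarrow> m = m'"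
  shows "pullback C f g p q"
  unfolding pullback_def
proof (intro conjI allI ballI impI assms)
  fix x h k assume h: "h \<in> hom C x (Dom C f)" "k \<in> hom C x (Dom C g)" "f \<cdot>\<^bsub>C\<^esub> h = g \<cdot>\<^bsub>C\<^esub> k"
  then obtain m where m: "m \<in> hom C x (Dom C p)" "p \<cdot>\<^bsub>C\<^esub> m = h" "q \<cdot>\<^bsub>C\<^esub> m = k"
    using ex[of h k] by (auto simp: hom_def)
  show "\<exists>!m. m \<in> hom C x (Dom C p) \<and> p \<cdot>\<^bsub>C\<^esub> m = h \<and> q \<cdot>\<^bsub>C\<^esub> m = k"
  proof (rule ex1I[of _ m])
    fix n assume "n \<in> hom C x (Dom C p) \<and> p \<cdot>\<^bsub>C\<^esub> n = h \<and> q \<cdot>\<^bsub>C\<^esub> n = k"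
    then show "n = m" using un[of n m] m by (simp add: hom_def)
  qed (use m in simp)
qed

lemma pullback_swap: "pullback C f g p q \<Longrightarrow> pullback C g f q p"
proof -
  assume pb: "pullback C f g p q"
  note ty = pullbackD[OF pb]
  show ?thesis
  proof (rule pullbackI)
    fix x h k assume "h \<in> Ar C" "k \<in> Ar C" "Dom C h = x" "Dom C k = x" "Cod C h = Dom C g" "Cod C k = Dom C f"
      "g \<cdot>\<^bsub>C\<^esub> h = f \<cdot>\<^bsub>C\<^esub> k"
    then show "\<exists>m. m \<in> Ar C \<and> Dom C m = x \<and> Cod C m = Dom C q \<and> q \<cdot>\<^bsub>C\<^esub> m = h \<and> p \<cdot>\<^bsub>C\<^esub> m = k"
      using pullback_factor[OF pb, of k h x] ty(6) by metis
  next
    fix x m m' assume "m \<in> Ar C" "m' \<in> Ar C" "Dom C m = x" "Dom C m' = x" "Cod C m = Dom C q" "Cod C m' = Dom C q"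
      "q \<cdot>\<^bsub>C\<^esub> m = q \<cdot>\<^bsub>C\<^esub> m'" "p \<cdot>\<^bsub>C\<^esub> m = p \<cdot>\<^bsub>C\<^esub> m'"
    then show "m = m'" using pullback_unique[OF pb, of m m'] ty(6) by metis
  qed (use ty in metis)+
qed

end

lemma (in is_functor) fa_ar [simp]: "f \<in> Ar A \<Longrightarrow> fa F f \<in> Ar B"
  and fa_dom [simp]: "f \<in> Ar A \<Longrightarrow> Dom B (fa F f) = fo F (Dom A f)"
  and fa_cod [simp]: "f \<in> Ar A \<Longrightarrow> Cod B (fa F f) = fo F (Cod A f)"
  using fa_in[of f "Dom A f" "Cod A f"] by (auto simp: hom_def)

lemma (in is_functor) fa_comp' [simp]: "f \<in> Ar A \<Longrightarrow> g \<in> Ar A \<Longrightarrow> Cod A f = Dom A g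
    \<Longrightarrow> fa F (g \<cdot>\<^bsub>A\<^esub> f) = fa F g \<cdot>\<^bsub>B\<^esub> fa F f"
  using fa_comp[of f "Dom A f" "Cod A f" g "Cod A g"] by (auto simp: hom_def)

declare (in is_functor) fo_in [simp] fa_id [simp]

lemma comp_fnc_simps [simp]: "fo (comp_fnc G F) a = fo G (fo F a)" "fa (comp_fnc G F) f = fa G (fa F f)"
  by (simp_all add: comp_fnc_def)

lemma id_fnc_simps [simp]: "fo id_fnc a = a" "fa id_fnc f = f"
  by (simp_all add: id_fnc_def)

lemma (in category) is_functor_id: "is_functor C C id_fnc"
  by unfold_locales (auto simp: hom_def)

lemma is_functor_comp: "is_functor A B F \<Longrightarrow> is_functor B C G \<Longrightarrow> is_functor A C (comp_fnc G F)"
proof -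
  assume "is_functor A B F" "is_functor B C G"
  then interpret F: is_functor A B F + G: is_functor B C G by simp_all
  show ?thesis by unfold_locales (auto simp: hom_def)
qed

lemma is_functor_cong: "is_functor A B F \<Longrightarrow> eq_fnc A F G \<Longrightarrow> is_functor A B G"
proof -
  assume F: "is_functor A B F" and e: "eq_fnc A F G"
  then interpret F: is_functor A B F by simp
  have o: "a \<in> Ob A \<Longrightarrow> fo G a = fo F a" and a: "f \<in> Ar A \<Longrightarrow> fa G f = fa F f" for a f
    using e by (auto simp: eq_fnc_def)
  show ?thesis by unfold_locales (auto simp: hom_def o a)
qed


section \<open>Adjunctions\<close>

locale adj =
  fixes A :: "('o, 'm) cat" and B :: "('p, 'n) cat" and F :: "('o, 'm, 'p, 'n) fnc"
    and U :: "('p, 'n, 'o, 'm) fnc" and u :: "'o \<Rightarrow> 'm" and v :: "'p \<Rightarrow> 'n"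
  assumes adjunction: "adjunction A B F U u v"
begin

sublocale F: is_functor A B F using adjunction by (simp add: adjunction_def)
sublocale U: is_functor B A U using adjunction by (simp add: adjunction_def)

lemma unit [simp]: "a \<in> Ob A \<Longrightarrow> u a \<in> Ar A" "a \<in> Ob A \<Longrightarrow> Dom A (u a) = a"
    "a \<in> Ob A \<Longrightarrow> Cod A (u a) = fo U (fo F a)"
  using adjunction by (auto simp: adjunction_def nat_trans_def hom_def)

lemma counit [simp]: "b \<in> Ob B \<Longrightarrow> v b \<in> Ar B" "b \<in> Ob B \<Longrightarrow> Dom B (v b) = fo F (fo U b)"
    "b \<in> Ob B \<Longrightarrow> Cod B (v b) = b"
  using adjunction by (auto simp: adjunction_def nat_trans_def hom_def)

lemma unit_nat: "f \<in> Ar A \<Longrightarrow> Dom A f = a \<Longrightarrow> Cod A f = b \<Longrightarrow> fa U (fa F f) \<cdot>\<^bsub>A\<^esub> u a = u b \<cdot>\<^bsub>A\<^esub> f"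
  using adjunction by (auto simp: adjunction_def nat_trans_def)

lemma counit_nat: "f \<in> Ar B \<Longrightarrow> Dom B f = a \<Longrightarrow> Cod B f = b \<Longrightarrow> f \<cdot>\<^bsub>B\<^esub> v a = v b \<cdot>\<^bsub>B\<^esub> fa F (fa U f)"
  using adjunction by (auto simp: adjunction_def nat_trans_def)

lemma triangle_F: "a \<in> Ob A \<Longrightarrow> v (fo F a) \<cdot>\<^bsub>B\<^esub> fa F (u a) = Idt B (fo F a)"
  and triangle_U: "b \<in> Ob B \<Longrightarrow> fa U (v b) \<cdot>\<^bsub>A\<^esub> u (fo U b) = Idt A (fo U b)"
  using adjunction by (auto simp: adjunction_def)

definition transpose :: "'o \<Rightarrow> 'n \<Rightarrow> 'm" where "transpose a f = fa U f \<cdot>\<^bsub>A\<^esub> u a"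

lemma transpose_ar [simp]: "a \<in> Ob A \<Longrightarrow> f \<in> Ar B \<Longrightarrow> Dom B f = fo F a \<Longrightarrow> transpose a f \<in> Ar A"
  and transpose_dom [simp]: "a \<in> Ob A \<Longrightarrow> f \<in> Ar B \<Longrightarrow> Dom B f = fo F a \<Longrightarrow> Dom A (transpose a f) = a"
  and transpose_cod [simp]: "a \<in> Ob A \<Longrightarrow> f \<in> Ar B \<Longrightarrow> Dom B f = fo F a
    \<Longrightarrow> Cod A (transpose a f) = fo U (Cod B f)"
  by (simp_all add: transpose_def)

lemma counit_transpose:
  assumes "a \<in> Ob A" "f \<in> Ar B" "Dom B f = fo F a"
  shows "v (Cod B f) \<cdot>\<^bsub>B\<^esub> fa F (transpose a f) = f"
proof -
  have "v (Cod B f) \<cdot>\<^bsub>B\<^esub> fa F (fa U f \<cdot>\<^bsub>A\<^esub> u a) = (v (Cod B f) \<cdot>\<^bsub>B\<^esub> fa F (fa U f)) \<cdot>\<^bsub>B\<^esub> fa F (u a)"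
    using assms by (simp add: F.B.comp_assoc)
  also have "\<dots> = (f \<cdot>\<^bsub>B\<^esub> v (Dom B f)) \<cdot>\<^bsub>B\<^esub> fa F (u a)"
    using assms counit_nat[of f] by simp
  also have "\<dots> = f" using assms by (simp add: F.B.comp_assoc triangle_F)
  finally show ?thesis by (simp add: transpose_def)
qed

lemma transpose_counit:
  assumes "b \<in> Ob B" "g \<in> Ar A" "Cod A g = fo U b" "Dom A g = a"
  shows "transpose a (v b \<cdot>\<^bsub>B\<^esub> fa F g) = g"
proof -
  have [simp]: "a \<in> Ob A" using assms by auto
  have "transpose a (v b \<cdot>\<^bsub>B\<^esub> fa F g) = fa U (v b) \<cdot>\<^bsub>A\<^esub> u (fo U b) \<cdot>\<^bsub>A\<^esub> g"
    using assms unit_nat[of g] by (simp add: transpose_def F.A.comp_assoc)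
  also have "\<dots> = g" using assms F.A.comp_reassoc[OF triangle_U] by simp
  finally show ?thesis .
qed

lemma transpose_inj:
  assumes "transpose a f = transpose a g" "a \<in> Ob A" "f \<in> Ar B" "g \<in> Ar B" "Dom B f = fo F a"
    "Dom B g = fo F a" "Cod B f = Cod B g"
  shows "f = g"
  using counit_transpose[of a f] counit_transpose[of a g] assms by metis

lemma transpose_surj:
  assumes "b \<in> Ob B" "g \<in> Ar A" "Cod A g = fo U b" "Dom A g = a"
  obtains f where "f \<in> Ar B" "Dom B f = fo F a" "Cod B f = b" "transpose a f = g"
proof -
  have [simp]: "a \<in> Ob A" using assms by auto
  show ?thesis using that[of "v b \<cdot>\<^bsub>B\<^esub> fa F g"] assms transpose_counit[OF assms] by simp
qed

lemma transpose_post: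
  assumes "a \<in> Ob A" "f \<in> Ar B" "Dom B f = fo F a" "g \<in> Ar B" "Dom B g = Cod B f"
  shows "transpose a (g \<cdot>\<^bsub>B\<^esub> f) = fa U g \<cdot>\<^bsub>A\<^esub> transpose a f"
  using assms by (simp add: transpose_def F.A.comp_assoc)

lemma transpose_pre:
  assumes "g \<in> Ar A" "Dom A g = a'" "Cod A g = a" "f \<in> Ar B" "Dom B f = fo F a"
  shows "transpose a' (f \<cdot>\<^bsub>B\<^esub> fa F g) = transpose a f \<cdot>\<^bsub>A\<^esub> g"
proof -
  have [simp]: "a \<in> Ob A" "a' \<in> Ob A" using assms by auto
  show ?thesis using assms unit_nat[of g a' a] by (simp add: transpose_def F.A.comp_assoc)
qed

lemma transpose_id: "a \<in> Ob A \<Longrightarrow> transpose a (Idt B (fo F a)) = u a"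
  by (simp add: transpose_def)

text \<open>A cone over the image of a square under \<open>U\<close> transposes to a cone over the square itself.\<close>

lemma right_adjoint_pullback:
  assumes pb: "pullback B f g p q"
  shows "pullback A (fa U f) (fa U g) (fa U p) (fa U q)"
proof -
  note ty = F.B.pullbackD[OF pb]
  show ?thesis
  proof (rule F.A.pullbackI)
    show "fa U f \<cdot>\<^bsub>A\<^esub> fa U p = fa U g \<cdot>\<^bsub>A\<^esub> fa U q" using ty by (simp flip: U.fa_comp')
  next
    fix x h k assume h: "h \<in> Ar A" "k \<in> Ar A" "Dom A h = x" "Dom A k = x" "Cod A h = Dom A (fa U f)"
      "Cod A k = Dom A (fa U g)" and e: "fa U f \<cdot>\<^bsub>A\<^esub> h = fa U g \<cdot>\<^bsub>A\<^esub> k"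
    have [simp]: "x \<in> Ob A" using h(1,3) by auto
    obtain h' where h': "h' \<in> Ar B" "Dom B h' = fo F x" "Cod B h' = Dom B f" "transpose x h' = h"
      by (rule transpose_surj[of "Dom B f" h x]) (use h ty in simp_all)
    obtain k' where k': "k' \<in> Ar B" "Dom B k' = fo F x" "Cod B k' = Dom B g" "transpose x k' = k"
      by (rule transpose_surj[of "Dom B g" k x]) (use h ty in simp_all)
    have "f \<cdot>\<^bsub>B\<^esub> h' = g \<cdot>\<^bsub>B\<^esub> k'"
      by (rule transpose_inj[of x]) (use ty h h' k' e in \<open>simp_all add: transpose_post\<close>)
    then obtain m where m: "m \<in> Ar B" "Dom B m = fo F x" "Cod B m = Dom B p" "p \<cdot>\<^bsub>B\<^esub> m = h'" "q \<cdot>\<^bsub>B\<^esub> m = k'"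
      using F.B.pullback_factor[OF pb, of h' k' "fo F x"] h' k' by auto
    show "\<exists>m. m \<in> Ar A \<and> Dom A m = x \<and> Cod A m = Dom A (fa U p) \<and> fa U p \<cdot>\<^bsub>A\<^esub> m = h \<and> fa U q \<cdot>\<^bsub>A\<^esub> m = k"
      using m h h' k' ty transpose_post[of x m p] transpose_post[of x m q]
      by (intro exI[of _ "transpose x m"]) simp
  next
    fix x m n assume m: "m \<in> Ar A" "n \<in> Ar A" "Dom A m = x" "Dom A n = x" "Cod A m = Dom A (fa U p)"
      "Cod A n = Dom A (fa U p)" and e: "fa U p \<cdot>\<^bsub>A\<^esub> m = fa U p \<cdot>\<^bsub>A\<^esub> n" "fa U q \<cdot>\<^bsub>A\<^esub> m = fa U q \<cdot>\<^bsub>A\<^esub> n"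
    have [simp]: "x \<in> Ob A" using m(1,3) by auto
    obtain m' where m': "m' \<in> Ar B" "Dom B m' = fo F x" "Cod B m' = Dom B p" "transpose x m' = m"
      by (rule transpose_surj[of "Dom B p" m x]) (use m ty in simp_all)
    obtain n' where n': "n' \<in> Ar B" "Dom B n' = fo F x" "Cod B n' = Dom B p" "transpose x n' = n"
      by (rule transpose_surj[of "Dom B p" n x]) (use m ty in simp_all)
    have "p \<cdot>\<^bsub>B\<^esub> m' = p \<cdot>\<^bsub>B\<^esub> n'" "q \<cdot>\<^bsub>B\<^esub> m' = q \<cdot>\<^bsub>B\<^esub> n'"
      by (rule transpose_inj[of x]; use ty m m' n' e in \<open>simp add: transpose_post\<close>)+
    then have "m' = n'" by (rule F.B.pullback_unique[OF pb, rotated 5]) (use m' n' in simp_all)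
    then show "m = n" using m' n' by simp
  qed (use ty in simp_all)
qed

end

lemma adjunction_comp:
  assumes "adjunction A B F U u v" "adjunction B C F' U' u' v'"
  shows "adjunction A C (comp_fnc F' F) (comp_fnc U U') (\<lambda>a. fa U (u' (fo F a)) \<cdot>\<^bsub>A\<^esub> u a)
    (\<lambda>c. v' c \<cdot>\<^bsub>C\<^esub> fa F' (v (fo U' c)))"
proof -
  interpret P: adj A B F U u v by unfold_locales (rule assms)
  interpret Q: adj B C F' U' u' v' by unfold_locales (rule assms)
  have F: "is_functor A C (comp_fnc F' F)" and U: "is_functor C A (comp_fnc U U')"
    by (rule is_functor_comp; unfold_locales)+
  have 1: "fa U (fa U' (fa F' (fa F f))) \<cdot>\<^bsub>A\<^esub> fa U (u' (fo F (Dom A f))) \<cdot>\<^bsub>A\<^esub> u (Dom A f) =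
      (fa U (u' (fo F (Cod A f))) \<cdot>\<^bsub>A\<^esub> u (Cod A f)) \<cdot>\<^bsub>A\<^esub> f" if "f \<in> Ar A" for f
  proof -
    have "fa U (fa U' (fa F' (fa F f))) \<cdot>\<^bsub>A\<^esub> fa U (u' (fo F (Dom A f))) \<cdot>\<^bsub>A\<^esub> u (Dom A f)
      = fa U (fa U' (fa F' (fa F f)) \<cdot>\<^bsub>B\<^esub> u' (fo F (Dom A f))) \<cdot>\<^bsub>A\<^esub> u (Dom A f)"
      using that by (simp add: P.F.A.comp_assoc)
    also have "\<dots> = fa U (u' (fo F (Cod A f))) \<cdot>\<^bsub>A\<^esub> fa U (fa F f) \<cdot>\<^bsub>A\<^esub> u (Dom A f)"
      using that Q.unit_nat[of "fa F f"] by (simp add: P.F.A.comp_assoc)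
    finally show ?thesis using that P.unit_nat[of f] by (simp add: P.F.A.comp_assoc)
  qed
  have 2: "f \<cdot>\<^bsub>C\<^esub> v' (Dom C f) \<cdot>\<^bsub>C\<^esub> fa F' (v (fo U' (Dom C f))) =
      (v' (Cod C f) \<cdot>\<^bsub>C\<^esub> fa F' (v (fo U' (Cod C f)))) \<cdot>\<^bsub>C\<^esub> fa F' (fa F (fa U (fa U' f)))"
    if "f \<in> Ar C" for f
  proof -
    have "f \<cdot>\<^bsub>C\<^esub> v' (Dom C f) \<cdot>\<^bsub>C\<^esub> fa F' (v (fo U' (Dom C f)))
      = v' (Cod C f) \<cdot>\<^bsub>C\<^esub> fa F' (fa U' f) \<cdot>\<^bsub>C\<^esub> fa F' (v (fo U' (Dom C f)))"
      using that Q.F.B.comp_reassoc[OF Q.counit_nat[of f]] by (simp add: Q.F.B.comp_assoc)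
    also have "\<dots> = v' (Cod C f) \<cdot>\<^bsub>C\<^esub> fa F' (fa U' f \<cdot>\<^bsub>B\<^esub> v (fo U' (Dom C f)))"
      using that by simp
    also have "fa U' f \<cdot>\<^bsub>B\<^esub> v (fo U' (Dom C f)) = v (fo U' (Cod C f)) \<cdot>\<^bsub>B\<^esub> fa F (fa U (fa U' f))"
      using that P.counit_nat[of "fa U' f"] by simp
    finally show ?thesis using that by (simp add: Q.F.B.comp_assoc)
  qed
  have 3: "(v' (fo F' (fo F a)) \<cdot>\<^bsub>C\<^esub> fa F' (v (fo U' (fo F' (fo F a))))) \<cdot>\<^bsub>C\<^esub>
       fa F' (fa F (fa U (u' (fo F a)) \<cdot>\<^bsub>A\<^esub> u a)) = Idt C (fo F' (fo F a))" if "a \<in> Ob A" for a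
  proof -
    have "(v' (fo F' (fo F a)) \<cdot>\<^bsub>C\<^esub> fa F' (v (fo U' (fo F' (fo F a))))) \<cdot>\<^bsub>C\<^esub>
       fa F' (fa F (fa U (u' (fo F a)) \<cdot>\<^bsub>A\<^esub> u a))
      = v' (fo F' (fo F a)) \<cdot>\<^bsub>C\<^esub> fa F' (v (Cod B (u' (fo F a))) \<cdot>\<^bsub>B\<^esub> fa F (P.transpose a (u' (fo F a))))"
      using that by (simp add: Q.F.B.comp_assoc P.transpose_def)
    also have "\<dots> = Idt C (fo F' (fo F a))"
      using that P.counit_transpose[of a "u' (fo F a)"] Q.triangle_F[of "fo F a"] by simp
    finally show ?thesis .
  qed
  have 4: "fa U (fa U' (v' c \<cdot>\<^bsub>C\<^esub> fa F' (v (fo U' c)))) \<cdot>\<^bsub>A\<^esub>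
     fa U (u' (fo F (fo U (fo U' c)))) \<cdot>\<^bsub>A\<^esub> u (fo U (fo U' c)) = Idt A (fo U (fo U' c))"
    if "c \<in> Ob C" for c
  proof -
    have "fa U (fa U' (v' c \<cdot>\<^bsub>C\<^esub> fa F' (v (fo U' c)))) \<cdot>\<^bsub>A\<^esub>
     fa U (u' (fo F (fo U (fo U' c)))) \<cdot>\<^bsub>A\<^esub> u (fo U (fo U' c))
      = fa U (Q.transpose (fo F (fo U (fo U' c))) (v' c \<cdot>\<^bsub>C\<^esub> fa F' (v (fo U' c)))) \<cdot>\<^bsub>A\<^esub> u (fo U (fo U' c))"
      using that by (simp add: Q.transpose_def P.F.A.comp_assoc)
    also have "\<dots> = Idt A (fo U (fo U' c))"
      using that Q.transpose_counit[of c "v (fo U' c)"] P.triangle_U[of "fo U' c"] by simp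
    finally show ?thesis .
  qed
  have "is_functor A A id_fnc" "is_functor C C id_fnc"
    by (rule P.F.A.is_functor_id Q.F.B.is_functor_id)+
  then show ?thesis unfolding adjunction_def nat_trans_def
    using F U is_functor_comp[OF F U] is_functor_comp[OF U F] 1 2 3 4 by (simp add: hom_def)
qed

text \<open>Two left adjoints of one functor are compared by the arrow whose transpose under the first
  adjunction is the unit of the second. It is natural and invertible because transposition is
  injective.\<close>

locale two_adjs = L: adj A B F U u v + R: adj A B F' U' u' v'
  for A :: "('o, 'm) cat" and B :: "('p, 'n) cat" and F F' :: "('o, 'm, 'p, 'n) fnc"
    and U U' :: "('p, 'n, 'o, 'm) fnc" and u u' :: "'o \<Rightarrow> 'm" and v v' :: "'p \<Rightarrow> 'n" +
  assumes same_right: "eq_fnc B U U'"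
begin

lemma same_right_ob: "b \<in> Ob B \<Longrightarrow> fo U' b = fo U b"
  and same_right_ar: "f \<in> Ar B \<Longrightarrow> fa U' f = fa U f"
  using same_right by (auto simp: eq_fnc_def)

definition compare :: "'o \<Rightarrow> 'n" where "compare a = v (fo F' a) \<cdot>\<^bsub>B\<^esub> fa F (u' a)"

lemma compare_ar [simp]: "a \<in> Ob A \<Longrightarrow> compare a \<in> Ar B"
  and compare_dom [simp]: "a \<in> Ob A \<Longrightarrow> Dom B (compare a) = fo F a"
  and compare_cod [simp]: "a \<in> Ob A \<Longrightarrow> Cod B (compare a) = fo F' a"
  by (simp_all add: compare_def same_right_ob)

lemma transpose_compare: "a \<in> Ob A \<Longrightarrow> L.transpose a (compare a) = u' a"
  unfolding compare_def by (rule L.transpose_counit) (simp_all add: same_right_ob)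

lemma transpose_comp_compare:
  assumes "a \<in> Ob A" "f \<in> Ar B" "Dom B f = fo F' a"
  shows "L.transpose a (f \<cdot>\<^bsub>B\<^esub> compare a) = R.transpose a f"
  using assms by (simp add: L.transpose_post transpose_compare R.transpose_def same_right_ar)

lemma compare_nat:
  assumes "f \<in> Ar A" "Dom A f = a" "Cod A f = b"
  shows "compare b \<cdot>\<^bsub>B\<^esub> fa F f = fa F' f \<cdot>\<^bsub>B\<^esub> compare a"
proof -
  have [simp]: "a \<in> Ob A" "b \<in> Ob A" using assms by auto
  have "fa F' f = Idt B (fo F' b) \<cdot>\<^bsub>B\<^esub> fa F' f" using assms by simp
  then have "R.transpose a (fa F' f) = R.transpose b (Idt B (fo F' b)) \<cdot>\<^bsub>A\<^esub> f"
    using R.transpose_pre[of f a b "Idt B (fo F' b)"] assms by simp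
  then show ?thesis using assms
    by (intro L.transpose_inj[of a]) 
      (simp_all add: transpose_comp_compare L.transpose_pre transpose_compare R.transpose_id)
qed

lemma swap: "two_adjs A B F' F U' U u' u v' v"
  using L.adj_axioms R.adj_axioms
  by (intro two_adjs.intro two_adjs_axioms.intro) (auto simp: eq_fnc_def same_right_ob same_right_ar)

end

lemma (in two_adjs) compare_iso: assumes a: "a \<in> Ob A" shows "is_iso B (compare a)"
proof -
  interpret op: two_adjs A B F' F U' U u' u v' v by (rule swap)
  have "op.compare a \<cdot>\<^bsub>B\<^esub> compare a = Idt B (fo F a)"
    by (rule L.transpose_inj[of a]) (simp_all add: a transpose_comp_compare op.transpose_compare L.transpose_id)
  moreover have "compare a \<cdot>\<^bsub>B\<^esub> op.compare a = Idt B (fo F' a)"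
    by (rule R.transpose_inj[of a]) (simp_all add: a op.transpose_comp_compare transpose_compare R.transpose_id)
  ultimately show ?thesis unfolding is_iso_def by (intro conjI bexI[of _ "op.compare a"]) (simp_all add: a hom_def)
qed


section \<open>Algebras of a monad\<close>

locale mon =
  fixes C :: "('o, 'm) cat" and T :: "('o, 'm) mnd"
  assumes monad: "monad C T"
begin

sublocale T: is_functor C C "mfn T" using monad by (simp add: monad_def)

lemma mult [simp]: "x \<in> Ob C \<Longrightarrow> mult T x \<in> Ar C" "x \<in> Ob C \<Longrightarrow> Dom C (mult T x) = mo T (mo T x)"
    "x \<in> Ob C \<Longrightarrow> Cod C (mult T x) = mo T x"
  using monad by (auto simp: monad_def nat_trans_def hom_def)

lemma unt [simp]: "x \<in> Ob C \<Longrightarrow> unt T x \<in> Ar C" "x \<in> Ob C \<Longrightarrow> Dom C (unt T x) = x"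
    "x \<in> Ob C \<Longrightarrow> Cod C (unt T x) = mo T x"
  using monad by (auto simp: monad_def nat_trans_def hom_def)

lemma mult_nat: "f \<in> Ar C \<Longrightarrow> Dom C f = x \<Longrightarrow> Cod C f = y
    \<Longrightarrow> ma T f \<cdot>\<^bsub>C\<^esub> mult T x = mult T y \<cdot>\<^bsub>C\<^esub> ma T (ma T f)"
  and unt_nat: "f \<in> Ar C \<Longrightarrow> Dom C f = x \<Longrightarrow> Cod C f = y \<Longrightarrow> ma T f \<cdot>\<^bsub>C\<^esub> unt T x = unt T y \<cdot>\<^bsub>C\<^esub> f"
  using monad by (auto simp: monad_def nat_trans_def)

lemma mult_unt: "x \<in> Ob C \<Longrightarrow> mult T x \<cdot>\<^bsub>C\<^esub> unt T (mo T x) = Idt C (mo T x)"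
  and mult_map_unt: "x \<in> Ob C \<Longrightarrow> mult T x \<cdot>\<^bsub>C\<^esub> ma T (unt T x) = Idt C (mo T x)"
  and mult_mult: "x \<in> Ob C \<Longrightarrow> mult T x \<cdot>\<^bsub>C\<^esub> mult T (mo T x) = mult T x \<cdot>\<^bsub>C\<^esub> ma T (mult T x)"
  using monad by (auto simp: monad_def)

lemma Alg_simps [simp]: "Ob (Alg C T) = Alg_ob C T" "Dom (Alg C T) f = fst f" "Cod (Alg C T) f = snd (snd f)"
    "Idt (Alg C T) A = (A, Idt C (fst A), A)"
    "g \<cdot>\<^bsub>Alg C T\<^esub> f = (fst f, fst (snd g) \<cdot>\<^bsub>C\<^esub> fst (snd f), snd (snd g))"
  by (auto simp: Alg_def split: prod.splits)

lemma Alg_obD: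
  assumes "A \<in> Alg_ob C T"
  shows "fst A \<in> Ob C" "snd A \<in> Ar C" "Dom C (snd A) = mo T (fst A)" "Cod C (snd A) = fst A"
    "snd A \<cdot>\<^bsub>C\<^esub> unt T (fst A) = Idt C (fst A)" "snd A \<cdot>\<^bsub>C\<^esub> mult T (fst A) = snd A \<cdot>\<^bsub>C\<^esub> ma T (snd A)"
  using assms by (auto simp: Alg_ob_def hom_def)

lemma Alg_obI:
  assumes "fst A \<in> Ob C" "snd A \<in> Ar C" "Dom C (snd A) = mo T (fst A)" "Cod C (snd A) = fst A"
    "snd A \<cdot>\<^bsub>C\<^esub> unt T (fst A) = Idt C (fst A)" "snd A \<cdot>\<^bsub>C\<^esub> mult T (fst A) = snd A \<cdot>\<^bsub>C\<^esub> ma T (snd A)"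
  shows "A \<in> Alg_ob C T"
  using assms by (cases A) (auto simp: Alg_ob_def hom_def)

lemma Alg_ar_iff: "f \<in> Ar (Alg C T) \<longleftrightarrow> fst f \<in> Alg_ob C T \<and> snd (snd f) \<in> Alg_ob C T
    \<and> fst (snd f) \<in> Ar C \<and> Dom C (fst (snd f)) = fst (fst f) \<and> Cod C (fst (snd f)) = fst (snd (snd f))
    \<and> fst (snd f) \<cdot>\<^bsub>C\<^esub> snd (fst f) = snd (snd (snd f)) \<cdot>\<^bsub>C\<^esub> ma T (fst (snd f))"
  by (cases f) (auto simp: Alg_def hom_def)

lemma Alg_comp_square:
  assumes "f \<in> Ar (Alg C T)" "g \<in> Ar (Alg C T)" "snd (snd f) = fst g"
  shows "(fst (snd g) \<cdot>\<^bsub>C\<^esub> fst (snd f)) \<cdot>\<^bsub>C\<^esub> snd (fst f) = snd (snd (snd g)) \<cdot>\<^bsub>C\<^esub> ma T (fst (snd g) \<cdot>\<^bsub>C\<^esub> fst (snd f))"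
proof -
  note f = assms(1)[unfolded Alg_ar_iff] and g = assms(2)[unfolded Alg_ar_iff]
  note ob = Alg_obD[of "fst f"] Alg_obD[of "fst g"] Alg_obD[of "snd (snd g)"]
  have "(fst (snd g) \<cdot>\<^bsub>C\<^esub> fst (snd f)) \<cdot>\<^bsub>C\<^esub> snd (fst f) = fst (snd g) \<cdot>\<^bsub>C\<^esub> snd (fst g) \<cdot>\<^bsub>C\<^esub> ma T (fst (snd f))"
    using f g ob assms(3) by (simp add: T.A.comp_assoc)
  also have "\<dots> = (snd (snd (snd g)) \<cdot>\<^bsub>C\<^esub> ma T (fst (snd g))) \<cdot>\<^bsub>C\<^esub> ma T (fst (snd f))"
    using f g ob assms(3) by (intro T.A.comp_reassoc) simp_all
  also have "\<dots> = snd (snd (snd g)) \<cdot>\<^bsub>C\<^esub> ma T (fst (snd g) \<cdot>\<^bsub>C\<^esub> fst (snd f))"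
    using f g ob assms(3) by (simp add: T.A.comp_assoc)
  finally show ?thesis .
qed

lemma category_Alg: "category (Alg C T)"
proof
  fix f g A B D assume "f \<in> hom (Alg C T) A B" "g \<in> hom (Alg C T) B D"
  then show "g \<cdot>\<^bsub>Alg C T\<^esub> f \<in> hom (Alg C T) A D"
    using Alg_comp_square[of f g] by (auto simp: hom_def Alg_ar_iff)
qed (auto simp: hom_def Alg_ar_iff Alg_obD T.A.comp_assoc)

lemma forget_simps [simp]: "fo forget A = fst A" "fa forget f = fst (snd f)"
  by (auto simp: forget_def split: prod.splits)

lemma free_simps [simp]: "fo (free C T) x = free_alg T x"
    "fa (free C T) f = (free_alg T (Dom C f), ma T f, free_alg T (Cod C f))"
    "fst (free_alg T x) = mo T x" "snd (free_alg T x) = mult T x"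
  by (auto simp: free_def free_alg_def)

lemma free_alg_ob [simp]: "x \<in> Ob C \<Longrightarrow> free_alg T x \<in> Alg_ob C T"
  by (rule Alg_obI) (simp_all add: mult_unt mult_mult)

lemma free_forget_adjunction:
  "adjunction C (Alg C T) (free C T) forget (unt T) (\<lambda>A. (free_alg T (fst A), snd A, A))"
proof -
  interpret A: category "Alg C T" by (rule category_Alg)
  have F: "is_functor C (Alg C T) (free C T)"
    by unfold_locales (auto simp: hom_def Alg_ar_iff mult_nat)
  have U: "is_functor (Alg C T) C forget"
    by unfold_locales (auto simp: hom_def Alg_ar_iff Alg_obD)
  show ?thesis unfolding adjunction_def nat_trans_def
    using F U is_functor_comp[OF F U] is_functor_comp[OF U F] T.A.is_functor_id A.is_functor_id
    by (auto simp: hom_def Alg_ar_iff Alg_obD mult_unt mult_map_unt unt_nat)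
qed

sublocale FU: adj C "Alg C T" "free C T" forget "unt T" "\<lambda>A. (free_alg T (fst A), snd A, A)"
  by unfold_locales (rule free_forget_adjunction)

end

section \<open>Internal categories\<close>

text \<open>All laws are used on generalized elements: for every object \<open>x\<close>, the arrows from \<open>x\<close> into the
  object of arrows of an internal category are the arrows of an ordinary category, with
  composition \<open>icomp\<close>, and precomposition with \<open>y \<rightarrow> x\<close> is a functor.\<close>

locale icat = category C for C :: "('o, 'm) cat" +
  fixes D :: "('o, 'm) icat"
  assumes internal: "internal_category C D"
begin

lemma obs [simp]: "ic0 D \<in> Ob C" "ic1 D \<in> Ob C" "ic2 D \<in> Ob C"
  and arrows [simp]:
    "isrc D \<in> Ar C" "Dom C (isrc D) = ic1 D" "Cod C (isrc D) = ic0 D"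
    "itgt D \<in> Ar C" "Dom C (itgt D) = ic1 D" "Cod C (itgt D) = ic0 D"
    "iide D \<in> Ar C" "Dom C (iide D) = ic0 D" "Cod C (iide D) = ic1 D"
    "ipr1 D \<in> Ar C" "Dom C (ipr1 D) = ic2 D" "Cod C (ipr1 D) = ic1 D"
    "ipr2 D \<in> Ar C" "Dom C (ipr2 D) = ic2 D" "Cod C (ipr2 D) = ic1 D"
    "icmp D \<in> Ar C" "Dom C (icmp D) = ic2 D" "Cod C (icmp D) = ic1 D"
  using internal by (auto simp: internal_category_def hom_def)

lemma pairs: "pullback C (isrc D) (itgt D) (ipr1 D) (ipr2 D)"
  using internal by (simp add: internal_category_def)

lemma src_tgt_ide [simp]: "isrc D \<cdot>\<^bsub>C\<^esub> iide D = Idt C (ic0 D)" "itgt D \<cdot>\<^bsub>C\<^esub> iide D = Idt C (ic0 D)"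
  and src_tgt_cmp: "isrc D \<cdot>\<^bsub>C\<^esub> icmp D = isrc D \<cdot>\<^bsub>C\<^esub> ipr2 D" "itgt D \<cdot>\<^bsub>C\<^esub> icmp D = itgt D \<cdot>\<^bsub>C\<^esub> ipr1 D"
  and src_tgt_pr: "isrc D \<cdot>\<^bsub>C\<^esub> ipr1 D = itgt D \<cdot>\<^bsub>C\<^esub> ipr2 D"
  using internal by (auto simp: internal_category_def pullback_def)

lemma src_tgt_ide_el [simp]:
  assumes "z \<in> Ar C" "Cod C z = ic0 D"
  shows "isrc D \<cdot>\<^bsub>C\<^esub> iide D \<cdot>\<^bsub>C\<^esub> z = z" "itgt D \<cdot>\<^bsub>C\<^esub> iide D \<cdot>\<^bsub>C\<^esub> z = z"
  using assms comp_reassoc[OF src_tgt_ide(1)] comp_reassoc[OF src_tgt_ide(2)] by simp_all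

text \<open>Every composable pair has the form \<open>(ipr1 \<cdot> k, ipr2 \<cdot> k)\<close>, so this equation replaces the
  definite description in \<open>icomp\<close>.\<close>

lemma icomp_pair:
  assumes "k \<in> Ar C" "Cod C k = ic2 D"
  shows "icomp C D (ipr1 D \<cdot>\<^bsub>C\<^esub> k) (ipr2 D \<cdot>\<^bsub>C\<^esub> k) = icmp D \<cdot>\<^bsub>C\<^esub> k"
proof -
  have "(THE k'. k' \<in> hom C (Dom C (ipr1 D \<cdot>\<^bsub>C\<^esub> k)) (ic2 D) \<and> ipr1 D \<cdot>\<^bsub>C\<^esub> k' = ipr1 D \<cdot>\<^bsub>C\<^esub> k
      \<and> ipr2 D \<cdot>\<^bsub>C\<^esub> k' = ipr2 D \<cdot>\<^bsub>C\<^esub> k) = k"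
  proof (rule the_equality)
    fix k' assume "k' \<in> hom C (Dom C (ipr1 D \<cdot>\<^bsub>C\<^esub> k)) (ic2 D) \<and> ipr1 D \<cdot>\<^bsub>C\<^esub> k' = ipr1 D \<cdot>\<^bsub>C\<^esub> k
      \<and> ipr2 D \<cdot>\<^bsub>C\<^esub> k' = ipr2 D \<cdot>\<^bsub>C\<^esub> k"
    then show "k' = k" using assms by (auto simp: hom_def intro: pullback_unique[OF pairs])
  qed (use assms in \<open>simp add: hom_def\<close>)
  then show ?thesis by (simp add: icomp_def)
qed

lemma pairE:
  assumes "g \<in> Ar C" "f \<in> Ar C" "Cod C g = ic1 D" "Cod C f = ic1 D" "Dom C g = Dom C f"
    "isrc D \<cdot>\<^bsub>C\<^esub> g = itgt D \<cdot>\<^bsub>C\<^esub> f"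
  obtains k where "k \<in> Ar C" "Dom C k = Dom C f" "Cod C k = ic2 D" "ipr1 D \<cdot>\<^bsub>C\<^esub> k = g" "ipr2 D \<cdot>\<^bsub>C\<^esub> k = f"
    "icomp C D g f = icmp D \<cdot>\<^bsub>C\<^esub> k"
proof -
  obtain k where k: "k \<in> Ar C" "Dom C k = Dom C f" "Cod C k = ic2 D" "ipr1 D \<cdot>\<^bsub>C\<^esub> k = g" "ipr2 D \<cdot>\<^bsub>C\<^esub> k = f"
    by (rule pullback_factor[OF pairs, of g f "Dom C f"]) (use assms in simp_all)
  then show ?thesis using that[of k] icomp_pair[of k] by simp
qed

lemma icomp_el [simp]:
  assumes "g \<in> Ar C" "f \<in> Ar C" "Cod C g = ic1 D" "Cod C f = ic1 D" "Dom C g = Dom C f"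
    "isrc D \<cdot>\<^bsub>C\<^esub> g = itgt D \<cdot>\<^bsub>C\<^esub> f"
  shows "icomp C D g f \<in> Ar C" "Dom C (icomp C D g f) = Dom C f" "Cod C (icomp C D g f) = ic1 D"
    "isrc D \<cdot>\<^bsub>C\<^esub> icomp C D g f = isrc D \<cdot>\<^bsub>C\<^esub> f" "itgt D \<cdot>\<^bsub>C\<^esub> icomp C D g f = itgt D \<cdot>\<^bsub>C\<^esub> g"
    "\<And>y. y \<in> Ar C \<Longrightarrow> Cod C y = Dom C f \<Longrightarrow> icomp C D g f \<cdot>\<^bsub>C\<^esub> y = icomp C D (g \<cdot>\<^bsub>C\<^esub> y) (f \<cdot>\<^bsub>C\<^esub> y)"
proof -
  obtain k where k: "k \<in> Ar C" "Dom C k = Dom C f" "Cod C k = ic2 D" "ipr1 D \<cdot>\<^bsub>C\<^esub> k = g" "ipr2 D \<cdot>\<^bsub>C\<^esub> k = f"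
    and e: "icomp C D g f = icmp D \<cdot>\<^bsub>C\<^esub> k"
    using pairE[OF assms] by blast
  show "icomp C D g f \<in> Ar C" "Dom C (icomp C D g f) = Dom C f" "Cod C (icomp C D g f) = ic1 D"
    using k(1-3) by (simp_all add: e)
  show "isrc D \<cdot>\<^bsub>C\<^esub> icomp C D g f = isrc D \<cdot>\<^bsub>C\<^esub> f"
    using k comp_reassoc[OF src_tgt_cmp(1), of k] by (simp add: e comp_assoc)
  show "itgt D \<cdot>\<^bsub>C\<^esub> icomp C D g f = itgt D \<cdot>\<^bsub>C\<^esub> g"
    using k comp_reassoc[OF src_tgt_cmp(2), of k] by (simp add: e comp_assoc)
  fix y assume y: "y \<in> Ar C" "Cod C y = Dom C f"
  have "g \<cdot>\<^bsub>C\<^esub> y = ipr1 D \<cdot>\<^bsub>C\<^esub> k \<cdot>\<^bsub>C\<^esub> y" "f \<cdot>\<^bsub>C\<^esub> y = ipr2 D \<cdot>\<^bsub>C\<^esub> k \<cdot>\<^bsub>C\<^esub> y"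
    using comp_reassoc[OF k(4)] comp_reassoc[OF k(5)] k(1-3) y by simp_all
  then show "icomp C D g f \<cdot>\<^bsub>C\<^esub> y = icomp C D (g \<cdot>\<^bsub>C\<^esub> y) (f \<cdot>\<^bsub>C\<^esub> y)"
    using k(1-3) y icomp_pair[of "k \<cdot>\<^bsub>C\<^esub> y"] by (simp add: e comp_assoc)
qed

lemma icomp_unit [simp]:
  assumes "f \<in> Ar C" "Cod C f = ic1 D"
  shows "isrc D \<cdot>\<^bsub>C\<^esub> f = z \<Longrightarrow> icomp C D f (iide D \<cdot>\<^bsub>C\<^esub> z) = f"
    "itgt D \<cdot>\<^bsub>C\<^esub> f = z \<Longrightarrow> icomp C D (iide D \<cdot>\<^bsub>C\<^esub> z) f = f"
proof -
  have "f \<in> hom C (Dom C f) (ic1 D)" using assms by (simp add: hom_def)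
  then have "icomp C D f (iide D \<cdot>\<^bsub>C\<^esub> isrc D \<cdot>\<^bsub>C\<^esub> f) = f \<and> icomp C D (iide D \<cdot>\<^bsub>C\<^esub> itgt D \<cdot>\<^bsub>C\<^esub> f) f = f"
    using internal unfolding internal_category_def by blast
  then show "isrc D \<cdot>\<^bsub>C\<^esub> f = z \<Longrightarrow> icomp C D f (iide D \<cdot>\<^bsub>C\<^esub> z) = f"
    "itgt D \<cdot>\<^bsub>C\<^esub> f = z \<Longrightarrow> icomp C D (iide D \<cdot>\<^bsub>C\<^esub> z) f = f" by auto
qed

lemma icomp_assoc:
  assumes "f \<in> Ar C" "g \<in> Ar C" "h \<in> Ar C" "Cod C f = ic1 D" "Cod C g = ic1 D" "Cod C h = ic1 D"
    "Dom C g = Dom C f" "Dom C h = Dom C f" "isrc D \<cdot>\<^bsub>C\<^esub> h = itgt D \<cdot>\<^bsub>C\<^esub> g" "isrc D \<cdot>\<^bsub>C\<^esub> g = itgt D \<cdot>\<^bsub>C\<^esub> f"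
  shows "icomp C D (icomp C D h g) f = icomp C D h (icomp C D g f)"
proof -
  have "f \<in> hom C (Dom C f) (ic1 D)" "g \<in> hom C (Dom C f) (ic1 D)" "h \<in> hom C (Dom C f) (ic1 D)"
    using assms by (simp_all add: hom_def)
  then have "icomp C D h (icomp C D g f) = icomp C D (icomp C D h g) f"
    using internal assms(9,10) unfolding internal_category_def by blast
  then show ?thesis by simp
qed

end

locale ifun = A: icat C A + B: icat C B for C :: "('o, 'm) cat" and A B +
  fixes f :: "'m ifun"
  assumes internal_functor: "internal_functor C A B f"
begin

lemma arrows [simp]: "if0 f \<in> Ar C" "Dom C (if0 f) = ic0 A" "Cod C (if0 f) = ic0 B"
    "if1 f \<in> Ar C" "Dom C (if1 f) = ic1 A" "Cod C (if1 f) = ic1 B"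
  and laws [simp]: "isrc B \<cdot>\<^bsub>C\<^esub> if1 f = if0 f \<cdot>\<^bsub>C\<^esub> isrc A" "itgt B \<cdot>\<^bsub>C\<^esub> if1 f = if0 f \<cdot>\<^bsub>C\<^esub> itgt A"
    "if1 f \<cdot>\<^bsub>C\<^esub> iide A = iide B \<cdot>\<^bsub>C\<^esub> if0 f"
  and cmp: "if1 f \<cdot>\<^bsub>C\<^esub> icmp A = icomp C B (if1 f \<cdot>\<^bsub>C\<^esub> ipr1 A) (if1 f \<cdot>\<^bsub>C\<^esub> ipr2 A)"
  using internal_functor by (auto simp: internal_functor_def hom_def)

lemma el_laws [simp]:
  "h \<in> Ar C \<Longrightarrow> Cod C h = ic1 A \<Longrightarrow> isrc B \<cdot>\<^bsub>C\<^esub> if1 f \<cdot>\<^bsub>C\<^esub> h = if0 f \<cdot>\<^bsub>C\<^esub> isrc A \<cdot>\<^bsub>C\<^esub> h"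
  "h \<in> Ar C \<Longrightarrow> Cod C h = ic1 A \<Longrightarrow> itgt B \<cdot>\<^bsub>C\<^esub> if1 f \<cdot>\<^bsub>C\<^esub> h = if0 f \<cdot>\<^bsub>C\<^esub> itgt A \<cdot>\<^bsub>C\<^esub> h"
  "z \<in> Ar C \<Longrightarrow> Cod C z = ic0 A \<Longrightarrow> if1 f \<cdot>\<^bsub>C\<^esub> iide A \<cdot>\<^bsub>C\<^esub> z = iide B \<cdot>\<^bsub>C\<^esub> if0 f \<cdot>\<^bsub>C\<^esub> z"
  using A.comp_reassoc[OF laws(1)] A.comp_reassoc[OF laws(2)] A.comp_reassoc[OF laws(3)]
  by (simp_all add: A.comp_assoc)

lemma el_icomp [simp]:
  assumes "g \<in> Ar C" "h \<in> Ar C" "Cod C g = ic1 A" "Cod C h = ic1 A" "Dom C g = Dom C h"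
    "isrc A \<cdot>\<^bsub>C\<^esub> g = itgt A \<cdot>\<^bsub>C\<^esub> h"
  shows "if1 f \<cdot>\<^bsub>C\<^esub> icomp C A g h = icomp C B (if1 f \<cdot>\<^bsub>C\<^esub> g) (if1 f \<cdot>\<^bsub>C\<^esub> h)"
proof -
  obtain k where k: "k \<in> Ar C" "Dom C k = Dom C h" "Cod C k = ic2 A" "ipr1 A \<cdot>\<^bsub>C\<^esub> k = g" "ipr2 A \<cdot>\<^bsub>C\<^esub> k = h"
    "icomp C A g h = icmp A \<cdot>\<^bsub>C\<^esub> k"
    using A.pairE[OF assms] by blast
  have "if1 f \<cdot>\<^bsub>C\<^esub> icomp C A g h = icomp C B (if1 f \<cdot>\<^bsub>C\<^esub> ipr1 A) (if1 f \<cdot>\<^bsub>C\<^esub> ipr2 A) \<cdot>\<^bsub>C\<^esub> k"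
    using A.comp_reassoc[OF cmp, of k] k(1-3) by (simp add: k(6))
  also have "\<dots> = icomp C B (if1 f \<cdot>\<^bsub>C\<^esub> g) (if1 f \<cdot>\<^bsub>C\<^esub> h)"
    using k(1-5) by (simp add: A.src_tgt_pr A.comp_assoc)
  finally show ?thesis .
qed

end

locale inat = F: ifun C A B f + G: ifun C A B g for C :: "('o, 'm) cat" and A B f g +
  fixes \<tau> :: 'm
  assumes nat: "internal_nat C A B f g \<tau>"
begin

lemma arrow [simp]: "\<tau> \<in> Ar C" "Dom C \<tau> = ic0 A" "Cod C \<tau> = ic1 B"
    "isrc B \<cdot>\<^bsub>C\<^esub> \<tau> = if0 f" "itgt B \<cdot>\<^bsub>C\<^esub> \<tau> = if0 g"
  using nat by (auto simp: internal_nat_def hom_def)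

lemma el [simp]:
  "z \<in> Ar C \<Longrightarrow> Cod C z = ic0 A \<Longrightarrow> isrc B \<cdot>\<^bsub>C\<^esub> \<tau> \<cdot>\<^bsub>C\<^esub> z = if0 f \<cdot>\<^bsub>C\<^esub> z"
  "z \<in> Ar C \<Longrightarrow> Cod C z = ic0 A \<Longrightarrow> itgt B \<cdot>\<^bsub>C\<^esub> \<tau> \<cdot>\<^bsub>C\<^esub> z = if0 g \<cdot>\<^bsub>C\<^esub> z"
  using F.A.comp_reassoc[OF arrow(4)] F.A.comp_reassoc[OF arrow(5)] by simp_all

lemma naturality: "icomp C B (if1 g) (\<tau> \<cdot>\<^bsub>C\<^esub> isrc A) = icomp C B (\<tau> \<cdot>\<^bsub>C\<^esub> itgt A) (if1 f)"
  using nat by (simp add: internal_nat_def)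

lemma el_naturality:
  assumes "h \<in> Ar C" "Cod C h = ic1 A"
  shows "icomp C B (if1 g \<cdot>\<^bsub>C\<^esub> h) (\<tau> \<cdot>\<^bsub>C\<^esub> isrc A \<cdot>\<^bsub>C\<^esub> h) = icomp C B (\<tau> \<cdot>\<^bsub>C\<^esub> itgt A \<cdot>\<^bsub>C\<^esub> h) (if1 f \<cdot>\<^bsub>C\<^esub> h)"
proof -
  have "icomp C B (if1 g) (\<tau> \<cdot>\<^bsub>C\<^esub> isrc A) \<cdot>\<^bsub>C\<^esub> h = icomp C B (\<tau> \<cdot>\<^bsub>C\<^esub> itgt A) (if1 f) \<cdot>\<^bsub>C\<^esub> h"
    by (simp add: naturality)
  then show ?thesis using assms by (simp add: F.A.comp_assoc)
qed

end

context category
begin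

lemma internal_nat_functors:
  "internal_nat C A B f g \<tau> \<Longrightarrow> internal_functor C A B f" "internal_nat C A B f g \<tau> \<Longrightarrow> internal_functor C A B g"
  by (simp_all add: internal_nat_def)

lemma icat_intro: "internal_category C D \<Longrightarrow> icat C D"
  by unfold_locales

lemma ifun_intro: "internal_category C A \<Longrightarrow> internal_category C B \<Longrightarrow> internal_functor C A B f \<Longrightarrow> ifun C A B f"
  by (intro ifun.intro ifun_axioms.intro icat_intro)

lemma inat_intro: "internal_category C A \<Longrightarrow> internal_category C B \<Longrightarrow> internal_nat C A B f g \<tau> \<Longrightarrow> inat C A B f g \<tau>"
  by (intro inat.intro inat_axioms.intro ifun_intro) (auto simp: internal_nat_def)

lemma internal_functor_comp:
  assumes "internal_category C A" "internal_category C B" "internal_category C D"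
    "internal_functor C A B f" "internal_functor C B D g"
  shows "internal_functor C A D (comp_ifun C g f)"
proof -
  interpret F: ifun C A B f by (rule ifun_intro) fact+
  interpret G: ifun C B D g by (rule ifun_intro) fact+
  show ?thesis by (simp add: internal_functor_def comp_ifun_def hom_def comp_assoc F.cmp F.A.src_tgt_pr)
qed

lemma internal_functor_id:
  assumes "internal_category C A" shows "internal_functor C A A (id_ifun C A)"
proof -
  interpret A: icat C A by (rule icat_intro) fact+
  have "icomp C A (ipr1 A) (ipr2 A) = icmp A"
    using A.icomp_pair[of "Idt C (ic2 A)"] by simp
  then show ?thesis by (simp add: internal_functor_def id_ifun_def hom_def)
qed

lemma internal_nat_vert:
  assumes "internal_category C A" "internal_category C B" "internal_nat C A B f g \<tau>" "internal_nat C A B g h \<sigma>"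
  shows "internal_nat C A B f h (icomp C B \<sigma> \<tau>)"
proof -
  interpret T: inat C A B f g \<tau> by (rule inat_intro) fact+
  interpret S: inat C A B g h \<sigma> by (rule inat_intro) fact+
  let ?s = "isrc A" and ?t = "itgt A"
  have "icomp C B (if1 h) (icomp C B \<sigma> \<tau> \<cdot>\<^bsub>C\<^esub> ?s) = icomp C B (icomp C B (if1 h) (\<sigma> \<cdot>\<^bsub>C\<^esub> ?s)) (\<tau> \<cdot>\<^bsub>C\<^esub> ?s)"
    by (simp add: T.F.B.icomp_assoc comp_assoc)
  also have "\<dots> = icomp C B (\<sigma> \<cdot>\<^bsub>C\<^esub> ?t) (icomp C B (if1 g) (\<tau> \<cdot>\<^bsub>C\<^esub> ?s))"
    by (simp add: S.naturality T.F.B.icomp_assoc comp_assoc)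
  also have "\<dots> = icomp C B (icomp C B \<sigma> \<tau> \<cdot>\<^bsub>C\<^esub> ?t) (if1 f)"
    by (simp add: T.naturality T.F.B.icomp_assoc comp_assoc)
  finally show ?thesis
    using T.F.internal_functor S.G.internal_functor by (simp add: internal_nat_def hom_def comp_assoc)
qed

lemma internal_nat_id:
  assumes "internal_category C A" "internal_category C B" "internal_functor C A B f"
  shows "internal_nat C A B f f (iide B \<cdot>\<^bsub>C\<^esub> if0 f)"
proof -
  interpret F: ifun C A B f by (rule ifun_intro) fact+
  show ?thesis using F.internal_functor by (simp add: internal_nat_def hom_def comp_assoc)
qed

lemma internal_nat_whisker_right:
  assumes "internal_category C A" "internal_category C B" "internal_category C D"
    "internal_functor C A B f" "internal_nat C B D k k' \<sigma>"
  shows "internal_nat C A D (comp_ifun C k f) (comp_ifun C k' f) (\<sigma> \<cdot>\<^bsub>C\<^esub> if0 f)"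
proof -
  interpret F: ifun C A B f by (rule ifun_intro) fact+
  interpret S: inat C B D k k' \<sigma> by (rule inat_intro) fact+
  show ?thesis
    using S.el_naturality[of "if1 f"] internal_functor_comp[OF assms(1-4)] S.F.internal_functor S.G.internal_functor
    by (simp add: internal_nat_def hom_def comp_assoc) (simp add: comp_ifun_def comp_assoc)
qed

lemma internal_nat_whisker_left:
  assumes "internal_category C A" "internal_category C B" "internal_category C D"
    "internal_nat C A B f f' \<tau>" "internal_functor C B D k"
  shows "internal_nat C A D (comp_ifun C k f) (comp_ifun C k f') (if1 k \<cdot>\<^bsub>C\<^esub> \<tau>)"
proof -
  interpret T: inat C A B f f' \<tau> by (rule inat_intro) fact+
  interpret K: ifun C B D k by (rule ifun_intro) fact+
  have "if1 k \<cdot>\<^bsub>C\<^esub> icomp C B (if1 f') (\<tau> \<cdot>\<^bsub>C\<^esub> isrc A) = if1 k \<cdot>\<^bsub>C\<^esub> icomp C B (\<tau> \<cdot>\<^bsub>C\<^esub> itgt A) (if1 f)"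
    by (simp add: T.naturality)
  then show ?thesis
    using internal_functor_comp[OF assms(1-3) T.F.internal_functor assms(5)] internal_functor_comp[OF assms(1-3) T.G.internal_functor assms(5)]
    by (simp add: internal_nat_def hom_def comp_assoc) (simp add: comp_ifun_def comp_assoc)
qed

text \<open>The horizontal composite in \<open>ICat\<close> is the vertical composite of two whiskerings; the
  interchange law is naturality of the left factor at the components of the right one.\<close>

lemma internal_nat_horiz:
  assumes "internal_category C A" "internal_category C B" "internal_category C D"
    "internal_nat C A B f f' \<tau>" "internal_nat C B D k k' \<sigma>"
  shows "internal_nat C A D (comp_ifun C k f) (comp_ifun C k' f') (icomp C D (\<sigma> \<cdot>\<^bsub>C\<^esub> if0 f') (if1 k \<cdot>\<^bsub>C\<^esub> \<tau>))"
proof (rule internal_nat_vert[OF assms(1,3)])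
  show "internal_nat C A D (comp_ifun C k f) (comp_ifun C k f') (if1 k \<cdot>\<^bsub>C\<^esub> \<tau>)"
    by (rule internal_nat_whisker_left[OF assms(1-4)]) (use assms(5) in \<open>simp add: internal_nat_def\<close>)
  show "internal_nat C A D (comp_ifun C k f') (comp_ifun C k' f') (\<sigma> \<cdot>\<^bsub>C\<^esub> if0 f')"
    by (rule internal_nat_whisker_right[OF assms(1-3) _ assms(5)]) (use assms(4) in \<open>simp add: internal_nat_def\<close>)
qed

lemma ICat_hom_simps [simp]: "Ob (ICat_hom C A B) = {f. internal_functor C A B f}"
  "Ar (ICat_hom C A B) = {(f, \<tau>, g). internal_nat C A B f g \<tau>}"
  "Dom (ICat_hom C A B) a = fst a" "Cod (ICat_hom C A B) a = snd (snd a)"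
  "Idt (ICat_hom C A B) f = (f, iide B \<cdot>\<^bsub>C\<^esub> if0 f, f)"
  "b \<cdot>\<^bsub>ICat_hom C A B\<^esub> a = (fst a, icomp C B (fst (snd b)) (fst (snd a)), snd (snd b))"
  by (auto simp: ICat_hom_def split: prod.splits)

lemma ICat_simps [simp]: "Ob2 (ICat C) = {D. internal_category C D}" "Hom2 (ICat C) = ICat_hom C"
  "id1 (ICat C) = id_ifun C" "comp1 (ICat C) A B D = comp_ifun C"
  "comp2 (ICat C) A B D b a = (comp_ifun C (fst b) (fst a),
    icomp C D (fst (snd b) \<cdot>\<^bsub>C\<^esub> if0 (snd (snd a))) (if1 (fst b) \<cdot>\<^bsub>C\<^esub> fst (snd a)), comp_ifun C (snd (snd b)) (snd (snd a)))"
  by (auto simp: ICat_def split: prod.splits)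

lemma category_ICat_hom:
  assumes AB: "internal_category C A" "internal_category C B"
  shows "category (ICat_hom C A B)"
proof
  fix f a b g c h e
  assume f: "f \<in> hom (ICat_hom C A B) a b"
  then interpret F: inat C A B a b "fst (snd f)"
    using AB by (intro inat_intro) (auto simp: hom_def)
  show "Idt (ICat_hom C A B) b \<cdot>\<^bsub>ICat_hom C A B\<^esub> f = f" "f \<cdot>\<^bsub>ICat_hom C A B\<^esub> Idt (ICat_hom C A B) a = f"
    using f by (auto simp: hom_def)
  assume g: "g \<in> hom (ICat_hom C A B) b c"
  then interpret G: inat C A B b c "fst (snd g)"
    using AB by (intro inat_intro) (auto simp: hom_def)
  show "g \<cdot>\<^bsub>ICat_hom C A B\<^esub> f \<in> hom (ICat_hom C A B) a c"
    using f g internal_nat_vert[OF AB] by (auto simp: hom_def)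
  assume h: "h \<in> hom (ICat_hom C A B) c e"
  then interpret H: inat C A B c e "fst (snd h)"
    using AB by (intro inat_intro) (auto simp: hom_def)
  show "h \<cdot>\<^bsub>ICat_hom C A B\<^esub> (g \<cdot>\<^bsub>ICat_hom C A B\<^esub> f) = (h \<cdot>\<^bsub>ICat_hom C A B\<^esub> g) \<cdot>\<^bsub>ICat_hom C A B\<^esub> f"
    by (simp add: F.F.B.icomp_assoc)
qed (use AB in \<open>auto simp: hom_def internal_nat_functors internal_nat_id\<close>)

lemma two_category_ICat: "two_category (ICat C)"
proof (rule two_category.intro)
  fix A B D f f' f'' g g' g'' \<tau> \<tau>' \<sigma> \<sigma>'
  assume "A \<in> Ob2 (ICat C)" "B \<in> Ob2 (ICat C)" "D \<in> Ob2 (ICat C)"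
  then have AB: "internal_category C A" "internal_category C B" "internal_category C D" by simp_all
  assume t: "\<tau> \<in> hom (Hom2 (ICat C) A B) f f'" and t': "\<tau>' \<in> hom (Hom2 (ICat C) A B) f' f''"
    and s: "\<sigma> \<in> hom (Hom2 (ICat C) B D) g g'" and s': "\<sigma>' \<in> hom (Hom2 (ICat C) B D) g' g''"
  interpret T: inat C A B f f' "fst (snd \<tau>)" using t AB by (intro inat_intro) (auto simp: hom_def)
  interpret T': inat C A B f' f'' "fst (snd \<tau>')" using t' AB by (intro inat_intro) (auto simp: hom_def)
  interpret S: inat C B D g g' "fst (snd \<sigma>)" using s AB by (intro inat_intro) (auto simp: hom_def)
  interpret S': inat C B D g' g'' "fst (snd \<sigma>')" using s' AB by (intro inat_intro) (auto simp: hom_def)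
  have e: "fst \<tau> = f" "snd (snd \<tau>) = f'" "fst \<tau>' = f'" "snd (snd \<tau>') = f''"
    "fst \<sigma> = g" "snd (snd \<sigma>) = g'" "fst \<sigma>' = g'" "snd (snd \<sigma>') = g''"
    using t t' s s' by (auto simp: hom_def)
  let ?a = "fst (snd \<tau>)" and ?a' = "fst (snd \<tau>')" and ?b = "fst (snd \<sigma>)" and ?b' = "fst (snd \<sigma>')"
  have "icomp C D (?b \<cdot>\<^bsub>C\<^esub> if0 f'') (icomp C D (if1 g \<cdot>\<^bsub>C\<^esub> ?a') (if1 g \<cdot>\<^bsub>C\<^esub> ?a))
    = icomp C D (icomp C D (if1 g' \<cdot>\<^bsub>C\<^esub> ?a') (?b \<cdot>\<^bsub>C\<^esub> if0 f')) (if1 g \<cdot>\<^bsub>C\<^esub> ?a)"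
    using S.el_naturality[of ?a'] by (simp add: S.F.B.icomp_assoc flip: S.F.B.icomp_assoc)
  then show "comp2 (ICat C) A B D (\<sigma>' \<cdot>\<^bsub>Hom2 (ICat C) B D\<^esub> \<sigma>) (\<tau>' \<cdot>\<^bsub>Hom2 (ICat C) A B\<^esub> \<tau>)
      = comp2 (ICat C) A B D \<sigma>' \<tau>' \<cdot>\<^bsub>Hom2 (ICat C) A D\<^esub> comp2 (ICat C) A B D \<sigma> \<tau>"
    by (simp add: e comp_assoc S.F.B.icomp_assoc)
next
  fix A B D H \<tau> \<sigma> \<rho>
  assume "A \<in> Ob2 (ICat C)" "B \<in> Ob2 (ICat C)" "D \<in> Ob2 (ICat C)" "H \<in> Ob2 (ICat C)"
  then have AB: "internal_category C A" "internal_category C B" "internal_category C D" "internal_category C H"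
    by simp_all
  assume t: "\<tau> \<in> Ar (Hom2 (ICat C) A B)" and s: "\<sigma> \<in> Ar (Hom2 (ICat C) B D)" and r: "\<rho> \<in> Ar (Hom2 (ICat C) D H)"
  interpret T: inat C A B "fst \<tau>" "snd (snd \<tau>)" "fst (snd \<tau>)" using t AB by (intro inat_intro) auto
  interpret S: inat C B D "fst \<sigma>" "snd (snd \<sigma>)" "fst (snd \<sigma>)" using s AB by (intro inat_intro) auto
  interpret R: inat C D H "fst \<rho>" "snd (snd \<rho>)" "fst (snd \<rho>)" using r AB by (intro inat_intro) auto
  show "comp2 (ICat C) A D H \<rho> (comp2 (ICat C) A B D \<sigma> \<tau>) = comp2 (ICat C) A B H (comp2 (ICat C) B D H \<rho> \<sigma>) \<tau>"
    by (simp add: comp_ifun_def comp_assoc R.F.B.icomp_assoc)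
next
  fix A B \<tau>
  assume "A \<in> Ob2 (ICat C)" "B \<in> Ob2 (ICat C)"
  then have AB: "internal_category C A" "internal_category C B" by simp_all
  assume t: "\<tau> \<in> Ar (Hom2 (ICat C) A B)"
  interpret T: inat C A B "fst \<tau>" "snd (snd \<tau>)" "fst (snd \<tau>)" using t AB by (intro inat_intro) auto
  show "comp2 (ICat C) A A B \<tau> (id2 (ICat C) A) = \<tau> \<and> comp2 (ICat C) A B B (id2 (ICat C) B) \<tau> = \<tau>"
    using t by (auto simp: id2_def comp_ifun_def id_ifun_def)
next
  fix A B D f g
  assume "A \<in> Ob2 (ICat C)" "B \<in> Ob2 (ICat C)" "D \<in> Ob2 (ICat C)"
    "f \<in> Ob (Hom2 (ICat C) A B)" "g \<in> Ob (Hom2 (ICat C) B D)"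
  then interpret F: ifun C A B f + G: ifun C B D g by (auto intro!: ifun_intro)
  show "comp2 (ICat C) A B D (Idt (Hom2 (ICat C) B D) g) (Idt (Hom2 (ICat C) A B) f)
          = Idt (Hom2 (ICat C) A D) (comp1 (ICat C) A B D g f)"
    by (simp add: comp_ifun_def comp_assoc)
next
  fix A B f
  assume "A \<in> Ob2 (ICat C)" "B \<in> Ob2 (ICat C)" "f \<in> Ob (Hom2 (ICat C) A B)"
  then interpret F: ifun C A B f by (auto intro!: ifun_intro)
  show "comp1 (ICat C) A A B f (id1 (ICat C) A) = f \<and> comp1 (ICat C) A B B (id1 (ICat C) B) f = f"
    by (simp add: comp_ifun_def id_ifun_def)
next
  fix A B D H f g h
  assume "A \<in> Ob2 (ICat C)" "B \<in> Ob2 (ICat C)" "D \<in> Ob2 (ICat C)" "H \<in> Ob2 (ICat C)"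
    "f \<in> Ob (Hom2 (ICat C) A B)" "g \<in> Ob (Hom2 (ICat C) B D)" "h \<in> Ob (Hom2 (ICat C) D H)"
  then interpret F: ifun C A B f + G: ifun C B D g + H: ifun C D H h by (auto intro!: ifun_intro)
  show "comp1 (ICat C) A D H h (comp1 (ICat C) A B D g f) = comp1 (ICat C) A B H (comp1 (ICat C) B D H h g) f"
    by (simp add: comp_ifun_def comp_assoc)
qed (auto simp: hom_def intro: category_ICat_hom internal_functor_id internal_functor_comp internal_nat_horiz)

end

text \<open>The unit and associativity laws of the image of \<open>D\<close> under a right adjoint \<open>U\<close> are demanded for all
  generalized elements \<open>x \<rightarrow> U (ic1 D)\<close>, not only for images under \<open>U\<close>. But these transpose to
  elements \<open>F x \<rightarrow> ic1 D\<close>, and transposition preserves composition.\<close>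

locale adj_icat = adj A B F U u v + D: icat B D
  for A :: "('o, 'm) cat" and B :: "('p, 'n) cat" and F U u v and D :: "('p, 'n) icat"
begin

lemma map_icat_simps [simp]: "ic0 (map_icat U D) = fo U (ic0 D)" "ic1 (map_icat U D) = fo U (ic1 D)"
  "ic2 (map_icat U D) = fo U (ic2 D)" "isrc (map_icat U D) = fa U (isrc D)" "itgt (map_icat U D) = fa U (itgt D)"
  "iide (map_icat U D) = fa U (iide D)" "ipr1 (map_icat U D) = fa U (ipr1 D)" "ipr2 (map_icat U D) = fa U (ipr2 D)"
  "icmp (map_icat U D) = fa U (icmp D)"
  by (simp_all add: map_icat_def)

lemma pairs_image: "pullback A (fa U (isrc D)) (fa U (itgt D)) (fa U (ipr1 D)) (fa U (ipr2 D))"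
  by (rule right_adjoint_pullback[OF D.pairs])

lemma icomp_pair_image:
  assumes "k \<in> Ar A" "Cod A k = fo U (ic2 D)"
  shows "icomp A (map_icat U D) (fa U (ipr1 D) \<cdot>\<^bsub>A\<^esub> k) (fa U (ipr2 D) \<cdot>\<^bsub>A\<^esub> k) = fa U (icmp D) \<cdot>\<^bsub>A\<^esub> k"
proof -
  have "(THE k'. k' \<in> hom A (Dom A (fa U (ipr1 D) \<cdot>\<^bsub>A\<^esub> k)) (fo U (ic2 D)) \<and> fa U (ipr1 D) \<cdot>\<^bsub>A\<^esub> k' = fa U (ipr1 D) \<cdot>\<^bsub>A\<^esub> k
      \<and> fa U (ipr2 D) \<cdot>\<^bsub>A\<^esub> k' = fa U (ipr2 D) \<cdot>\<^bsub>A\<^esub> k) = k"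
  proof (rule the_equality)
    fix k' assume "k' \<in> hom A (Dom A (fa U (ipr1 D) \<cdot>\<^bsub>A\<^esub> k)) (fo U (ic2 D)) \<and> fa U (ipr1 D) \<cdot>\<^bsub>A\<^esub> k' = fa U (ipr1 D) \<cdot>\<^bsub>A\<^esub> k
      \<and> fa U (ipr2 D) \<cdot>\<^bsub>A\<^esub> k' = fa U (ipr2 D) \<cdot>\<^bsub>A\<^esub> k"
    then show "k' = k" using assms by (auto simp: hom_def intro: F.A.pullback_unique[OF pairs_image])
  qed (use assms in \<open>simp add: hom_def\<close>)
  then show ?thesis by (simp add: icomp_def)
qed

lemma transpose_icomp:
  assumes "x \<in> Ob A" "g \<in> Ar B" "f \<in> Ar B" "Cod B g = ic1 D" "Cod B f = ic1 D" "Dom B g = fo F x" "Dom B f = fo F x"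
    "isrc D \<cdot>\<^bsub>B\<^esub> g = itgt D \<cdot>\<^bsub>B\<^esub> f"
  shows "transpose x (icomp B D g f) = icomp A (map_icat U D) (transpose x g) (transpose x f)"
proof -
  obtain k where k: "k \<in> Ar B" "Dom B k = Dom B f" "Cod B k = ic2 D" "ipr1 D \<cdot>\<^bsub>B\<^esub> k = g" "ipr2 D \<cdot>\<^bsub>B\<^esub> k = f"
    "icomp B D g f = icmp D \<cdot>\<^bsub>B\<^esub> k"
    by (rule D.pairE[of g f]) (use assms in simp_all)
  have "transpose x g = fa U (ipr1 D) \<cdot>\<^bsub>A\<^esub> transpose x k" "transpose x f = fa U (ipr2 D) \<cdot>\<^bsub>A\<^esub> transpose x k"
    using k(1-3) assms transpose_post[of x k "ipr1 D"] transpose_post[of x k "ipr2 D"] by (simp_all add: k(4,5))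
  then show ?thesis using k(1-3) assms icomp_pair_image[of "transpose x k"]
    by (simp add: k(6) transpose_post)
qed

lemma map_icat_internal: "internal_category A (map_icat U D)"
proof -
  have lift: "\<exists>f'. f' \<in> Ar B \<and> Dom B f' = fo F x \<and> Cod B f' = ic1 D \<and> transpose x f' = f"
    if "f \<in> hom A x (fo U (ic1 D))" for x f
    by (rule transpose_surj[of "ic1 D" f x]) (use that in \<open>auto simp: hom_def\<close>)
  have 1: "icomp A (map_icat U D) f (fa U (iide D) \<cdot>\<^bsub>A\<^esub> fa U (isrc D) \<cdot>\<^bsub>A\<^esub> f) = f
    \<and> icomp A (map_icat U D) (fa U (iide D) \<cdot>\<^bsub>A\<^esub> fa U (itgt D) \<cdot>\<^bsub>A\<^esub> f) f = f"
    if el: "f \<in> hom A x (fo U (ic1 D))" for x f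
  proof -
    have x: "x \<in> Ob A" using el by (auto simp: hom_def)
    obtain f' where f': "f' \<in> Ar B" "Dom B f' = fo F x" "Cod B f' = ic1 D" and f: "f = transpose x f'"
      using lift[OF el] by auto
    have "transpose x (icomp B D f' (iide D \<cdot>\<^bsub>B\<^esub> isrc D \<cdot>\<^bsub>B\<^esub> f')) = f"
      "transpose x (icomp B D (iide D \<cdot>\<^bsub>B\<^esub> itgt D \<cdot>\<^bsub>B\<^esub> f') f') = f"
      using x f' by (simp_all add: f)
    then show ?thesis using x f'
      by (subst (asm) (1 2) transpose_icomp) (simp_all add: f transpose_post)
  qed
  have 2: "icomp A (map_icat U D) h (icomp A (map_icat U D) g f) = icomp A (map_icat U D) (icomp A (map_icat U D) h g) f"
    if el: "f \<in> hom A x (fo U (ic1 D))" "g \<in> hom A x (fo U (ic1 D))" "h \<in> hom A x (fo U (ic1 D))"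
      "fa U (isrc D) \<cdot>\<^bsub>A\<^esub> h = fa U (itgt D) \<cdot>\<^bsub>A\<^esub> g" "fa U (isrc D) \<cdot>\<^bsub>A\<^esub> g = fa U (itgt D) \<cdot>\<^bsub>A\<^esub> f" for x f g h
  proof -
    have x: "x \<in> Ob A" using el by (auto simp: hom_def)
    obtain f' where f': "f' \<in> Ar B" "Dom B f' = fo F x" "Cod B f' = ic1 D" and f: "f = transpose x f'"
      using lift[OF el(1)] by auto
    obtain g' where g': "g' \<in> Ar B" "Dom B g' = fo F x" "Cod B g' = ic1 D" and g: "g = transpose x g'"
      using lift[OF el(2)] by auto
    obtain h' where h': "h' \<in> Ar B" "Dom B h' = fo F x" "Cod B h' = ic1 D" and h: "h = transpose x h'"
      using lift[OF el(3)] by auto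
    have s: "isrc D \<cdot>\<^bsub>B\<^esub> h' = itgt D \<cdot>\<^bsub>B\<^esub> g'"
      by (rule transpose_inj[of x]) (use x f' g' h' el(4) in \<open>simp_all add: transpose_post f g h\<close>)
    have s': "isrc D \<cdot>\<^bsub>B\<^esub> g' = itgt D \<cdot>\<^bsub>B\<^esub> f'"
      by (rule transpose_inj[of x]) (use x f' g' h' el(5) in \<open>simp_all add: transpose_post f g h\<close>)
    have "transpose x (icomp B D h' (icomp B D g' f')) = transpose x (icomp B D (icomp B D h' g') f')"
      using f' g' h' s s' by (simp add: D.icomp_assoc)
    then show ?thesis using x f' g' h' s s'
      by (simp add: f g h transpose_icomp del: D.icomp_el(6))
  qed
  have "fa U (isrc D) \<cdot>\<^bsub>A\<^esub> fa U (iide D) = Idt A (fo U (ic0 D))" "fa U (itgt D) \<cdot>\<^bsub>A\<^esub> fa U (iide D) = Idt A (fo U (ic0 D))"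
    using U.fa_comp'[of "iide D" "isrc D"] U.fa_comp'[of "iide D" "itgt D"] by simp_all
  then show ?thesis unfolding internal_category_def
    using 1 2 pairs_image
      arg_cong[OF D.src_tgt_cmp(1), of "fa U"] arg_cong[OF D.src_tgt_cmp(2), of "fa U"]
    by (simp add: hom_def)
qed

end

section \<open>Nerves\<close>

locale simplicial = category C for C :: "('o, 'm) cat" +
  fixes X :: "('o, 'm) simp"
  assumes simplicial: "simplicial_object C X"
begin

lemma sob [simp]: "sob X n \<in> Ob C"
  and face [simp]: "i \<le> Suc n \<Longrightarrow> face X (Suc n) i \<in> Ar C" "i \<le> Suc n \<Longrightarrow> Dom C (face X (Suc n) i) = sob X (Suc n)"
    "i \<le> Suc n \<Longrightarrow> Cod C (face X (Suc n) i) = sob X n"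
  and degen [simp]: "i \<le> n \<Longrightarrow> degen X n i \<in> Ar C" "i \<le> n \<Longrightarrow> Dom C (degen X n i) = sob X n"
    "i \<le> n \<Longrightarrow> Cod C (degen X n i) = sob X (Suc n)"
  using simplicial by (auto simp: simplicial_object_def hom_def)

lemma face_face: "i < j \<Longrightarrow> j \<le> Suc (Suc n) \<Longrightarrow>
    face X (Suc n) i \<cdot>\<^bsub>C\<^esub> face X (Suc (Suc n)) j = face X (Suc n) (j - 1) \<cdot>\<^bsub>C\<^esub> face X (Suc (Suc n)) i"
  and face_degen_less: "i < j \<Longrightarrow> j \<le> Suc n \<Longrightarrow>
    face X (Suc (Suc n)) i \<cdot>\<^bsub>C\<^esub> degen X (Suc n) j = degen X n (j - 1) \<cdot>\<^bsub>C\<^esub> face X (Suc n) i"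
  and face_degen_same: "j \<le> n \<Longrightarrow> face X (Suc n) j \<cdot>\<^bsub>C\<^esub> degen X n j = Idt C (sob X n)"
    "j \<le> n \<Longrightarrow> face X (Suc n) (Suc j) \<cdot>\<^bsub>C\<^esub> degen X n j = Idt C (sob X n)"
  and face_degen_greater: "Suc j < i \<Longrightarrow> i \<le> Suc (Suc n) \<Longrightarrow>
    face X (Suc (Suc n)) i \<cdot>\<^bsub>C\<^esub> degen X (Suc n) j = degen X n j \<cdot>\<^bsub>C\<^esub> face X (Suc n) (i - 1)"
  using simplicial by (simp_all add: simplicial_object_def)

end

definition simp_trunc :: "('o, 'm) simp \<Rightarrow> ('o, 'm) icat" where
  "simp_trunc X = \<lparr>ic0 = sob X 0, ic1 = sob X 1, ic2 = sob X 2,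
      isrc = face X 1 0, itgt = face X 1 1, iide = degen X 0 0,
      ipr1 = face X 2 2, ipr2 = face X 2 0, icmp = face X 2 1\<rparr>"

text \<open>If all squares \<open>d\<^sub>0 d\<^sub>n\<^sub>+\<^sub>2 = d\<^sub>n\<^sub>+\<^sub>1 d\<^sub>0\<close> are pullbacks, then \<open>X\<^sub>n\<^sub>+\<^sub>2\<close> consists of pairs of
  chains of length \<open>n + 1\<close> that overlap in a chain of length \<open>n\<close>, and hence, by induction, of chains
  of length \<open>n + 2\<close>.\<close>

locale segal = simplicial +
  assumes overlap: "pullback C (face X (Suc n) 0) (face X (Suc n) (Suc n))
    (face X (Suc (Suc n)) (Suc (Suc n))) (face X (Suc (Suc n)) 0)"
begin

lemma edge_step: "edge C X (Suc (Suc n)) i =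
    (if i \<le> n then edge C X (Suc n) i \<cdot>\<^bsub>C\<^esub> face X (Suc (Suc n)) (Suc (Suc n))
     else edge C X (Suc n) n \<cdot>\<^bsub>C\<^esub> face X (Suc (Suc n)) 0)"
  by simp

declare edge.simps(3) [simp del]

lemma edge_ar [simp]: "i < Suc n \<Longrightarrow> edge C X (Suc n) i \<in> Ar C"
    "i < Suc n \<Longrightarrow> Dom C (edge C X (Suc n) i) = sob X (Suc n)"
    "i < Suc n \<Longrightarrow> Cod C (edge C X (Suc n) i) = sob X (Suc 0)"
  by (induction n arbitrary: i) (auto simp: edge_step)

lemma edge_face_last: "i < Suc n \<Longrightarrow> edge C X (Suc n) i \<cdot>\<^bsub>C\<^esub> face X (Suc (Suc n)) (Suc (Suc n)) = edge C X (Suc (Suc n)) i"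
  by (simp add: edge_step)

text \<open>The face \<open>0\<close> forgets the first arrow of a chain, so it shifts the numbering of the others.\<close>

lemma edge_face_0: "i < Suc n \<Longrightarrow> edge C X (Suc n) i \<cdot>\<^bsub>C\<^esub> face X (Suc (Suc n)) 0 = edge C X (Suc (Suc n)) (Suc i)"
proof (induction n arbitrary: i)
  case (Suc n)
  show ?case
  proof (cases "i \<le> n")
    case True
    have "edge C X (Suc (Suc n)) (Suc i) \<cdot>\<^bsub>C\<^esub> face X (Suc (Suc (Suc n))) (Suc (Suc (Suc n)))
      = edge C X (Suc n) i \<cdot>\<^bsub>C\<^esub> face X (Suc (Suc n)) 0 \<cdot>\<^bsub>C\<^esub> face X (Suc (Suc (Suc n))) (Suc (Suc (Suc n)))"
      using True Suc.IH[of i] by (subst comp_assoc[symmetric]) (simp_all add: edge_step)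
    also have "\<dots> = edge C X (Suc (Suc n)) i \<cdot>\<^bsub>C\<^esub> face X (Suc (Suc (Suc n))) 0"
      using True by (simp add: edge_step face_face comp_assoc)
    finally show ?thesis using True by (simp add: edge_step)
  next
    case False
    then have "i = Suc n" using Suc.prems by simp
    then show ?thesis by (simp add: edge_step)
  qed
qed (simp add: edge_step)

lemma edges_unique:
  assumes "k \<in> Ar C" "k' \<in> Ar C" "Dom C k = x" "Dom C k' = x" "Cod C k = sob X (Suc n)" "Cod C k' = sob X (Suc n)"
    "\<And>i. i < Suc n \<Longrightarrow> edge C X (Suc n) i \<cdot>\<^bsub>C\<^esub> k = edge C X (Suc n) i \<cdot>\<^bsub>C\<^esub> k'"
  shows "k = k'"
  using assms
proof (induction n arbitrary: k k')
  case 0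
  then show ?case using "0.prems"(7)[of 0] by simp
next
  case (Suc n)
  let ?N = "Suc (Suc n)"
  have "edge C X (Suc n) i \<cdot>\<^bsub>C\<^esub> face X ?N ?N \<cdot>\<^bsub>C\<^esub> k = edge C X (Suc n) i \<cdot>\<^bsub>C\<^esub> face X ?N ?N \<cdot>\<^bsub>C\<^esub> k'" if "i < Suc n" for i
    using Suc.prems that comp_reassoc[OF edge_face_last[OF that]] by simp
  then have 1: "face X ?N ?N \<cdot>\<^bsub>C\<^esub> k = face X ?N ?N \<cdot>\<^bsub>C\<^esub> k'"
    by (rule Suc.IH[rotated 6]) (use Suc.prems(1-6) in simp_all)
  have "edge C X (Suc n) i \<cdot>\<^bsub>C\<^esub> face X ?N 0 \<cdot>\<^bsub>C\<^esub> k = edge C X (Suc n) i \<cdot>\<^bsub>C\<^esub> face X ?N 0 \<cdot>\<^bsub>C\<^esub> k'" if "i < Suc n" for i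
    using Suc.prems that comp_reassoc[OF edge_face_0[OF that]] by simp
  then have 2: "face X ?N 0 \<cdot>\<^bsub>C\<^esub> k = face X ?N 0 \<cdot>\<^bsub>C\<^esub> k'"
    by (rule Suc.IH[rotated 6]) (use Suc.prems(1-6) in simp_all)
  show ?case by (rule pullback_unique[OF overlap _ _ _ _ _ 1 2]) (use Suc.prems(1-6) in simp_all)
qed

lemma edges_exist:
  assumes "\<And>i. i < Suc n \<Longrightarrow> g i \<in> hom C x (sob X (Suc 0))"
    "\<And>i. Suc i < Suc n \<Longrightarrow> face X (Suc 0) 0 \<cdot>\<^bsub>C\<^esub> g i = face X (Suc 0) (Suc 0) \<cdot>\<^bsub>C\<^esub> g (Suc i)"
  shows "\<exists>k. k \<in> hom C x (sob X (Suc n)) \<and> (\<forall>i < Suc n. edge C X (Suc n) i \<cdot>\<^bsub>C\<^esub> k = g i)"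
  using assms
proof (induction n arbitrary: g)
  case 0
  then show ?case using "0.prems"(1)[of 0] by (intro exI[of _ "g 0"]) (simp add: hom_def)
next
  case (Suc n)
  let ?N = "Suc (Suc n)"
  obtain a where a: "a \<in> Ar C" "Dom C a = x" "Cod C a = sob X (Suc n)"
      "\<And>i. i < Suc n \<Longrightarrow> edge C X (Suc n) i \<cdot>\<^bsub>C\<^esub> a = g i"
    using Suc.IH[of g] Suc.prems by (auto simp: hom_def)
  obtain b where b: "b \<in> Ar C" "Dom C b = x" "Cod C b = sob X (Suc n)"
      "\<And>i. i < Suc n \<Longrightarrow> edge C X (Suc n) i \<cdot>\<^bsub>C\<^esub> b = g (Suc i)"
    using Suc.IH[of "\<lambda>i. g (Suc i)"] Suc.prems by (auto simp: hom_def)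
  have "face X (Suc n) 0 \<cdot>\<^bsub>C\<^esub> a = face X (Suc n) (Suc n) \<cdot>\<^bsub>C\<^esub> b"
  proof (cases n)
    case 0
    then show ?thesis using a(1-3) b(1-3) a(4)[of 0] b(4)[of 0] Suc.prems(2)[of 0] by simp
  next
    case (Suc m)
    have "edge C X (Suc m) i \<cdot>\<^bsub>C\<^esub> face X (Suc (Suc m)) 0 \<cdot>\<^bsub>C\<^esub> a
        = edge C X (Suc m) i \<cdot>\<^bsub>C\<^esub> face X (Suc (Suc m)) (Suc (Suc m)) \<cdot>\<^bsub>C\<^esub> b" if i: "i < Suc m" for i
      using comp_reassoc[OF edge_face_0[OF i], of a] comp_reassoc[OF edge_face_last[OF i], of b]
        a(1-3) b(1-3) a(4)[of "Suc i"] b(4)[of i] i Suc by simp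
    then show ?thesis unfolding Suc
      by (rule edges_unique[rotated 6]) (use a(1-3) b(1-3) Suc in simp_all)
  qed
  then obtain k where k: "k \<in> Ar C" "Dom C k = x" "Cod C k = sob X ?N" "face X ?N ?N \<cdot>\<^bsub>C\<^esub> k = a" "face X ?N 0 \<cdot>\<^bsub>C\<^esub> k = b"
    using pullback_factor[OF overlap[of n], of a b x] a(1-3) b(1-3) by auto
  have "edge C X ?N i \<cdot>\<^bsub>C\<^esub> k = g i" if i: "i < ?N" for i
  proof (cases "i < Suc n")
    case True
    then show ?thesis using k comp_reassoc[OF edge_face_last[OF True], of k] a(4)[OF True] by simp
  next
    case False
    then have "i = Suc n" using i by simp
    then show ?thesis using k comp_reassoc[OF edge_face_0[of n n], of k] b(4)[of n] by simp
  qed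
  then show ?case using k(1-3) by (auto simp: hom_def)
qed

lemma simp_trunc_simps [simp]: "ic0 (simp_trunc X) = sob X 0" "ic1 (simp_trunc X) = sob X (Suc 0)"
    "ic2 (simp_trunc X) = sob X (Suc (Suc 0))"
    "isrc (simp_trunc X) = face X (Suc 0) 0" "itgt (simp_trunc X) = face X (Suc 0) (Suc 0)" "iide (simp_trunc X) = degen X 0 0"
    "ipr1 (simp_trunc X) = face X (Suc (Suc 0)) (Suc (Suc 0))" "ipr2 (simp_trunc X) = face X (Suc (Suc 0)) 0"
    "icmp (simp_trunc X) = face X (Suc (Suc 0)) (Suc 0)"
  by (simp_all add: simp_trunc_def numeral_2_eq_2)

lemma icomp_trunc:
  assumes "k \<in> Ar C" "Cod C k = sob X (Suc (Suc 0))"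
    "face X (Suc (Suc 0)) (Suc (Suc 0)) \<cdot>\<^bsub>C\<^esub> k = g" "face X (Suc (Suc 0)) 0 \<cdot>\<^bsub>C\<^esub> k = f"
  shows "icomp C (simp_trunc X) g f = face X (Suc (Suc 0)) (Suc 0) \<cdot>\<^bsub>C\<^esub> k"
proof -
  have d: "Dom C g = Dom C k" using assms(1,2) unfolding assms(3)[symmetric] by simp
  have "(THE k'. k' \<in> hom C (Dom C g) (sob X (Suc (Suc 0))) \<and> face X (Suc (Suc 0)) (Suc (Suc 0)) \<cdot>\<^bsub>C\<^esub> k' = g
      \<and> face X (Suc (Suc 0)) 0 \<cdot>\<^bsub>C\<^esub> k' = f) = k"
    by (rule the_equality) (use assms d in \<open>auto simp: hom_def intro: pullback_unique[OF overlap[of 0]]\<close>)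
  then show ?thesis by (simp add: icomp_def)
qed

text \<open>The unit laws are witnessed by the two degenerate 2-simplices of an edge, associativity by
  the 3-simplex of a chain of three edges.\<close>

lemma internal_category_trunc: "internal_category C (simp_trunc X)"
proof -
  let ?d1 = "face X (Suc 0)" and ?d2 = "face X (Suc (Suc 0))" and ?d3 = "face X (Suc (Suc (Suc 0)))"
  let ?X1 = "sob X (Suc 0)"
  have units: "icomp C (simp_trunc X) f (degen X 0 0 \<cdot>\<^bsub>C\<^esub> ?d1 0 \<cdot>\<^bsub>C\<^esub> f) = f
    \<and> icomp C (simp_trunc X) (degen X 0 0 \<cdot>\<^bsub>C\<^esub> ?d1 (Suc 0) \<cdot>\<^bsub>C\<^esub> f) f = f"
    if f: "f \<in> Ar C" "Cod C f = ?X1" for f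
  proof
    show "icomp C (simp_trunc X) f (degen X 0 0 \<cdot>\<^bsub>C\<^esub> ?d1 0 \<cdot>\<^bsub>C\<^esub> f) = f"
      using f comp_reassoc[OF face_degen_same(1)[of "Suc 0" "Suc 0"], of f]
        comp_reassoc[OF face_degen_same(2)[of "Suc 0" "Suc 0"], of f]
        comp_reassoc[OF face_degen_less[of 0 "Suc 0" 0], of f]
      by (subst icomp_trunc[of "degen X (Suc 0) (Suc 0) \<cdot>\<^bsub>C\<^esub> f"]) (simp_all add: comp_assoc)
    show "icomp C (simp_trunc X) (degen X 0 0 \<cdot>\<^bsub>C\<^esub> ?d1 (Suc 0) \<cdot>\<^bsub>C\<^esub> f) f = f"
      using f comp_reassoc[OF face_degen_same(1)[of 0 "Suc 0"], of f]
        comp_reassoc[OF face_degen_same(2)[of 0 "Suc 0"], of f]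
        comp_reassoc[OF face_degen_greater[of 0 "Suc (Suc 0)" 0], of f]
      by (subst icomp_trunc[of "degen X (Suc 0) 0 \<cdot>\<^bsub>C\<^esub> f"]) (simp_all add: comp_assoc)
  qed
  have assoc: "icomp C (simp_trunc X) h (icomp C (simp_trunc X) g f) = icomp C (simp_trunc X) (icomp C (simp_trunc X) h g) f"
    if f: "f \<in> Ar C" "Dom C f = x" "Cod C f = ?X1" and g: "g \<in> Ar C" "Dom C g = x" "Cod C g = ?X1"
      and h: "h \<in> Ar C" "Dom C h = x" "Cod C h = ?X1"
      and hg: "?d1 0 \<cdot>\<^bsub>C\<^esub> h = ?d1 (Suc 0) \<cdot>\<^bsub>C\<^esub> g" and gf: "?d1 0 \<cdot>\<^bsub>C\<^esub> g = ?d1 (Suc 0) \<cdot>\<^bsub>C\<^esub> f" for x f g h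
  proof -
    obtain a where a: "a \<in> Ar C" "Dom C a = x" "Cod C a = sob X (Suc (Suc 0))" "?d2 (Suc (Suc 0)) \<cdot>\<^bsub>C\<^esub> a = h" "?d2 0 \<cdot>\<^bsub>C\<^esub> a = g"
      by (rule pullback_factor[OF overlap[of 0], of h g x]) (use f g h hg in simp_all)
    obtain b where b: "b \<in> Ar C" "Dom C b = x" "Cod C b = sob X (Suc (Suc 0))" "?d2 (Suc (Suc 0)) \<cdot>\<^bsub>C\<^esub> b = g" "?d2 0 \<cdot>\<^bsub>C\<^esub> b = f"
      by (rule pullback_factor[OF overlap[of 0], of g f x]) (use f g h gf in simp_all)
    obtain k where k: "k \<in> Ar C" "Dom C k = x" "Cod C k = sob X (Suc (Suc (Suc 0)))"
        "?d3 (Suc (Suc (Suc 0))) \<cdot>\<^bsub>C\<^esub> k = a" "?d3 0 \<cdot>\<^bsub>C\<^esub> k = b"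
      by (rule pullback_factor[OF overlap[of "Suc 0"], of a b x]) (use a b in simp_all)
    have ff: "?d2 i \<cdot>\<^bsub>C\<^esub> ?d3 j \<cdot>\<^bsub>C\<^esub> k = ?d2 (j - 1) \<cdot>\<^bsub>C\<^esub> ?d3 i \<cdot>\<^bsub>C\<^esub> k" if "i < j" "j \<le> Suc (Suc (Suc 0))" for i j
      using comp_reassoc[OF face_face[OF that]] that k(1-3) by (simp add: comp_assoc)
    have hg': "icomp C (simp_trunc X) h g = ?d2 (Suc 0) \<cdot>\<^bsub>C\<^esub> a" and gf': "icomp C (simp_trunc X) g f = ?d2 (Suc 0) \<cdot>\<^bsub>C\<^esub> b"
      using a b by (auto intro: icomp_trunc)
    have "icomp C (simp_trunc X) h (icomp C (simp_trunc X) g f) = ?d2 (Suc 0) \<cdot>\<^bsub>C\<^esub> ?d3 (Suc (Suc 0)) \<cdot>\<^bsub>C\<^esub> k"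
      by (rule icomp_trunc) (use k a b ff[of "Suc (Suc 0)" "Suc (Suc (Suc 0))"] ff[of 0 "Suc (Suc 0)"] in \<open>simp_all add: gf'\<close>)
    moreover have "icomp C (simp_trunc X) (icomp C (simp_trunc X) h g) f = ?d2 (Suc 0) \<cdot>\<^bsub>C\<^esub> ?d3 (Suc 0) \<cdot>\<^bsub>C\<^esub> k"
      by (rule icomp_trunc) (use k a b ff[of "Suc 0" "Suc (Suc (Suc 0))"] ff[of 0 "Suc 0"] in \<open>simp_all add: hg'\<close>)
    ultimately show ?thesis using ff[of "Suc 0" "Suc (Suc 0)"] by simp
  qed
  show ?thesis unfolding internal_category_def
    using units assoc overlap[of 0] face_degen_same[of 0 0] face_face[of 0 "Suc 0" 0] face_face[of "Suc 0" "Suc (Suc 0)" 0]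
    by (simp add: hom_def)
qed

lemma is_nerve_trunc: "is_nerve C (simp_trunc X) X"
proof -
  have "\<exists>!k. k \<in> hom C x (sob X n) \<and> (\<forall>i < n. edge C X n i \<cdot>\<^bsub>C\<^esub> k = g i)"
    if n: "0 < n" and g: "\<forall>i < n. g i \<in> hom C x (sob X (Suc 0))"
      "\<forall>i. Suc i < n \<longrightarrow> face X (Suc 0) 0 \<cdot>\<^bsub>C\<^esub> g i = face X (Suc 0) (Suc 0) \<cdot>\<^bsub>C\<^esub> g (Suc i)" for n x g
  proof -
    obtain m where m: "n = Suc m" using n by (cases n) auto
    show ?thesis
    proof (rule ex_ex1I)
      show "\<exists>k. k \<in> hom C x (sob X n) \<and> (\<forall>i < n. edge C X n i \<cdot>\<^bsub>C\<^esub> k = g i)"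
        unfolding m by (rule edges_exist) (use g m in auto)
    next
      fix k k' assume "k \<in> hom C x (sob X n) \<and> (\<forall>i < n. edge C X n i \<cdot>\<^bsub>C\<^esub> k = g i)"
        "k' \<in> hom C x (sob X n) \<and> (\<forall>i < n. edge C X n i \<cdot>\<^bsub>C\<^esub> k' = g i)"
      then show "k = k'" unfolding m by (intro edges_unique[of k k' x m]) (auto simp: hom_def)
    qed
  qed
  then show ?thesis unfolding is_nerve_def
    using internal_category_trunc simplicial by (simp add: numeral_2_eq_2)
qed

end


section \<open>Bar constructions\<close>

definition right_action :: "('p, 'n) cat \<Rightarrow> ('p, 'n) mnd \<Rightarrow> ('o, 'm) cat \<Rightarrow> ('p, 'n, 'o, 'm) fnc \<Rightarrow> ('p \<Rightarrow> 'm) \<Rightarrow> bool" where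
  "right_action E T D G act \<longleftrightarrow> nat_trans E D (comp_fnc G (mfn T)) G act
     \<and> (\<forall>x \<in> Ob E. act x \<cdot>\<^bsub>D\<^esub> act (mo T x) = act x \<cdot>\<^bsub>D\<^esub> fa G (mult T x)
          \<and> act x \<cdot>\<^bsub>D\<^esub> fa G (unt T x) = Idt D (fo G x))"

lemma (in category) terminal_bang:
  assumes "terminal C t"
  shows "t \<in> Ob C" "a \<in> Ob C \<Longrightarrow> bang C t a \<in> Ar C" "a \<in> Ob C \<Longrightarrow> Dom C (bang C t a) = a" "a \<in> Ob C \<Longrightarrow> Cod C (bang C t a) = t"
    "f \<in> Ar C \<Longrightarrow> g \<in> Ar C \<Longrightarrow> Cod C f = t \<Longrightarrow> Cod C g = t \<Longrightarrow> Dom C f = Dom C g \<Longrightarrow> f = g"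
proof -
  have u: "\<exists>!f. f \<in> hom C a t" if "a \<in> Ob C" for a using that assms by (auto simp: terminal_def)
  show "t \<in> Ob C" using assms by (simp add: terminal_def)
  show "a \<in> Ob C \<Longrightarrow> bang C t a \<in> Ar C" "a \<in> Ob C \<Longrightarrow> Dom C (bang C t a) = a" "a \<in> Ob C \<Longrightarrow> Cod C (bang C t a) = t"
    using theI'[OF u[of a]] by (auto simp: bang_def hom_def)
  show "f \<in> Ar C \<Longrightarrow> g \<in> Ar C \<Longrightarrow> Cod C f = t \<Longrightarrow> Cod C g = t \<Longrightarrow> Dom C f = Dom C g \<Longrightarrow> f = g"
    using u[of "Dom C g"] by (auto simp: hom_def)
qed

locale bar_data = mon E T + D: category D for E :: "('p, 'n) cat" and T and D :: "('o, 'm) cat" +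
  fixes G :: "('p, 'n, 'o, 'm) fnc" and act :: "'p \<Rightarrow> 'm" and one :: 'p
  assumes action: "right_action E T D G act" and terminal: "terminal E one"
begin

sublocale G: is_functor E D G using action by (simp add: right_action_def nat_trans_def)

lemma act [simp]: "x \<in> Ob E \<Longrightarrow> act x \<in> Ar D" "x \<in> Ob E \<Longrightarrow> Dom D (act x) = fo G (mo T x)"
    "x \<in> Ob E \<Longrightarrow> Cod D (act x) = fo G x"
  using action by (auto simp: right_action_def nat_trans_def hom_def)

lemma act_nat: "f \<in> Ar E \<Longrightarrow> Dom E f = x \<Longrightarrow> Cod E f = y \<Longrightarrow> fa G f \<cdot>\<^bsub>D\<^esub> act x = act y \<cdot>\<^bsub>D\<^esub> fa G (ma T f)"
  and act_mult: "x \<in> Ob E \<Longrightarrow> act x \<cdot>\<^bsub>D\<^esub> act (mo T x) = act x \<cdot>\<^bsub>D\<^esub> fa G (mult T x)"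
  and act_unt: "x \<in> Ob E \<Longrightarrow> act x \<cdot>\<^bsub>D\<^esub> fa G (unt T x) = Idt D (fo G x)"
  using action by (auto simp: right_action_def nat_trans_def)

lemmas bang [simp] = T.A.terminal_bang(1-4)[OF terminal]

abbreviation P :: "nat \<Rightarrow> 'p" where "P k \<equiv> (mo T ^^ k) one"
abbreviation M :: "nat \<Rightarrow> 'n \<Rightarrow> 'n" where "M k \<equiv> ma T ^^ k"

lemma funpow_ob [simp]: "x \<in> Ob E \<Longrightarrow> (mo T ^^ k) x \<in> Ob E"
  by (induction k) auto

lemma M [simp]: "f \<in> Ar E \<Longrightarrow> M k f \<in> Ar E" "f \<in> Ar E \<Longrightarrow> Dom E (M k f) = (mo T ^^ k) (Dom E f)"
    "f \<in> Ar E \<Longrightarrow> Cod E (M k f) = (mo T ^^ k) (Cod E f)"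
  by (induction k) auto

lemma M_comp: "f \<in> Ar E \<Longrightarrow> g \<in> Ar E \<Longrightarrow> Cod E f = Dom E g \<Longrightarrow> M k (g \<cdot>\<^bsub>E\<^esub> f) = M k g \<cdot>\<^bsub>E\<^esub> M k f"
  by (induction k) auto

lemma M_id: "x \<in> Ob E \<Longrightarrow> M k (Idt E x) = Idt E ((mo T ^^ k) x)"
  by (induction k) auto

lemma P_le: "j \<le> k \<Longrightarrow> (mo T ^^ j) (P (k - j)) = P k"
  by (simp flip: funpow_add[unfolded comp_def, THEN fun_cong])

text \<open>All faces except the face \<open>0\<close> are iterates of \<open>T\<close> on the maps \<open>T\<^sup>m\<^sup>+\<^sup>1(1) \<rightarrow> T\<^sup>m(1)\<close> below. The
  terminal map and the multiplications can be treated alike, since the terminal object is an algebra.\<close>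

definition collapse :: "nat \<Rightarrow> 'n" where
  "collapse m = (case m of 0 \<Rightarrow> bang E one (mo T one) | Suc m \<Rightarrow> mult T (P m))"

lemma collapse_ar [simp]: "collapse m \<in> Ar E" "Dom E (collapse m) = mo T (P m)" "Cod E (collapse m) = P m"
  by (auto simp: collapse_def split: nat.splits)

lemma collapse_unt: "collapse m \<cdot>\<^bsub>E\<^esub> unt T (P m) = Idt E (P m)"
proof (cases m)
  case 0
  then show ?thesis by (intro T.A.terminal_bang(5)[OF terminal]) simp_all
qed (simp add: collapse_def mult_unt)

text \<open>For \<open>r = 0\<close> this is associativity of the multiplication or uniqueness of maps to \<open>1\<close>; for
  \<open>r > 0\<close> it is naturality of the multiplication.\<close>

lemma collapse_collapse:
  assumes "r \<le> N"
  shows "collapse N \<cdot>\<^bsub>E\<^esub> ma T (M r (collapse (N - r))) = M r (collapse (N - r)) \<cdot>\<^bsub>E\<^esub> collapse (Suc N)"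
proof (cases r)
  case 0
  show ?thesis
  proof (cases N)
    case 0
    then show ?thesis using assms by (intro T.A.terminal_bang(5)[OF terminal]) simp_all
  qed (simp add: collapse_def mult_mult 0)
next
  case (Suc s)
  then obtain N' where N: "N = Suc N'" using assms by (cases N) auto
  have le: "s \<le> N'" using assms Suc N by simp
  have "Dom E (M s (collapse (N' - s))) = P N" 
    using P_le[OF le] by (simp add: N flip: funpow_swap1)
  then show ?thesis using mult_nat[of "M s (collapse (N' - s))" "P N" "P N'"] P_le[OF le]
    by (simp add: Suc N collapse_def[of "Suc _"])
qed

lemma bar_sob [simp]: "sob (bar E T one G act) k = fo G (P k)"
  and bar_face [simp]: "face (bar E T one G act) (Suc n) 0 = act (P n)"
    "i \<le> n \<Longrightarrow> face (bar E T one G act) (Suc n) (Suc i) = fa G (M i (collapse (n - i)))"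
  and bar_degen [simp]: "degen (bar E T one G act) n i = fa G (M i (unt T (P (n - i))))"
proof -
  show "face (bar E T one G act) (Suc n) (Suc i) = fa G (M i (collapse (n - i)))" if "i \<le> n"
  proof (cases "n - i")
    case (Suc m)
    then have "m = n - Suc i" by simp
    then show ?thesis using that Suc by (auto simp: bar_def collapse_def)
  qed (use that in \<open>auto simp: bar_def collapse_def\<close>)
qed (simp_all add: bar_def)

lemma image_square:
  assumes "a \<cdot>\<^bsub>E\<^esub> b = c \<cdot>\<^bsub>E\<^esub> d" "a \<in> Ar E" "b \<in> Ar E" "c \<in> Ar E" "d \<in> Ar E" "Cod E b = Dom E a" "Cod E d = Dom E c"
  shows "fa G (M k a) \<cdot>\<^bsub>D\<^esub> fa G (M k b) = fa G (M k c) \<cdot>\<^bsub>D\<^esub> fa G (M k d)"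
proof -
  have "fa G (M k (a \<cdot>\<^bsub>E\<^esub> b)) = fa G (M k (c \<cdot>\<^bsub>E\<^esub> d))" using assms(1) by simp
  then show ?thesis using assms(2-7) by (simp add: M_comp)
qed

lemma image_id:
  assumes "a \<cdot>\<^bsub>E\<^esub> b = Idt E x" "a \<in> Ar E" "b \<in> Ar E" "x \<in> Ob E" "Cod E b = Dom E a"
  shows "fa G (M k a) \<cdot>\<^bsub>D\<^esub> fa G (M k b) = Idt D (fo G ((mo T ^^ k) x))"
proof -
  have "fa G (M k (a \<cdot>\<^bsub>E\<^esub> b)) = fa G (M k (Idt E x))" using assms(1) by simp
  then show ?thesis using assms(2-5) by (simp add: M_comp M_id)
qed

text \<open>The operators other than the face \<open>0\<close> all lie in the image of \<open>G\<close>, and after removing the common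
  iterate of \<open>T\<close> their identities are the laws of the monad, its naturality squares, or
  \<open>collapse_collapse\<close>. Those that involve the face \<open>0\<close> are the laws and the naturality of the action.\<close>

lemma simplicial_bar: "simplicial_object D (bar E T one G act)"
proof -
  let ?X = "bar E T one G act"
  have face_ty: "face ?X (Suc n) i \<in> hom D (sob ?X (Suc n)) (sob ?X n)" if "i \<le> Suc n" for n i
    using that P_le by (cases i) (auto simp: hom_def simp flip: funpow_swap1)
  have degen_ty: "degen ?X n i \<in> hom D (sob ?X n) (sob ?X (Suc n))" if "i \<le> n" for n i
    using that P_le by (auto simp: hom_def simp flip: funpow_swap1)
  have ff: "face ?X (Suc n) i \<cdot>\<^bsub>D\<^esub> face ?X (Suc (Suc n)) j = face ?X (Suc n) (j - 1) \<cdot>\<^bsub>D\<^esub> face ?X (Suc (Suc n)) i"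
    if ij: "i < j" "j \<le> Suc (Suc n)" for n i j
  proof (cases i)
    case 0
    show ?thesis
    proof (cases "j = Suc 0")
      case True
      then show ?thesis using act_mult[of "P n"] by (simp add: 0 collapse_def)
    next
      case False
      then obtain r where r: "j = Suc (Suc r)" using ij by (cases j; cases "j - 1") auto
      then show ?thesis using act_nat[of "M r (collapse (n - r))" "P (Suc n)" "P n"] P_le[of r n] ij
        by (simp add: 0 flip: funpow_swap1)
    qed
  next
    case (Suc i')
    \<comment> \<open>The outer operator is \<open>T\<^sup>i'\<close> of a structure map and the inner one lies \<open>r + 1\<close> levels deeper, so
      \<open>T\<^sup>i'\<close> can be split off from both; the remaining identities use the same device.\<close>
    define r where "r = j - Suc (Suc i')"
    have j: "j = Suc (Suc (i' + r))" using ij Suc by (simp add: r_def)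
    have rn: "i' + r \<le> n" using ij by (simp add: j)
    have N: "n - (i' + r) = n - i' - r" "Suc n - Suc (i' + r) = n - i' - r" "Suc n - i' = Suc (n - i')"
      using rn by auto
    have le: "r \<le> n - i'" using rn by simp
    have P1: "(mo T ^^ r) (P (n - i' - r)) = P (n - i')" using P_le[OF le] by simp
    have "fa G (M i' (collapse (n - i'))) \<cdot>\<^bsub>D\<^esub> fa G (M i' (ma T (M r (collapse (n - i' - r)))))
        = fa G (M i' (M r (collapse (n - i' - r)))) \<cdot>\<^bsub>D\<^esub> fa G (M i' (collapse (Suc (n - i'))))"
      by (rule image_square[OF collapse_collapse[OF le]]) (use P1 in \<open>simp_all flip: funpow_swap1\<close>)
    then show ?thesis using rn by (simp add: Suc j N funpow_add del: diff_diff_left flip: funpow_swap1)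
  qed
  have fd_less: "face ?X (Suc (Suc n)) i \<cdot>\<^bsub>D\<^esub> degen ?X (Suc n) j = degen ?X n (j - 1) \<cdot>\<^bsub>D\<^esub> face ?X (Suc n) i"
    if ij: "i < j" "j \<le> Suc n" for n i j
  proof (cases i)
    case 0
    then obtain r where r: "j = Suc r" using ij by (cases j) auto
    then show ?thesis using act_nat[of "M r (unt T (P (n - r)))" "P n" "P (Suc n)"] P_le[of r n] ij
      by (simp add: 0 flip: funpow_swap1)
  next
    case (Suc i')
    define r where "r = j - Suc (Suc i')"
    have j: "j = Suc (Suc (i' + r))" using ij Suc by (simp add: r_def)
    define N where "N = n - Suc i'"
    have N: "n - i' = Suc N" "Suc n - i' = Suc (Suc N)" "n - Suc (i' + r) = N - r" "Suc n - Suc (Suc (i' + r)) = N - r"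
      using ij by (simp_all add: j N_def)
    have le: "r \<le> N" using ij by (simp add: j N_def)
    have "ma T (M r (unt T (P (N - r)))) \<cdot>\<^bsub>E\<^esub> mult T (P N) = mult T (mo T (P N)) \<cdot>\<^bsub>E\<^esub> ma T (ma T (M r (unt T (P (N - r)))))"
      by (rule mult_nat) (use P_le[OF le] in \<open>simp_all flip: funpow_swap1\<close>)
    then have "fa G (M i' (collapse (Suc (Suc N)))) \<cdot>\<^bsub>D\<^esub> fa G (M i' (ma T (ma T (M r (unt T (P (N - r)))))))
      = fa G (M i' (ma T (M r (unt T (P (N - r)))))) \<cdot>\<^bsub>D\<^esub> fa G (M i' (collapse (Suc N)))"
      by (intro image_square) (use P_le[OF le] in \<open>simp_all add: collapse_def flip: funpow_swap1\<close>)
    then show ?thesis using ij by (simp add: Suc j N funpow_add del: diff_diff_left flip: funpow_swap1)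
  qed
  have fd_same: "face ?X (Suc n) j \<cdot>\<^bsub>D\<^esub> degen ?X n j = Idt D (sob ?X n)"
      "face ?X (Suc n) (Suc j) \<cdot>\<^bsub>D\<^esub> degen ?X n j = Idt D (sob ?X n)" if j: "j \<le> n" for n j
  proof -
    show "face ?X (Suc n) j \<cdot>\<^bsub>D\<^esub> degen ?X n j = Idt D (sob ?X n)"
    proof (cases j)
      case 0
      then show ?thesis using act_unt[of "P n"] by simp
    next
      case (Suc j')
      define N where "N = n - j"
      have N: "n - j' = Suc N" "n - Suc j' = N" using j by (simp_all add: N_def Suc)
      have "fa G (M j' (collapse (Suc N))) \<cdot>\<^bsub>D\<^esub> fa G (M j' (ma T (unt T (P N)))) = Idt D (fo G ((mo T ^^ j') (P (Suc N))))"
        by (rule image_id) (simp_all add: collapse_def mult_map_unt)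
      then show ?thesis using j P_le[of j' n] by (simp add: Suc N flip: funpow_swap1)
    qed
    have "fa G (M j (collapse (n - j))) \<cdot>\<^bsub>D\<^esub> fa G (M j (unt T (P (n - j)))) = Idt D (fo G ((mo T ^^ j) (P (n - j))))"
      by (rule image_id) (simp_all add: collapse_unt)
    then show "face ?X (Suc n) (Suc j) \<cdot>\<^bsub>D\<^esub> degen ?X n j = Idt D (sob ?X n)"
      using j P_le[OF j] by simp
  qed
  have fd_greater: "face ?X (Suc (Suc n)) i \<cdot>\<^bsub>D\<^esub> degen ?X (Suc n) j = degen ?X n j \<cdot>\<^bsub>D\<^esub> face ?X (Suc n) (i - 1)"
    if ij: "Suc j < i" "i \<le> Suc (Suc n)" for n i j
  proof -
    define r where "r = i - Suc (Suc j)"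
    have i: "i = Suc (Suc (j + r))" using ij by (simp add: r_def)
    define N where "N = n - j"
    have N: "n - j = N" "Suc n - j = Suc N" "n - (j + r) = N - r" "Suc n - Suc (j + r) = N - r"
      using ij by (simp_all add: i N_def)
    have le: "r \<le> N" using ij by (simp add: i N_def)
    have "ma T (M r (collapse (N - r))) \<cdot>\<^bsub>E\<^esub> unt T (mo T (P N)) = unt T (P N) \<cdot>\<^bsub>E\<^esub> M r (collapse (N - r))"
      by (rule unt_nat) (use P_le[OF le] in \<open>simp_all flip: funpow_swap1\<close>)
    then have "fa G (M j (ma T (M r (collapse (N - r))))) \<cdot>\<^bsub>D\<^esub> fa G (M j (unt T (P (Suc N))))
        = fa G (M j (unt T (P N))) \<cdot>\<^bsub>D\<^esub> fa G (M j (M r (collapse (N - r))))"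
      by (intro image_square) (use P_le[OF le] in \<open>simp_all flip: funpow_swap1\<close>)
    then show ?thesis using ij by (simp add: i N funpow_add del: diff_diff_left flip: funpow_swap1)
  qed
  have dd: "degen ?X (Suc n) i \<cdot>\<^bsub>D\<^esub> degen ?X n j = degen ?X (Suc n) (Suc j) \<cdot>\<^bsub>D\<^esub> degen ?X n i"
    if ij: "i \<le> j" "j \<le> n" for n i j
  proof -
    define r where "r = j - i"
    have j: "j = i + r" using ij by (simp add: r_def)
    define N where "N = n - i"
    have N: "n - i = N" "Suc n - i = Suc N" "n - (i + r) = N - r" "Suc n - Suc (i + r) = N - r"
      using ij by (simp_all add: j N_def)
    have le: "r \<le> N" using ij by (simp add: j N_def)
    have "ma T (M r (unt T (P (N - r)))) \<cdot>\<^bsub>E\<^esub> unt T (P N) = unt T (P (Suc N)) \<cdot>\<^bsub>E\<^esub> M r (unt T (P (N - r)))"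
      by (rule unt_nat) (use P_le[OF le] in \<open>simp_all flip: funpow_swap1\<close>)
    then have "fa G (M i (unt T (P (Suc N)))) \<cdot>\<^bsub>D\<^esub> fa G (M i (M r (unt T (P (N - r)))))
        = fa G (M i (ma T (M r (unt T (P (N - r)))))) \<cdot>\<^bsub>D\<^esub> fa G (M i (unt T (P N)))"
      by (intro image_square) (use P_le[OF le] in \<open>simp_all flip: funpow_swap1\<close>)
    then show ?thesis by (simp add: j N funpow_add del: diff_diff_left flip: funpow_swap1)
  qed
  show ?thesis unfolding simplicial_object_def
    using face_ty degen_ty ff fd_less fd_same fd_greater dd
    by (simp del: bar_face bar_degen)
qed

text \<open>If the action is cartesian, its naturality square at \<open>T\<^sup>n\<close> of the map \<open>T 1 \<rightarrow> 1\<close> is the overlap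
  square.\<close>

lemma segal_bar:
  assumes cart: "\<And>f. f \<in> Ar E \<Longrightarrow> pullback D (fa G f) (act (Cod E f)) (act (Dom E f)) (fa G (ma T f))"
  shows "segal D (bar E T one G act)"
proof (intro segal.intro simplicial.intro simplicial_axioms.intro segal_axioms.intro simplicial_bar)
  show "category D" by unfold_locales
  fix n
  have "pullback D (act (P n)) (fa G (M n (collapse 0))) (fa G (ma T (M n (collapse 0)))) (act (P (Suc n)))"
    by (rule D.pullback_swap) (use cart[of "M n (collapse 0)"] in \<open>simp flip: funpow_swap1\<close>)
  then show "pullback D (face (bar E T one G act) (Suc n) 0) (face (bar E T one G act) (Suc n) (Suc n))
     (face (bar E T one G act) (Suc (Suc n)) (Suc (Suc n))) (face (bar E T one G act) (Suc (Suc n)) 0)"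
    by simp
qed

end

lemma (in mon) right_action_free: "right_action C T (Alg C T) (free C T) (free_action T)"
  unfolding right_action_def nat_trans_def
  using FU.F.is_functor_axioms is_functor_comp[OF T.is_functor_axioms FU.F.is_functor_axioms]
  by (auto simp: hom_def free_action_def Alg_ar_iff mult_nat mult_mult mult_map_unt)

lemma right_action_map:
  assumes a: "right_action E T A F act" and T: "monad E T" and p: "is_functor A B p"
  shows "right_action E T B (comp_fnc p F) (\<lambda>x. fa p (act x))"
proof -
  interpret p: is_functor A B p by (rule p)
  interpret T: mon E T by unfold_locales (rule T)
  have F: "is_functor E A F" and FT: "is_functor E A (comp_fnc F (mfn T))"
    using a by (simp_all add: right_action_def nat_trans_def)
  interpret F: is_functor E A F by (rule F)
  have "is_functor E B (comp_fnc (comp_fnc p F) (mfn T))"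
    using is_functor_comp[OF FT p] by (simp add: comp_fnc_def)
  moreover have act: "x \<in> Ob E \<Longrightarrow> act x \<in> Ar A" "x \<in> Ob E \<Longrightarrow> Dom A (act x) = fo F (mo T x)"
    "x \<in> Ob E \<Longrightarrow> Cod A (act x) = fo F x" for x
    using a by (auto simp: right_action_def nat_trans_def hom_def)
  moreover have "fa p (fa F f) \<cdot>\<^bsub>B\<^esub> fa p (act (Dom E f)) = fa p (act (Cod E f)) \<cdot>\<^bsub>B\<^esub> fa p (fa F (ma T f))" if "f \<in> Ar E" for f
  proof -
    have "fa F f \<cdot>\<^bsub>A\<^esub> act (Dom E f) = act (Cod E f) \<cdot>\<^bsub>A\<^esub> fa F (ma T f)"
      using a that by (auto simp: right_action_def nat_trans_def)
    then show ?thesis using that act by (simp flip: p.fa_comp')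
  qed
  moreover have "fa p (act x) \<cdot>\<^bsub>B\<^esub> fa p (act (mo T x)) = fa p (act x) \<cdot>\<^bsub>B\<^esub> fa p (fa F (mult T x))
     \<and> fa p (act x) \<cdot>\<^bsub>B\<^esub> fa p (fa F (unt T x)) = Idt B (fo p (fo F x))" if "x \<in> Ob E" for x
  proof -
    have "act x \<cdot>\<^bsub>A\<^esub> act (mo T x) = act x \<cdot>\<^bsub>A\<^esub> fa F (mult T x)" "act x \<cdot>\<^bsub>A\<^esub> fa F (unt T x) = Idt A (fo F x)"
      using a that by (auto simp: right_action_def)
    then show ?thesis using that act by (simp flip: p.fa_comp')
  qed
  ultimately show ?thesis unfolding right_action_def nat_trans_def
    using is_functor_comp[OF F p] by (auto simp: hom_def)
qed

lemma map_simp_bar: "map_simp p (bar E T t G act) = bar E T t (comp_fnc p G) (\<lambda>x. fa p (act x))"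
  by (simp add: map_simp_def bar_def fun_eq_iff)

text \<open>An isomorphism \<open>\<theta>\<close> of functors that is compatible with their actions can be cancelled on both sides of
  an equation. The action laws therefore pass from \<open>G\<close> to \<open>G'\<close>, cartesianness passes back from
  \<open>G'\<close> to \<open>G\<close>, and the components of \<open>\<theta>\<close> at \<open>T\<^sup>n 1\<close> form an isomorphism of bar constructions.\<close>

locale action_iso = bar_data E T D G act one for E :: "('p, 'n) cat" and T and D :: "('o, 'm) cat" and G act one +
  fixes G' :: "('p, 'n, 'o, 'm) fnc" and act' :: "'p \<Rightarrow> 'm" and \<theta> :: "'p \<Rightarrow> 'm"
  assumes nat': "nat_trans E D (comp_fnc G' (mfn T)) G' act'"
    and iso: "x \<in> Ob E \<Longrightarrow> is_iso D (\<theta> x)"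
    and \<theta> [simp]: "x \<in> Ob E \<Longrightarrow> \<theta> x \<in> Ar D" "x \<in> Ob E \<Longrightarrow> Dom D (\<theta> x) = fo G x" "x \<in> Ob E \<Longrightarrow> Cod D (\<theta> x) = fo G' x"
    and \<theta>_nat: "f \<in> Ar E \<Longrightarrow> \<theta> (Cod E f) \<cdot>\<^bsub>D\<^esub> fa G f = fa G' f \<cdot>\<^bsub>D\<^esub> \<theta> (Dom E f)"
    and \<theta>_act: "x \<in> Ob E \<Longrightarrow> \<theta> x \<cdot>\<^bsub>D\<^esub> act x = act' x \<cdot>\<^bsub>D\<^esub> \<theta> (mo T x)"
begin

sublocale G': is_functor E D G' using nat' by (simp add: nat_trans_def)

lemma act' [simp]: "x \<in> Ob E \<Longrightarrow> act' x \<in> Ar D" "x \<in> Ob E \<Longrightarrow> Dom D (act' x) = fo G' (mo T x)"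
    "x \<in> Ob E \<Longrightarrow> Cod D (act' x) = fo G' x"
  using nat' by (auto simp: nat_trans_def hom_def)

lemma \<theta>_nat_el: "f \<in> Ar E \<Longrightarrow> Dom E f = a \<Longrightarrow> Cod E f = b \<Longrightarrow> z \<in> Ar D \<Longrightarrow> Cod D z = fo G a
    \<Longrightarrow> \<theta> b \<cdot>\<^bsub>D\<^esub> fa G f \<cdot>\<^bsub>D\<^esub> z = fa G' f \<cdot>\<^bsub>D\<^esub> \<theta> a \<cdot>\<^bsub>D\<^esub> z"
  using D.comp_reassoc[OF \<theta>_nat] by (auto simp: D.comp_assoc)

lemma \<theta>_act_el: "x \<in> Ob E \<Longrightarrow> z \<in> Ar D \<Longrightarrow> Cod D z = fo G (mo T x)
    \<Longrightarrow> \<theta> x \<cdot>\<^bsub>D\<^esub> act x \<cdot>\<^bsub>D\<^esub> z = act' x \<cdot>\<^bsub>D\<^esub> \<theta> (mo T x) \<cdot>\<^bsub>D\<^esub> z"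
  using D.comp_reassoc[OF \<theta>_act] by (auto simp: D.comp_assoc)

lemma action': "right_action E T D G' act'"
proof -
  have "act' x \<cdot>\<^bsub>D\<^esub> act' (mo T x) = act' x \<cdot>\<^bsub>D\<^esub> fa G' (mult T x)" if x: "x \<in> Ob E" for x
  proof (rule D.iso_cancel_right[OF iso[of "mo T (mo T x)"]])
    have "(act' x \<cdot>\<^bsub>D\<^esub> act' (mo T x)) \<cdot>\<^bsub>D\<^esub> \<theta> (mo T (mo T x)) = \<theta> x \<cdot>\<^bsub>D\<^esub> act x \<cdot>\<^bsub>D\<^esub> act (mo T x)"
      using x by (simp add: \<theta>_act_el \<theta>_act D.comp_assoc)
    also have "\<dots> = (act' x \<cdot>\<^bsub>D\<^esub> fa G' (mult T x)) \<cdot>\<^bsub>D\<^esub> \<theta> (mo T (mo T x))"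
      using x \<theta>_nat[of "mult T x"] by (simp add: act_mult \<theta>_act_el D.comp_assoc)
    finally show "(act' x \<cdot>\<^bsub>D\<^esub> act' (mo T x)) \<cdot>\<^bsub>D\<^esub> \<theta> (mo T (mo T x)) = (act' x \<cdot>\<^bsub>D\<^esub> fa G' (mult T x)) \<cdot>\<^bsub>D\<^esub> \<theta> (mo T (mo T x))" .
  qed (use x in simp_all)
  moreover have "act' x \<cdot>\<^bsub>D\<^esub> fa G' (unt T x) = Idt D (fo G' x)" if x: "x \<in> Ob E" for x
  proof (rule D.iso_cancel_right[OF iso[of x]])
    have "\<theta> x \<cdot>\<^bsub>D\<^esub> act x \<cdot>\<^bsub>D\<^esub> fa G (unt T x) = (act' x \<cdot>\<^bsub>D\<^esub> fa G' (unt T x)) \<cdot>\<^bsub>D\<^esub> \<theta> x"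
      using x \<theta>_nat[of "unt T x"] by (simp add: \<theta>_act_el D.comp_assoc)
    then show "(act' x \<cdot>\<^bsub>D\<^esub> fa G' (unt T x)) \<cdot>\<^bsub>D\<^esub> \<theta> x = Idt D (fo G' x) \<cdot>\<^bsub>D\<^esub> \<theta> x"
      using x by (simp add: act_unt)
  qed (use x in simp_all)
  ultimately show ?thesis using nat' by (simp add: right_action_def)
qed

lemma cartesian_transport:
  assumes f: "f \<in> Ar E" and pb: "pullback D (fa G' f) (act' (Cod E f)) (act' (Dom E f)) (fa G' (ma T f))"
  shows "pullback D (fa G f) (act (Cod E f)) (act (Dom E f)) (fa G (ma T f))"
proof (rule D.pullbackI)
  let ?a = "Dom E f" and ?b = "Cod E f"
  note [simp] = f
  show "fa G f \<cdot>\<^bsub>D\<^esub> act ?a = act ?b \<cdot>\<^bsub>D\<^esub> fa G (ma T f)" by (simp add: act_nat)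
  fix x h k assume h: "h \<in> Ar D" "k \<in> Ar D" "Dom D h = x" "Dom D k = x" "Cod D h = Dom D (fa G f)" "Cod D k = Dom D (act ?b)"
    and e: "fa G f \<cdot>\<^bsub>D\<^esub> h = act ?b \<cdot>\<^bsub>D\<^esub> k"
  have "fa G' f \<cdot>\<^bsub>D\<^esub> \<theta> ?a \<cdot>\<^bsub>D\<^esub> h = act' ?b \<cdot>\<^bsub>D\<^esub> \<theta> (mo T ?b) \<cdot>\<^bsub>D\<^esub> k"
    using h e \<theta>_nat_el[of f ?a ?b h] \<theta>_act_el[of ?b k] by simp
  then obtain m where m: "m \<in> Ar D" "Dom D m = x" "Cod D m = fo G' (mo T ?a)" "act' ?a \<cdot>\<^bsub>D\<^esub> m = \<theta> ?a \<cdot>\<^bsub>D\<^esub> h"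
      "fa G' (ma T f) \<cdot>\<^bsub>D\<^esub> m = \<theta> (mo T ?b) \<cdot>\<^bsub>D\<^esub> k"
    using D.pullback_factor[OF pb, of "\<theta> ?a \<cdot>\<^bsub>D\<^esub> h" "\<theta> (mo T ?b) \<cdot>\<^bsub>D\<^esub> k" x] h by auto
  obtain j where j: "j \<in> Ar D" "Dom D j = fo G' (mo T ?a)" "Cod D j = fo G (mo T ?a)"
      "\<theta> (mo T ?a) \<cdot>\<^bsub>D\<^esub> j = Idt D (fo G' (mo T ?a))"
    using D.is_isoE[OF iso[of "mo T ?a"]] by auto
  have jm: "\<theta> (mo T ?a) \<cdot>\<^bsub>D\<^esub> j \<cdot>\<^bsub>D\<^esub> m = m" using D.comp_reassoc[OF j(4)] j m by simp
  have "act ?a \<cdot>\<^bsub>D\<^esub> j \<cdot>\<^bsub>D\<^esub> m = h"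
    by (rule D.iso_cancel_left[OF iso[of ?a]]) (use j m h jm in \<open>simp_all add: \<theta>_act_el\<close>)
  moreover have "fa G (ma T f) \<cdot>\<^bsub>D\<^esub> j \<cdot>\<^bsub>D\<^esub> m = k"
    by (rule D.iso_cancel_left[OF iso[of "mo T ?b"]]) (use j m h jm in \<open>simp_all add: \<theta>_nat_el\<close>)
  ultimately show "\<exists>m. m \<in> Ar D \<and> Dom D m = x \<and> Cod D m = Dom D (act ?a) \<and> act ?a \<cdot>\<^bsub>D\<^esub> m = h \<and> fa G (ma T f) \<cdot>\<^bsub>D\<^esub> m = k"
    using j m by (intro exI[of _ "j \<cdot>\<^bsub>D\<^esub> m"]) simp
next
  let ?a = "Dom E f" and ?b = "Cod E f"
  note [simp] = f
  fix x m n assume m: "m \<in> Ar D" "n \<in> Ar D" "Dom D m = x" "Dom D n = x" "Cod D m = Dom D (act ?a)" "Cod D n = Dom D (act ?a)"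
    and e: "act ?a \<cdot>\<^bsub>D\<^esub> m = act ?a \<cdot>\<^bsub>D\<^esub> n" "fa G (ma T f) \<cdot>\<^bsub>D\<^esub> m = fa G (ma T f) \<cdot>\<^bsub>D\<^esub> n"
  have "act' ?a \<cdot>\<^bsub>D\<^esub> \<theta> (mo T ?a) \<cdot>\<^bsub>D\<^esub> m = act' ?a \<cdot>\<^bsub>D\<^esub> \<theta> (mo T ?a) \<cdot>\<^bsub>D\<^esub> n"
    using m e(1) by (simp flip: \<theta>_act_el)
  moreover have "fa G' (ma T f) \<cdot>\<^bsub>D\<^esub> \<theta> (mo T ?a) \<cdot>\<^bsub>D\<^esub> m = fa G' (ma T f) \<cdot>\<^bsub>D\<^esub> \<theta> (mo T ?a) \<cdot>\<^bsub>D\<^esub> n"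
    using m e(2) \<theta>_nat_el[of "ma T f" "mo T ?a" "mo T ?b"] by (metis (no_types, lifting) T.fa_ar T.fa_cod T.fa_dom act(2) T.A.dom_in f)
  ultimately have "\<theta> (mo T ?a) \<cdot>\<^bsub>D\<^esub> m = \<theta> (mo T ?a) \<cdot>\<^bsub>D\<^esub> n"
    by (rule D.pullback_unique[OF pb, rotated 5]) (use m in simp_all)
  then show "m = n" by (rule D.iso_cancel_left[OF iso[of "mo T ?a"], rotated 5]) (use m in simp_all)
qed (use f in simp_all)

lemma simp_isomorphic_bar: "simp_isomorphic D (bar E T one G act) (bar E T one G' act')"
proof -
  interpret B: bar_data E T D G' act' one by unfold_locales (rule action' terminal)+
  let ?X = "bar E T one G act" and ?Y = "bar E T one G' act'"
  interpret X: simplicial D ?X by unfold_locales (rule simplicial_bar)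
  have "\<theta> (P n) \<cdot>\<^bsub>D\<^esub> face ?X (Suc n) i = face ?Y (Suc n) i \<cdot>\<^bsub>D\<^esub> \<theta> (P (Suc n))" if i: "i \<le> Suc n" for n i
  proof (cases i)
    case 0
    then show ?thesis using \<theta>_act[of "P n"] by simp
  next
    case (Suc j)
    then show ?thesis using \<theta>_nat[of "M j (collapse (n - j))"] P_le[of j n] i by (simp flip: funpow_swap1)
  qed
  moreover have "\<theta> (P (Suc n)) \<cdot>\<^bsub>D\<^esub> degen ?X n i = degen ?Y n i \<cdot>\<^bsub>D\<^esub> \<theta> (P n)" if i: "i \<le> n" for n i
    using \<theta>_nat[of "M i (unt T (P (n - i)))"] P_le[OF i] by (simp flip: funpow_swap1)
  ultimately show ?thesis unfolding simp_isomorphic_def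
    using simplicial_bar B.simplicial_bar iso
    by (intro conjI exI[of _ "\<lambda>n. \<theta> (P n)"]) (simp_all add: hom_def del: bar_face bar_degen B.bar_face B.bar_degen)
qed

end

section \<open>Representable 2-functors\<close>

text \<open>A bijection on objects and arrows that respects the operations transports the category laws.\<close>

locale cat_bij = A: category A for A :: "('o, 'm) cat" +
  fixes B :: "('p, 'n) cat" and \<Phi> :: "('o, 'm, 'p, 'n) fnc"
  assumes bij_ob: "bij_betw (fo \<Phi>) (Ob A) (Ob B)" and bij_ar: "bij_betw (fa \<Phi>) (Ar A) (Ar B)"
    and dom: "f \<in> Ar A \<Longrightarrow> Dom B (fa \<Phi> f) = fo \<Phi> (Dom A f)"
    and cod: "f \<in> Ar A \<Longrightarrow> Cod B (fa \<Phi> f) = fo \<Phi> (Cod A f)"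
    and ide: "a \<in> Ob A \<Longrightarrow> Idt B (fo \<Phi> a) = fa \<Phi> (Idt A a)"
    and comp: "f \<in> Ar A \<Longrightarrow> g \<in> Ar A \<Longrightarrow> Cod A f = Dom A g \<Longrightarrow> fa \<Phi> g \<cdot>\<^bsub>B\<^esub> fa \<Phi> f = fa \<Phi> (g \<cdot>\<^bsub>A\<^esub> f)"
begin

lemma ob [simp]: "a \<in> Ob A \<Longrightarrow> fo \<Phi> a \<in> Ob B" and ar [simp]: "f \<in> Ar A \<Longrightarrow> fa \<Phi> f \<in> Ar B"
  using bij_ob bij_ar by (auto dest: bij_betwE)

lemma ob_cases: assumes "x \<in> Ob B" obtains a where "a \<in> Ob A" "x = fo \<Phi> a"
  using assms bij_ob by (auto simp: bij_betw_def)

lemma ar_cases: assumes "x \<in> Ar B" obtains f where "f \<in> Ar A" "x = fa \<Phi> f"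
  using assms bij_ar by (auto simp: bij_betw_def)

lemma ob_inj: "a \<in> Ob A \<Longrightarrow> b \<in> Ob A \<Longrightarrow> fo \<Phi> a = fo \<Phi> b \<longleftrightarrow> a = b"
  using bij_ob by (auto simp: bij_betw_def inj_on_def)

lemma hom_cases:
  assumes "x \<in> hom B (fo \<Phi> a) (fo \<Phi> b)" "a \<in> Ob A" "b \<in> Ob A" obtains f where "f \<in> hom A a b" "x = fa \<Phi> f"
proof -
  obtain f where "f \<in> Ar A" "x = fa \<Phi> f" using ar_cases assms(1) by (auto simp: hom_def)
  then show ?thesis using that[of f] assms by (auto simp: hom_def dom cod ob_inj)
qed

lemma category_B: "category B"
proof
  show dom_in: "Dom B x \<in> Ob B" "Cod B x \<in> Ob B" if "x \<in> Ar B" for x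
    using that by (auto elim!: ar_cases simp: dom cod)
  show "Idt B x \<in> hom B x x" if "x \<in> Ob B" for x
    using that by (auto elim!: ob_cases simp: hom_def ide dom cod)
  fix a b c e x y z assume x: "x \<in> hom B a b"
  then obtain a' b' where ab: "a' \<in> Ob A" "b' \<in> Ob A" "a = fo \<Phi> a'" "b = fo \<Phi> b'"
    using dom_in[of x] by (auto simp: hom_def elim!: ob_cases)
  then obtain f where f: "f \<in> hom A a' b'" "x = fa \<Phi> f" using hom_cases x by blast
  show "Idt B b \<cdot>\<^bsub>B\<^esub> x = x" "x \<cdot>\<^bsub>B\<^esub> Idt B a = x"
    using f ab by (auto simp: hom_def ide comp)
  assume y: "y \<in> hom B b c"
  then obtain c' where c: "c' \<in> Ob A" "c = fo \<Phi> c'"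
    using dom_in[of y] by (auto simp: hom_def elim!: ob_cases)
  then obtain g where g: "g \<in> hom A b' c'" "y = fa \<Phi> g" using hom_cases y ab by blast
  show "y \<cdot>\<^bsub>B\<^esub> x \<in> hom B a c" using f g ab c by (auto simp: hom_def comp dom cod)
  assume z: "z \<in> hom B c e"
  then obtain e' where e: "e' \<in> Ob A" "e = fo \<Phi> e'"
    using dom_in[of z] by (auto simp: hom_def elim!: ob_cases)
  then obtain h where h: "h \<in> hom A c' e'" "z = fa \<Phi> h" using hom_cases z c by blast
  show "z \<cdot>\<^bsub>B\<^esub> (y \<cdot>\<^bsub>B\<^esub> x) = (z \<cdot>\<^bsub>B\<^esub> y) \<cdot>\<^bsub>B\<^esub> x"
    using f g h by (auto simp: hom_def comp A.comp_assoc)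
qed

definition inverse :: "('p, 'n, 'o, 'm) fnc" where
  "inverse = \<lparr>fo = inv_into (Ob A) (fo \<Phi>), fa = inv_into (Ar A) (fa \<Phi>)\<rparr>"

lemma inverse_ob [simp]: "a \<in> Ob A \<Longrightarrow> fo inverse (fo \<Phi> a) = a"
  and inverse_ar [simp]: "f \<in> Ar A \<Longrightarrow> fa inverse (fa \<Phi> f) = f"
  using bij_ob bij_ar by (simp_all add: inverse_def bij_betw_inv_into_left)

lemma functor_to: "is_functor A B \<Phi>"
  using A.category_axioms category_B by (intro is_functor.intro is_functor_axioms.intro) (auto simp: hom_def dom cod ide comp)

lemma functor_inverse: "is_functor B A inverse"
proof (intro is_functor.intro is_functor_axioms.intro A.category_axioms category_B)
  fix a b c x y assume x: "x \<in> hom B a b" and y: "y \<in> hom B b c"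
  then obtain f g where "f \<in> Ar A" "g \<in> Ar A" "x = fa \<Phi> f" "y = fa \<Phi> g"
    by (auto simp: hom_def elim!: ar_cases)
  then show "fa inverse (y \<cdot>\<^bsub>B\<^esub> x) = fa inverse y \<cdot>\<^bsub>A\<^esub> fa inverse x"
    using x y by (auto simp: hom_def comp dom cod ob_inj)
next
  fix a assume "a \<in> Ob B"
  then obtain a' where "a' \<in> Ob A" "a = fo \<Phi> a'" by (rule ob_cases)
  then show "fo inverse a \<in> Ob A" "fa inverse (Idt B a) = Idt A (fo inverse a)" by (simp_all add: ide)
next
  fix a b x assume x: "x \<in> hom B a b"
  then obtain f where "f \<in> Ar A" "x = fa \<Phi> f" by (auto simp: hom_def elim!: ar_cases)
  then show "fa inverse x \<in> hom A (fo inverse a) (fo inverse b)" using x by (auto simp: hom_def dom cod)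
qed

lemma cat_iso: "cat_iso A B \<Phi>"
  unfolding cat_iso_def
  by (auto simp: functor_to eq_fnc_def intro!: exI[of _ inverse] functor_inverse elim!: ob_cases ar_cases)

end

context two_category
begin

lemma comp2_typed:
  assumes "A \<in> Ob2 K" "B \<in> Ob2 K" "C \<in> Ob2 K" "\<tau> \<in> Ar (Hom2 K A B)" "\<sigma> \<in> Ar (Hom2 K B C)"
  shows "comp2 K A B C \<sigma> \<tau> \<in> Ar (Hom2 K A C)"
    "Dom (Hom2 K A C) (comp2 K A B C \<sigma> \<tau>) = comp1 K A B C (Dom (Hom2 K B C) \<sigma>) (Dom (Hom2 K A B) \<tau>)"
    "Cod (Hom2 K A C) (comp2 K A B C \<sigma> \<tau>) = comp1 K A B C (Cod (Hom2 K B C) \<sigma>) (Cod (Hom2 K A B) \<tau>)"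
  using comp2_in[OF assms(1-3), of \<tau> _ _ \<sigma>] assms(4,5) by (auto simp: hom_def)

lemma interchange_typed:
  assumes "A \<in> Ob2 K" "B \<in> Ob2 K" "C \<in> Ob2 K" "\<tau> \<in> Ar (Hom2 K A B)" "\<tau>' \<in> Ar (Hom2 K A B)"
    "\<sigma> \<in> Ar (Hom2 K B C)" "\<sigma>' \<in> Ar (Hom2 K B C)"
    "Cod (Hom2 K A B) \<tau> = Dom (Hom2 K A B) \<tau>'" "Cod (Hom2 K B C) \<sigma> = Dom (Hom2 K B C) \<sigma>'"
  shows "comp2 K A B C \<sigma>' \<tau>' \<cdot>\<^bsub>Hom2 K A C\<^esub> comp2 K A B C \<sigma> \<tau>
    = comp2 K A B C (\<sigma>' \<cdot>\<^bsub>Hom2 K B C\<^esub> \<sigma>) (\<tau>' \<cdot>\<^bsub>Hom2 K A B\<^esub> \<tau>)"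
  using interchange[OF assms(1-3), of \<tau> _ _ \<tau>' _ \<sigma> _ _ \<sigma>'] assms(4-9) by (auto simp: hom_def)

lemmas hom_simps =
  category.id_ar[OF hom_category] category.id_dom[OF hom_category] category.id_cod[OF hom_category]
  category.dom_in[OF hom_category] category.cod_in[OF hom_category]
  category.ar_comp[OF hom_category] category.dom_comp[OF hom_category] category.cod_comp[OF hom_category]
  category.comp_id_left[OF hom_category] category.comp_id_right[OF hom_category]
  comp2_typed comp1_in id1_in

text \<open>The 2-functor \<open>Hom2 K h (-)\<close> on 1-cells.\<close>

definition postcomp :: "'a \<Rightarrow> 'a \<Rightarrow> 'a \<Rightarrow> 'x \<Rightarrow> ('x, 'y, 'x, 'y) fnc" where
  "postcomp h A B k = \<lparr>fo = comp1 K h A B k, fa = comp2 K h A B (Idt (Hom2 K A B) k)\<rparr>"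

lemma postcomp_simps [simp]: "fo (postcomp h A B k) = comp1 K h A B k"
    "fa (postcomp h A B k) = comp2 K h A B (Idt (Hom2 K A B) k)"
  by (simp_all add: postcomp_def)

lemma postcomp_functor:
  assumes [simp]: "h \<in> Ob2 K" "A \<in> Ob2 K" "B \<in> Ob2 K" "k \<in> Ob (Hom2 K A B)"
  shows "is_functor (Hom2 K h A) (Hom2 K h B) (postcomp h A B k)"
  by (intro is_functor.intro is_functor_axioms.intro hom_category)
    (auto simp: hom_def hom_simps comp2_id interchange_typed)

end

text \<open>To represent a family of categories with prescribed actions of 1-cells and 2-cells it is enough
  to identify the data with those of \<open>Hom2 K h (-)\<close>; all 2-functor laws, and even the laws of the
  categories \<open>on0 F A\<close>, are then inherited from \<open>K\<close>.\<close>

locale representation = two_category K for K :: "('a, 'x, 'y) twocat" +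
  fixes F :: "('a, 'x, 'y, 'p, 'q) catfun" and h :: 'a and \<Phi> :: "'a \<Rightarrow> ('x, 'y, 'p, 'q) fnc"
  assumes h [simp]: "h \<in> Ob2 K"
    and bij: "A \<in> Ob2 K \<Longrightarrow> cat_bij (Hom2 K h A) (on0 F A) (\<Phi> A)"
    and on1_ob: "\<lbrakk>A \<in> Ob2 K; B \<in> Ob2 K; k \<in> Ob (Hom2 K A B); f \<in> Ob (Hom2 K h A)\<rbrakk>
      \<Longrightarrow> fo (on1 F A B k) (fo (\<Phi> A) f) = fo (\<Phi> B) (comp1 K h A B k f)"
    and on1_ar: "\<lbrakk>A \<in> Ob2 K; B \<in> Ob2 K; k \<in> Ob (Hom2 K A B); \<alpha> \<in> Ar (Hom2 K h A)\<rbrakk>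
      \<Longrightarrow> fa (on1 F A B k) (fa (\<Phi> A) \<alpha>) = fa (\<Phi> B) (comp2 K h A B (Idt (Hom2 K A B) k) \<alpha>)"
    and on2_el: "\<lbrakk>A \<in> Ob2 K; B \<in> Ob2 K; \<tau> \<in> Ar (Hom2 K A B); f \<in> Ob (Hom2 K h A)\<rbrakk>
      \<Longrightarrow> on2 F A B \<tau> (fo (\<Phi> A) f) = fa (\<Phi> B) (comp2 K h A B \<tau> (Idt (Hom2 K h A) f))"
begin

lemma on1_is_functor:
  assumes AB: "A \<in> Ob2 K" "B \<in> Ob2 K" "k \<in> Ob (Hom2 K A B)"
  shows "is_functor (on0 F A) (on0 F B) (on1 F A B k)"
proof -
  interpret A: cat_bij "Hom2 K h A" "on0 F A" "\<Phi> A" by (rule bij) fact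
  interpret B: cat_bij "Hom2 K h B" "on0 F B" "\<Phi> B" by (rule bij) fact
  have "is_functor (on0 F A) (on0 F B) (comp_fnc (\<Phi> B) (comp_fnc (postcomp h A B k) A.inverse))"
    by (rule is_functor_comp[OF is_functor_comp[OF A.functor_inverse postcomp_functor[OF h AB]] B.functor_to])
  moreover have "eq_fnc (on0 F A) (comp_fnc (\<Phi> B) (comp_fnc (postcomp h A B k) A.inverse)) (on1 F A B k)"
    using AB by (auto simp: eq_fnc_def on1_ob on1_ar elim!: A.ob_cases A.ar_cases)
  ultimately show ?thesis by (rule is_functor_cong)
qed

lemma two_functor: "two_functor K F"
proof (intro two_functor.intro two_functor_axioms.intro two_category_axioms)
  fix A assume A: "A \<in> Ob2 K"
  interpret A: cat_bij "Hom2 K h A" "on0 F A" "\<Phi> A" by (rule bij) fact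
  show "category (on0 F A)" by (rule A.category_B)
  show "eq_fnc (on0 F A) (on1 F A A (id1 K A)) id_fnc"
    using A comp1_units[of h A] comp2_units[of h A]
    by (auto simp: eq_fnc_def on1_ob on1_ar hom_simps id2_def[symmetric] elim!: A.ob_cases A.ar_cases)
next
  fix A B k assume "A \<in> Ob2 K" "B \<in> Ob2 K" "k \<in> Ob (Hom2 K A B)"
  then show "is_functor (on0 F A) (on0 F B) (on1 F A B k)" by (rule on1_is_functor)
next
  fix A B C f g assume AB: "A \<in> Ob2 K" "B \<in> Ob2 K" "C \<in> Ob2 K" "f \<in> Ob (Hom2 K A B)" "g \<in> Ob (Hom2 K B C)"
  interpret A: cat_bij "Hom2 K h A" "on0 F A" "\<Phi> A" by (rule bij) fact
  show "eq_fnc (on0 F A) (on1 F A C (comp1 K A B C g f)) (comp_fnc (on1 F B C g) (on1 F A B f))"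
    using AB by (auto simp: eq_fnc_def on1_ob on1_ar hom_simps comp1_assoc comp2_assoc comp2_id[symmetric]
        elim!: A.ob_cases A.ar_cases)
next
  fix A B \<tau> f g assume AB: "A \<in> Ob2 K" "B \<in> Ob2 K" and "\<tau> \<in> hom (Hom2 K A B) f g"
  then have t: "\<tau> \<in> Ar (Hom2 K A B)" "Dom (Hom2 K A B) \<tau> = f" "Cod (Hom2 K A B) \<tau> = g" by (simp_all add: hom_def)
  then have fg: "f \<in> Ob (Hom2 K A B)" "g \<in> Ob (Hom2 K A B)" using AB hom_simps(4,5)[of A B \<tau>] by auto
  interpret A: cat_bij "Hom2 K h A" "on0 F A" "\<Phi> A" by (rule bij) fact
  interpret B: cat_bij "Hom2 K h B" "on0 F B" "\<Phi> B" by (rule bij) fact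
  show "nat_trans (on0 F A) (on0 F B) (on1 F A B f) (on1 F A B g) (on2 F A B \<tau>)"
    unfolding nat_trans_def
  proof (intro conjI ballI on1_is_functor AB fg)
    fix x assume "x \<in> Ob (on0 F A)"
    then obtain m where m: "m \<in> Ob (Hom2 K h A)" "x = fo (\<Phi> A) m" by (rule A.ob_cases)
    then show "on2 F A B \<tau> x \<in> hom (on0 F B) (fo (on1 F A B f) x) (fo (on1 F A B g) x)"
      using AB t fg by (simp add: hom_def on2_el on1_ob hom_simps B.dom B.cod)
  next
    fix x assume "x \<in> Ar (on0 F A)"
    then obtain \<alpha> where a: "\<alpha> \<in> Ar (Hom2 K h A)" "x = fa (\<Phi> A) \<alpha>" by (rule A.ar_cases)
    then show "fa (on1 F A B g) x \<cdot>\<^bsub>on0 F B\<^esub> on2 F A B \<tau> (Dom (on0 F A) x) = on2 F A B \<tau> (Cod (on0 F A) x) \<cdot>\<^bsub>on0 F B\<^esub> fa (on1 F A B f) x"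
      using AB t fg by (simp add: on2_el on1_ar hom_simps A.dom A.cod B.comp interchange_typed)
  qed
next
  fix A B f x assume AB: "A \<in> Ob2 K" "B \<in> Ob2 K" "f \<in> Ob (Hom2 K A B)" and x: "x \<in> Ob (on0 F A)"
  interpret A: cat_bij "Hom2 K h A" "on0 F A" "\<Phi> A" by (rule bij) fact
  interpret B: cat_bij "Hom2 K h B" "on0 F B" "\<Phi> B" by (rule bij) fact
  obtain m where m: "m \<in> Ob (Hom2 K h A)" "x = fo (\<Phi> A) m" using x by (rule A.ob_cases)
  then show "on2 F A B (Idt (Hom2 K A B) f) x = Idt (on0 F B) (fo (on1 F A B f) x)"
    using AB by (simp add: on2_el on1_ob hom_simps comp2_id B.ide)
next
  fix A B \<tau> f g \<sigma> k x assume AB: "A \<in> Ob2 K" "B \<in> Ob2 K"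
    and t: "\<tau> \<in> hom (Hom2 K A B) f g" "\<sigma> \<in> hom (Hom2 K A B) g k" and x: "x \<in> Ob (on0 F A)"
  interpret A: cat_bij "Hom2 K h A" "on0 F A" "\<Phi> A" by (rule bij) fact
  interpret B: cat_bij "Hom2 K h B" "on0 F B" "\<Phi> B" by (rule bij) fact
  obtain m where m: "m \<in> Ob (Hom2 K h A)" "x = fo (\<Phi> A) m" using x by (rule A.ob_cases)
  then show "on2 F A B (\<sigma> \<cdot>\<^bsub>Hom2 K A B\<^esub> \<tau>) x = on2 F A B \<sigma> x \<cdot>\<^bsub>on0 F B\<^esub> on2 F A B \<tau> x"
    using AB t by (simp add: hom_def on2_el hom_simps B.comp interchange_typed)
next
  fix A B C \<tau> f f' \<sigma> g g' x assume AB: "A \<in> Ob2 K" "B \<in> Ob2 K" "C \<in> Ob2 K"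
    and "\<tau> \<in> hom (Hom2 K A B) f f'" "\<sigma> \<in> hom (Hom2 K B C) g g'" and x: "x \<in> Ob (on0 F A)"
  then have t: "\<tau> \<in> Ar (Hom2 K A B)" "Dom (Hom2 K A B) \<tau> = f" "Cod (Hom2 K A B) \<tau> = f'"
    and s: "\<sigma> \<in> Ar (Hom2 K B C)" "Dom (Hom2 K B C) \<sigma> = g" "Cod (Hom2 K B C) \<sigma> = g'" by (simp_all add: hom_def)
  then have fg: "f \<in> Ob (Hom2 K A B)" "f' \<in> Ob (Hom2 K A B)" "g \<in> Ob (Hom2 K B C)"
    using AB hom_simps(4,5)[of A B \<tau>] hom_simps(4,5)[of B C \<sigma>] by auto
  interpret A: cat_bij "Hom2 K h A" "on0 F A" "\<Phi> A" by (rule bij) fact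
  interpret C: cat_bij "Hom2 K h C" "on0 F C" "\<Phi> C" by (rule bij) fact
  obtain m where m: "m \<in> Ob (Hom2 K h A)" "x = fo (\<Phi> A) m" using x by (rule A.ob_cases)
  then show "on2 F A C (comp2 K A B C \<sigma> \<tau>) x
          = on2 F B C \<sigma> (fo (on1 F A B f') x) \<cdot>\<^bsub>on0 F C\<^esub> fa (on1 F B C g) (on2 F A B \<tau> x)"
    using AB t s fg by (simp add: on2_el on1_ob on1_ar hom_simps C.comp interchange_typed comp2_assoc[symmetric])
qed

lemma represents: "represents K F h"
  unfolding represents_def
proof (intro conjI exI[of _ \<Phi>] ballI two_functor h)
  fix A B k assume AB: "A \<in> Ob2 K"
  then show "cat_iso (Hom2 K h A) (on0 F A) (\<Phi> A)" by (intro cat_bij.cat_iso bij)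
qed (auto simp: eq_fnc_def on1_ob on1_ar on2_el)

end

section \<open>Internal algebras\<close>

text \<open>A lax morphism from the terminal categorical algebra to \<open>B\<close> is determined by its object part
  \<open>x : 1 \<rightarrow> B\<^sub>0\<close> and its 2-cell \<open>\<phi> : T 1 \<rightarrow> B\<^sub>1\<close>, because a functor on a discrete category takes
  only identities as values.\<close>

locale cat_algebra = mon E T + B: icat "Alg E T" B for E :: "('p, 'n) cat" and T and B +
  fixes one :: 'p
  assumes terminal: "terminal E one"
begin

sublocale FB: adj_icat E "Alg E T" "free E T" forget "unt T" "\<lambda>A. (free_alg T (fst A), snd A, A)" B
  by unfold_locales

sublocale cB: icat E "carrier B"
  by (intro icat.intro icat_axioms.intro T.A.category_axioms) (simp add: carrier_def FB.map_icat_internal)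

lemmas bang [simp] = T.A.terminal_bang(1-4)[OF terminal]

abbreviation "b0 \<equiv> snd (ic0 B)"
abbreviation "b1 \<equiv> snd (ic1 B)"

lemma b01 [simp]: "b0 \<in> Ar E" "Dom E b0 = mo T (ic0 (carrier B))" "Cod E b0 = ic0 (carrier B)"
    "b1 \<in> Ar E" "Dom E b1 = mo T (ic1 (carrier B))" "Cod E b1 = ic1 (carrier B)"
  using Alg_obD(2-4)[of "ic0 B"] Alg_obD(2-4)[of "ic1 B"] B.obs by (simp_all add: carrier_def)

lemma str_laws:
  "isrc (carrier B) \<cdot>\<^bsub>E\<^esub> b1 = b0 \<cdot>\<^bsub>E\<^esub> ma T (isrc (carrier B))"
  "itgt (carrier B) \<cdot>\<^bsub>E\<^esub> b1 = b0 \<cdot>\<^bsub>E\<^esub> ma T (itgt (carrier B))"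
  "b1 \<cdot>\<^bsub>E\<^esub> ma T (iide (carrier B)) = iide (carrier B) \<cdot>\<^bsub>E\<^esub> b0"
  using B.arrows[unfolded Alg_ar_iff Alg_simps] by (auto simp: carrier_def)

lemma str_laws_el:
  "z \<in> Ar E \<Longrightarrow> Cod E z = mo T (ic1 (carrier B)) \<Longrightarrow> isrc (carrier B) \<cdot>\<^bsub>E\<^esub> b1 \<cdot>\<^bsub>E\<^esub> z = b0 \<cdot>\<^bsub>E\<^esub> ma T (isrc (carrier B)) \<cdot>\<^bsub>E\<^esub> z"
  "z \<in> Ar E \<Longrightarrow> Cod E z = mo T (ic1 (carrier B)) \<Longrightarrow> itgt (carrier B) \<cdot>\<^bsub>E\<^esub> b1 \<cdot>\<^bsub>E\<^esub> z = b0 \<cdot>\<^bsub>E\<^esub> ma T (itgt (carrier B)) \<cdot>\<^bsub>E\<^esub> z"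
  "z \<in> Ar E \<Longrightarrow> Cod E z = mo T (ic0 (carrier B)) \<Longrightarrow> b1 \<cdot>\<^bsub>E\<^esub> ma T (iide (carrier B)) \<cdot>\<^bsub>E\<^esub> z = iide (carrier B) \<cdot>\<^bsub>E\<^esub> b0 \<cdot>\<^bsub>E\<^esub> z"
  using T.A.comp_reassoc[OF str_laws(1)] T.A.comp_reassoc[OF str_laws(2)] T.A.comp_reassoc[OF str_laws(3)]
  by (simp_all add: T.A.comp_assoc)

lemma terminal_simps [simp]:
  "ic0 (carrier (terminal_cat_alg E T one)) = one" "ic2 (carrier (terminal_cat_alg E T one)) = one" "ic1 (carrier (terminal_cat_alg E T one)) = one"
  "isrc (carrier (terminal_cat_alg E T one)) = Idt E one" "itgt (carrier (terminal_cat_alg E T one)) = Idt E one"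
  "iide (carrier (terminal_cat_alg E T one)) = Idt E one" "ipr1 (carrier (terminal_cat_alg E T one)) = Idt E one"
  "ipr2 (carrier (terminal_cat_alg E T one)) = Idt E one" "icmp (carrier (terminal_cat_alg E T one)) = Idt E one"
  "if0 (str_map (terminal_cat_alg E T one)) = bang E one (mo T one)"
  "if1 (str_map (terminal_cat_alg E T one)) = bang E one (mo T one)"
  by (simp_all add: carrier_def terminal_cat_alg_def discrete_icat_def map_icat_def str_map_def)

lemma str_map_simps [simp]: "if0 (str_map B) = b0" "if1 (str_map B) = b1"
  by (simp_all add: str_map_def)

definition point :: "'n \<Rightarrow> 'n ifun" where
  "point x = \<lparr>if0 = x, if1 = iide (carrier B) \<cdot>\<^bsub>E\<^esub> x\<rparr>"

lemma point_simps [simp]: "if0 (point x) = x" "if1 (point x) = iide (carrier B) \<cdot>\<^bsub>E\<^esub> x"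
  by (simp_all add: point_def)

text \<open>The laws of an internal algebra; \<open>\<phi>\<close> is its structure, viewed as a \<open>T 1\<close>-indexed family of
  operations \<open>b(x, \<dots>, x) \<rightarrow> x\<close>.\<close>

definition internal_algebra :: "'n \<Rightarrow> 'n \<Rightarrow> bool" where
  "internal_algebra x \<phi> \<longleftrightarrow> x \<in> hom E one (ic0 (carrier B)) \<and> \<phi> \<in> hom E (mo T one) (ic1 (carrier B))
     \<and> isrc (carrier B) \<cdot>\<^bsub>E\<^esub> \<phi> = b0 \<cdot>\<^bsub>E\<^esub> ma T x
     \<and> itgt (carrier B) \<cdot>\<^bsub>E\<^esub> \<phi> = x \<cdot>\<^bsub>E\<^esub> bang E one (mo T one)
     \<and> \<phi> \<cdot>\<^bsub>E\<^esub> unt T one = iide (carrier B) \<cdot>\<^bsub>E\<^esub> x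
     \<and> \<phi> \<cdot>\<^bsub>E\<^esub> mult T one = icomp E (carrier B) (\<phi> \<cdot>\<^bsub>E\<^esub> ma T (bang E one (mo T one))) (b1 \<cdot>\<^bsub>E\<^esub> ma T \<phi>)"

lemma functor_from_terminal:
  "internal_functor E (carrier (terminal_cat_alg E T one)) (carrier B) f
    \<longleftrightarrow> if0 f \<in> hom E one (ic0 (carrier B)) \<and> f = point (if0 f)"
proof
  assume f: "internal_functor E (carrier (terminal_cat_alg E T one)) (carrier B) f"
  then have "if1 f = iide (carrier B) \<cdot>\<^bsub>E\<^esub> if0 f" by (auto simp: internal_functor_def hom_def)
  then show "if0 f \<in> hom E one (ic0 (carrier B)) \<and> f = point (if0 f)"
    using f by (simp add: internal_functor_def point_def)
next
  assume "if0 f \<in> hom E one (ic0 (carrier B)) \<and> f = point (if0 f)"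
  then obtain x where "x \<in> hom E one (ic0 (carrier B))" "f = point x" by blast
  then show "internal_functor E (carrier (terminal_cat_alg E T one)) (carrier B) f"
    by (simp add: internal_functor_def hom_def)
qed

text \<open>Naturality of the 2-cell is automatic: on a discrete category it says that composing with identities
  does nothing.\<close>

lemma lax_from_terminal:
  "lax_morphism E T (terminal_cat_alg E T one) B f \<phi> \<longleftrightarrow> f = point (if0 f) \<and> internal_algebra (if0 f) \<phi>"
proof
  assume l: "lax_morphism E T (terminal_cat_alg E T one) B f \<phi>"
  then have f: "f = point (if0 f)" "if0 f \<in> hom E one (ic0 (carrier B))"
    by (auto simp: lax_morphism_def functor_from_terminal)
  then show "f = point (if0 f) \<and> internal_algebra (if0 f) \<phi>"
    using l by (auto simp: lax_morphism_def internal_nat_def internal_algebra_def comp_ifun_def map_ifun_def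
        map_icat_def)
next
  assume "f = point (if0 f) \<and> internal_algebra (if0 f) \<phi>"
  then obtain x where f: "f = point x" and a: "internal_algebra x \<phi>" by auto
  then have ty: "x \<in> Ar E" "Dom E x = one" "Cod E x = ic0 (carrier B)"
      "\<phi> \<in> Ar E" "Dom E \<phi> = mo T one" "Cod E \<phi> = ic1 (carrier B)"
    and laws: "isrc (carrier B) \<cdot>\<^bsub>E\<^esub> \<phi> = b0 \<cdot>\<^bsub>E\<^esub> ma T x" "itgt (carrier B) \<cdot>\<^bsub>E\<^esub> \<phi> = x \<cdot>\<^bsub>E\<^esub> bang E one (mo T one)"
    by (auto simp: internal_algebra_def hom_def)
  have "internal_nat E (map_icat (mfn T) (carrier (terminal_cat_alg E T one))) (carrier B)
         (comp_ifun E (str_map B) (map_ifun (mfn T) f)) (comp_ifun E f (str_map (terminal_cat_alg E T one))) \<phi>"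
    using ty laws
    by (simp add: f internal_nat_def internal_functor_def hom_def comp_ifun_def map_ifun_def map_icat_def
        str_laws_el T.A.comp_assoc)
  then show "lax_morphism E T (terminal_cat_alg E T one) B f \<phi>"
    using a ty by (simp add: lax_morphism_def functor_from_terminal f)
      (simp add: internal_algebra_def hom_def)
qed

lemma lax_transformation_from_terminal:
  assumes "x \<in> hom E one (ic0 (carrier B))" "y \<in> hom E one (ic0 (carrier B))"
  shows "lax_transformation E T (terminal_cat_alg E T one) B (point x, \<phi>) (point y, \<psi>) \<tau>
    \<longleftrightarrow> \<tau> \<in> hom E one (ic1 (carrier B)) \<and> isrc (carrier B) \<cdot>\<^bsub>E\<^esub> \<tau> = x \<and> itgt (carrier B) \<cdot>\<^bsub>E\<^esub> \<tau> = y
      \<and> icomp E (carrier B) \<psi> (b1 \<cdot>\<^bsub>E\<^esub> ma T \<tau>) = icomp E (carrier B) (\<tau> \<cdot>\<^bsub>E\<^esub> bang E one (mo T one)) \<phi>"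
proof -
  let ?c = "carrier (terminal_cat_alg E T one)"
  have F: "internal_functor E ?c (carrier B) (point x)" "internal_functor E ?c (carrier B) (point y)"
    using assms by (simp_all add: functor_from_terminal)
  have "icomp E (carrier B) (if1 (point y)) (\<tau> \<cdot>\<^bsub>E\<^esub> isrc ?c) = icomp E (carrier B) (\<tau> \<cdot>\<^bsub>E\<^esub> itgt ?c) (if1 (point x))"
    if "\<tau> \<in> hom E one (ic1 (carrier B))" "isrc (carrier B) \<cdot>\<^bsub>E\<^esub> \<tau> = x" "itgt (carrier B) \<cdot>\<^bsub>E\<^esub> \<tau> = y"
    using that by (simp add: hom_def)
  then have "internal_nat E ?c (carrier B) (point x) (point y) \<tau>
      \<longleftrightarrow> \<tau> \<in> hom E one (ic1 (carrier B)) \<and> isrc (carrier B) \<cdot>\<^bsub>E\<^esub> \<tau> = x \<and> itgt (carrier B) \<cdot>\<^bsub>E\<^esub> \<tau> = y"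
    using F unfolding internal_nat_def by (auto simp only: point_simps terminal_simps)
  then show ?thesis unfolding lax_transformation_def by (simp only: prod.case conj_assoc str_map_simps terminal_simps)
qed

end

lemma Lax_hom_simps [simp]: "Ob (Lax_hom C T A B) = {(f, \<phi>). lax_morphism C T A B f \<phi>}"
  "Ar (Lax_hom C T A B) = {(F, \<tau>, G). lax_morphism C T A B (fst F) (snd F) \<and> lax_morphism C T A B (fst G) (snd G)
             \<and> lax_transformation C T A B F G \<tau>}"
  "Dom (Lax_hom C T A B) a = fst a" "Cod (Lax_hom C T A B) a = snd (snd a)"
  "Idt (Lax_hom C T A B) F = (F, iide (carrier B) \<cdot>\<^bsub>C\<^esub> if0 (fst F), F)"
  "b \<cdot>\<^bsub>Lax_hom C T A B\<^esub> a = (fst a, icomp C (carrier B) (fst (snd b)) (fst (snd a)), snd (snd b))"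
  by (auto simp: Lax_hom_def split: prod.splits)

section \<open>Internal algebras as transposes\<close>

text \<open>If \<open>d : D \<rightarrow> Alg\<^sub>T\<close> has a left adjoint \<open>p\<close>, then \<open>p F\<^sup>T\<close> is left adjoint to \<open>V = U\<^sup>T d\<close>, and
  arrows \<open>p F\<^sup>T y \<rightarrow> A\<close> in \<open>D\<close> correspond to arrows \<open>y \<rightarrow> V A\<close> in \<open>E\<close>.\<close>

locale adjoint_to_algebras = mon E T + P: adj "Alg E T" D p d u' v'
  for E :: "('p, 'n) cat" and T and D :: "('o, 'm) cat" and p d u' v'
begin

definition L :: "('p, 'n, 'o, 'm) fnc" where "L = comp_fnc p (free E T)"
definition V :: "('o, 'm, 'p, 'n) fnc" where "V = comp_fnc forget d"
definition unit :: "'p \<Rightarrow> 'n" where "unit a = fa forget (u' (fo (free E T) a)) \<cdot>\<^bsub>E\<^esub> unt T a"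
definition counit :: "'o \<Rightarrow> 'm" where
  "counit c = v' c \<cdot>\<^bsub>D\<^esub> fa p (free_alg T (fst (fo d c)), snd (fo d c), fo d c)"

sublocale V: adj E D L V unit counit
  using adjunction_comp[OF FU.adjunction P.adjunction]
  by unfold_locales (simp add: L_def V_def unit_def[abs_def] counit_def[abs_def])

lemma L_ob: "fo L x = fo p (free_alg T x)" and V_ar: "fa V f = fst (snd (fa d f))"
  by (simp_all add: L_def V_def)

lemma V_transpose:
  assumes "x \<in> Ob E" "f \<in> Ar D" "Dom D f = fo L x"
  shows "V.transpose x f = FU.transpose x (P.transpose (free_alg T x) f)"
proof -
  have "u' (free_alg T x) \<in> Ar (Alg E T)" "fst (u' (free_alg T x)) = free_alg T x"
      "snd (snd (u' (free_alg T x))) = fo d (fo p (free_alg T x))"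
    using P.unit[of "free_alg T x"] assms(1) by simp_all
  moreover have "fa d f \<in> Ar (Alg E T)" "fst (fa d f) = fo d (fo p (free_alg T x))"
    using P.U.fa_ar[of f] P.U.fa_dom[of f] assms by (simp_all add: L_ob)
  ultimately show ?thesis using assms
    by (simp add: L_ob V_ar V.transpose_def unit_def FU.transpose_def P.transpose_def Alg_ar_iff T.A.comp_assoc)
qed

lemma free_action_simps [simp]: "fst (free_action T x) = free_alg T (mo T x)" "fst (snd (free_action T x)) = mult T x"
    "snd (snd (free_action T x)) = free_alg T x"
  by (simp_all add: free_action_def)

lemma free_action_ar [simp]: "x \<in> Ob E \<Longrightarrow> free_action T x \<in> Ar (Alg E T)"
  by (simp add: Alg_ar_iff mult_mult)

definition act :: "'p \<Rightarrow> 'm" where "act x = fa p (free_action T x)"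

lemma act_ar [simp]: "x \<in> Ob E \<Longrightarrow> act x \<in> Ar D" "x \<in> Ob E \<Longrightarrow> Dom D (act x) = fo L (mo T x)"
    "x \<in> Ob E \<Longrightarrow> Cod D (act x) = fo L x"
  by (simp_all add: L_ob act_def)

text \<open>An algebra map out of the free algebra \<open>T x\<close> is the structure map of its target after \<open>T\<close> of its
  restriction to \<open>x\<close>. Since the free action restricts to the identity of \<open>T x\<close> along the unit of \<open>T\<close>,
  precomposing with it and transposing recovers the whole algebra map.\<close>

lemma transpose_action:
  assumes x: "x \<in> Ob E" and f: "f \<in> Ar D" "Dom D f = fo L x"
  shows "V.transpose (mo T x) (f \<cdot>\<^bsub>D\<^esub> act x) = snd (fo d (Cod D f)) \<cdot>\<^bsub>E\<^esub> ma T (V.transpose x f)"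
proof -
  note f = f[unfolded L_ob]
  let ?g = "P.transpose (free_alg T x) f"
  have g: "?g \<in> Ar (Alg E T)" "fst ?g = free_alg T x" "snd (snd ?g) = fo d (Cod D f)"
    using x f P.transpose_ar[of "free_alg T x" f] P.transpose_dom[of "free_alg T x" f] P.transpose_cod[of "free_alg T x" f] by simp_all
  then have g1: "fst (snd ?g) \<in> Ar E" "Dom E (fst (snd ?g)) = mo T x" by (simp_all add: Alg_ar_iff)
  have "V.transpose (mo T x) (f \<cdot>\<^bsub>D\<^esub> act x) = FU.transpose (mo T x) (?g \<cdot>\<^bsub>Alg E T\<^esub> free_action T x)"
    using x f P.transpose_pre[of "free_action T x" "free_alg T (mo T x)" "free_alg T x" f]
    by (simp add: V_transpose L_ob act_def)
  also have "\<dots> = fst (snd ?g)"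
    using x g1 by (simp add: FU.transpose_def T.A.comp_assoc mult_unt)
  also have "\<dots> = snd (fo d (Cod D f)) \<cdot>\<^bsub>E\<^esub> ma T (FU.transpose x ?g)"
    using arg_cong[OF FU.counit_transpose[of x ?g], of "\<lambda>m. fst (snd m)"] x g by simp
  finally show ?thesis using x f by (simp add: V_transpose L_ob)
qed

lemma transpose_iff:
  assumes "x \<in> Ob E" "f \<in> Ar D" "g \<in> Ar D" "Dom D f = fo L x" "Dom D g = fo L x" "Cod D f = Cod D g"
  shows "f = g \<longleftrightarrow> V.transpose x f = V.transpose x g"
  using V.transpose_inj[of x f g] assms by auto

end

context adjoint_to_algebras
begin

text \<open>The lax morphism \<open>1 \<rightarrow> d A\<close> that corresponds to an internal functor \<open>h \<rightarrow> A\<close>: its object part and its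
  2-cell are the transposes of the object part and the arrow part of the functor.\<close>

definition transpose_algebra :: "'p \<Rightarrow> ('o, 'm) icat \<Rightarrow> 'm ifun \<Rightarrow> 'n laxmor" where
  "transpose_algebra one A f = (\<lparr>if0 = V.transpose one (if0 f), if1 = fa V (iide A) \<cdot>\<^bsub>E\<^esub> V.transpose one (if0 f)\<rparr>,
     V.transpose (mo T one) (if1 f))"

definition transpose_functor :: "'p \<Rightarrow> ('o, 'm) icat \<Rightarrow> ('m ifun, 'm itrans, 'n laxmor, 'n laxmor \<times> 'n \<times> 'n laxmor) fnc" where
  "transpose_functor one A = \<lparr>fo = transpose_algebra one A,
     fa = (\<lambda>(f, \<tau>, g). (transpose_algebra one A f, V.transpose one \<tau>, transpose_algebra one A g))\<rparr>"

end

locale transposed_target = adjoint_to_algebras E T D p d u' v' + A: icat D A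
  for E :: "('p, 'n) cat" and T and D :: "('o, 'm) cat" and p d u' v' and A +
  fixes one :: 'p
  assumes terminal: "terminal E one"
begin

sublocale PA: adj_icat "Alg E T" D p d u' v' A by unfold_locales
sublocale VA: adj_icat E D L V unit counit A by unfold_locales
sublocale B: cat_algebra E T "map_icat d A" one
  using PA.map_icat_internal terminal by unfold_locales

lemma carrier_image: "carrier (map_icat d A) = map_icat V A"
  by (simp add: carrier_def map_icat_def V_def)

abbreviation h where "h \<equiv> map_icat p (HT E T one)"
abbreviation tr where "tr \<equiv> V.transpose"

lemma h_simps: "ic0 h = fo L one" "ic1 h = fo L (mo T one)" "ic2 h = fo L (mo T (mo T one))"
    "isrc h = act one" "itgt h = fa L (bang E one (mo T one))" "iide h = fa L (unt T one)"
    "ipr1 h = fa L (ma T (bang E one (mo T one)))" "ipr2 h = act (mo T one)" "icmp h = fa L (mult T one)"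
  by (simp_all add: map_icat_def HT_def Let_def bar_TT1_def bar_def L_def act_def numeral_2_eq_2)

text \<open>The equations that make \<open>f\<close> an internal functor on \<open>h\<close> transpose one by one to the laws of an
  internal algebra. The algebra structure of \<open>d A\<close> enters through the source of \<open>h\<close> and the second
  projection of its composable pairs, which are \<open>p\<close> of free actions.\<close>

lemma functor_iff_internal_algebra:
  assumes h: "internal_category D h"
  shows "internal_functor D h A f \<longleftrightarrow> if0 f \<in> hom D (fo L one) (ic0 A) \<and> if1 f \<in> hom D (fo L (mo T one)) (ic1 A)
    \<and> B.internal_algebra (tr one (if0 f)) (tr (mo T one) (if1 f))"
proof (cases "if0 f \<in> hom D (fo L one) (ic0 A) \<and> if1 f \<in> hom D (fo L (mo T one)) (ic1 A)")
  case True
  then have f [simp]: "if0 f \<in> Ar D" "Dom D (if0 f) = fo L one" "Cod D (if0 f) = ic0 A"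
    "if1 f \<in> Ar D" "Dom D (if1 f) = fo L (mo T one)" "Cod D (if1 f) = ic1 A"
    by (simp_all add: hom_def)
  let ?x = "tr one (if0 f)" and ?\<phi> = "tr (mo T one) (if1 f)" and ?t = "bang E one (mo T one)"
  have src: "isrc A \<cdot>\<^bsub>D\<^esub> if1 f = if0 f \<cdot>\<^bsub>D\<^esub> act one \<longleftrightarrow> fa V (isrc A) \<cdot>\<^bsub>E\<^esub> ?\<phi> = snd (fo d (ic0 A)) \<cdot>\<^bsub>E\<^esub> ma T ?x"
    by (subst transpose_iff[of "mo T one"]) (simp_all add: V.transpose_post[of _ _ "isrc A"] transpose_action)
  have tgt: "itgt A \<cdot>\<^bsub>D\<^esub> if1 f = if0 f \<cdot>\<^bsub>D\<^esub> fa L ?t \<longleftrightarrow> fa V (itgt A) \<cdot>\<^bsub>E\<^esub> ?\<phi> = ?x \<cdot>\<^bsub>E\<^esub> ?t"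
    by (subst transpose_iff[of "mo T one"]) (simp_all add: V.transpose_post[of _ _ "itgt A"] V.transpose_pre)
  have ide: "if1 f \<cdot>\<^bsub>D\<^esub> fa L (unt T one) = iide A \<cdot>\<^bsub>D\<^esub> if0 f \<longleftrightarrow> ?\<phi> \<cdot>\<^bsub>E\<^esub> unt T one = fa V (iide A) \<cdot>\<^bsub>E\<^esub> ?x"
    by (subst transpose_iff[of one]) (simp_all add: V.transpose_post[of _ _ "iide A"] V.transpose_pre)
  have cmp: "if1 f \<cdot>\<^bsub>D\<^esub> fa L (mult T one) = icomp D A (if1 f \<cdot>\<^bsub>D\<^esub> fa L (ma T ?t)) (if1 f \<cdot>\<^bsub>D\<^esub> act (mo T one))
      \<longleftrightarrow> ?\<phi> \<cdot>\<^bsub>E\<^esub> mult T one = icomp E (map_icat V A) (?\<phi> \<cdot>\<^bsub>E\<^esub> ma T ?t) (snd (fo d (ic1 A)) \<cdot>\<^bsub>E\<^esub> ma T ?\<phi>)"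
    if s: "isrc A \<cdot>\<^bsub>D\<^esub> if1 f = if0 f \<cdot>\<^bsub>D\<^esub> act one" and t: "itgt A \<cdot>\<^bsub>D\<^esub> if1 f = if0 f \<cdot>\<^bsub>D\<^esub> fa L ?t"
  proof -
    interpret h: icat D h by unfold_locales (rule h)
    have "act one \<cdot>\<^bsub>D\<^esub> fa L (ma T ?t) = fa L ?t \<cdot>\<^bsub>D\<^esub> act (mo T one)"
      using h.src_tgt_pr by (simp add: h_simps)
    then have c: "isrc A \<cdot>\<^bsub>D\<^esub> if1 f \<cdot>\<^bsub>D\<^esub> fa L (ma T ?t) = itgt A \<cdot>\<^bsub>D\<^esub> if1 f \<cdot>\<^bsub>D\<^esub> act (mo T one)"
      using P.F.B.comp_reassoc[OF s] P.F.B.comp_reassoc[OF t] by (simp add: P.F.B.comp_assoc)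
    then show ?thesis
      by (subst transpose_iff[of "mo T (mo T one)"])
        (simp_all add: VA.transpose_icomp V.transpose_pre transpose_action)
  qed
  show ?thesis using src tgt ide cmp
    by (auto simp: internal_functor_def B.internal_algebra_def h_simps carrier_image hom_def)
qed (auto simp: internal_functor_def h_simps)

lemma nat_iff_lax_transformation:
  assumes h: "internal_category D h" and f: "internal_functor D h A f" and g: "internal_functor D h A g"
  shows "internal_nat D h A f g \<tau> \<longleftrightarrow> \<tau> \<in> hom D (fo L one) (ic1 A)
    \<and> lax_transformation E T (terminal_cat_alg E T one) (map_icat d A)
        (B.point (tr one (if0 f)), tr (mo T one) (if1 f)) (B.point (tr one (if0 g)), tr (mo T one) (if1 g)) (tr one \<tau>)"
proof (cases "\<tau> \<in> hom D (fo L one) (ic1 A)")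
  case True
  then have t [simp]: "\<tau> \<in> Ar D" "Dom D \<tau> = fo L one" "Cod D \<tau> = ic1 A" by (simp_all add: hom_def)
  note f' = P.F.B.ifun_intro[OF h A.internal f] and g' = P.F.B.ifun_intro[OF h A.internal g]
  note ifun.arrows[OF f', unfolded h_simps, simp] ifun.arrows[OF g', unfolded h_simps, simp]
  let ?t = "bang E one (mo T one)"
  have src: "isrc A \<cdot>\<^bsub>D\<^esub> \<tau> = if0 f \<longleftrightarrow> fa V (isrc A) \<cdot>\<^bsub>E\<^esub> tr one \<tau> = tr one (if0 f)"
    by (subst transpose_iff[of one]) (simp_all add: V.transpose_post)
  have tgt: "itgt A \<cdot>\<^bsub>D\<^esub> \<tau> = if0 g \<longleftrightarrow> fa V (itgt A) \<cdot>\<^bsub>E\<^esub> tr one \<tau> = tr one (if0 g)"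
    by (subst transpose_iff[of one]) (simp_all add: V.transpose_post)
  have nat: "icomp D A (if1 g) (\<tau> \<cdot>\<^bsub>D\<^esub> act one) = icomp D A (\<tau> \<cdot>\<^bsub>D\<^esub> fa L ?t) (if1 f)
     \<longleftrightarrow> icomp E (map_icat V A) (tr (mo T one) (if1 g)) (snd (fo d (ic1 A)) \<cdot>\<^bsub>E\<^esub> ma T (tr one \<tau>))
         = icomp E (map_icat V A) (tr one \<tau> \<cdot>\<^bsub>E\<^esub> ?t) (tr (mo T one) (if1 f))"
    if s: "isrc A \<cdot>\<^bsub>D\<^esub> \<tau> = if0 f" and t: "itgt A \<cdot>\<^bsub>D\<^esub> \<tau> = if0 g"
  proof -
    have "isrc A \<cdot>\<^bsub>D\<^esub> if1 g = itgt A \<cdot>\<^bsub>D\<^esub> \<tau> \<cdot>\<^bsub>D\<^esub> act one" "isrc A \<cdot>\<^bsub>D\<^esub> \<tau> \<cdot>\<^bsub>D\<^esub> fa L ?t = itgt A \<cdot>\<^bsub>D\<^esub> if1 f"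
      using P.F.B.comp_reassoc[OF s] P.F.B.comp_reassoc[OF t] ifun.laws(2)[OF f'] ifun.laws(1)[OF g'] by (simp_all add: h_simps)
    then show ?thesis
      by (subst transpose_iff[of "mo T one"])
        (simp_all add: VA.transpose_icomp V.transpose_pre transpose_action)
  qed
  show ?thesis
    by (subst B.lax_transformation_from_terminal)
      (use src tgt nat f g True in \<open>auto simp: internal_nat_def h_simps carrier_image hom_def\<close>)
qed (auto simp: internal_nat_def h_simps)

lemma transpose_algebra_eq: "transpose_algebra one A f = (B.point (tr one (if0 f)), tr (mo T one) (if1 f))"
  by (simp add: transpose_algebra_def B.point_def carrier_image)

lemma functor_eqI:
  assumes "internal_category D h" "internal_functor D h A f" "internal_functor D h A g"
    "transpose_algebra one A f = transpose_algebra one A g"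
  shows "f = g"
proof -
  note f = ifun.arrows[OF P.F.B.ifun_intro[OF assms(1) A.internal assms(2)], unfolded h_simps]
  note g = ifun.arrows[OF P.F.B.ifun_intro[OF assms(1) A.internal assms(3)], unfolded h_simps]
  have "if0 f = if0 g" by (rule V.transpose_inj[of one]) (use assms(4) f g in \<open>simp_all add: transpose_algebra_def\<close>)
  moreover have "if1 f = if1 g" by (rule V.transpose_inj[of "mo T one"]) (use assms(4) f g in \<open>simp_all add: transpose_algebra_def\<close>)
  ultimately show ?thesis by (cases f, cases g) simp
qed

lemma lax_transpose_algebra:
  assumes "internal_category D h" "internal_functor D h A f"
  shows "lax_morphism E T (terminal_cat_alg E T one) (map_icat d A) (fst (transpose_algebra one A f)) (snd (transpose_algebra one A f))"
  using assms by (simp add: transpose_algebra_eq functor_iff_internal_algebra B.lax_from_terminal)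

lemma lax_cases:
  assumes h: "internal_category D h" and l: "lax_morphism E T (terminal_cat_alg E T one) (map_icat d A) F \<phi>"
  obtains f where "internal_functor D h A f" "(F, \<phi>) = transpose_algebra one A f"
proof -
  have F: "F = B.point (if0 F)" and a: "B.internal_algebra (if0 F) \<phi>"
    using l by (simp_all add: B.lax_from_terminal)
  then have ty: "if0 F \<in> Ar E" "Dom E (if0 F) = one" "Cod E (if0 F) = fo V (ic0 A)"
      "\<phi> \<in> Ar E" "Dom E \<phi> = mo T one" "Cod E \<phi> = fo V (ic1 A)"
    by (simp_all add: B.internal_algebra_def carrier_image hom_def)
  obtain f0 where f0: "f0 \<in> Ar D" "Dom D f0 = fo L one" "Cod D f0 = ic0 A" "tr one f0 = if0 F"
    by (rule V.transpose_surj[of "ic0 A" "if0 F" one]) (use ty in simp_all)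
  obtain f1 where f1: "f1 \<in> Ar D" "Dom D f1 = fo L (mo T one)" "Cod D f1 = ic1 A" "tr (mo T one) f1 = \<phi>"
    by (rule V.transpose_surj[of "ic1 A" \<phi> "mo T one"]) (use ty in simp_all)
  show ?thesis
    by (rule that[of "\<lparr>if0 = f0, if1 = f1\<rparr>"])
      (use f0 f1 a F in \<open>simp_all add: functor_iff_internal_algebra[OF h] transpose_algebra_eq hom_def\<close>)
qed

lemma transpose_bij:
  assumes h: "internal_category D h"
  shows "cat_bij (ICat_hom D h A) (Lax_hom E T (terminal_cat_alg E T one) (map_icat d A)) (transpose_functor one A)"
proof (intro cat_bij.intro cat_bij_axioms.intro P.F.B.category_ICat_hom h A.internal)
  let ?L = "Lax_hom E T (terminal_cat_alg E T one) (map_icat d A)" and ?\<Phi> = "transpose_functor one A"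
  show "bij_betw (fo ?\<Phi>) (Ob (ICat_hom D h A)) (Ob ?L)"
  proof (rule bij_betw_imageI)
    show "inj_on (fo ?\<Phi>) (Ob (ICat_hom D h A))"
      using functor_eqI[OF h] by (auto simp: inj_on_def transpose_functor_def)
    show "fo ?\<Phi> ` Ob (ICat_hom D h A) = Ob ?L"
      using lax_transpose_algebra[OF h] by (auto simp: transpose_functor_def case_prod_unfold elim!: lax_cases[OF h])
  qed
  have nat_ty: "\<tau> \<in> Ar D" "Dom D \<tau> = fo L one" "Cod D \<tau> = ic1 A" if "internal_nat D h A f g \<tau>" for f g \<tau>
    using that by (auto simp: internal_nat_def hom_def h_simps)
  show "bij_betw (fa ?\<Phi>) (Ar (ICat_hom D h A)) (Ar ?L)"
  proof (rule bij_betw_imageI)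
    show "inj_on (fa ?\<Phi>) (Ar (ICat_hom D h A))"
    proof (rule inj_onI)
      fix a b assume a: "a \<in> Ar (ICat_hom D h A)" and b: "b \<in> Ar (ICat_hom D h A)" and e: "fa ?\<Phi> a = fa ?\<Phi> b"
      obtain f \<tau> g where a': "a = (f, \<tau>, g)" "internal_nat D h A f g \<tau>" using a P.F.B.ICat_hom_simps(2) by auto
      obtain f' \<tau>' g' where b': "b = (f', \<tau>', g')" "internal_nat D h A f' g' \<tau>'" using b P.F.B.ICat_hom_simps(2) by auto
      have "f = f'" "g = g'"
        using e functor_eqI[OF h] P.F.B.internal_nat_functors[OF a'(2)] P.F.B.internal_nat_functors[OF b'(2)]
        by (auto simp: a'(1) b'(1) transpose_functor_def)
      moreover have "\<tau> = \<tau>'"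
        by (rule V.transpose_inj[of one])
          (use e nat_ty[OF a'(2)] nat_ty[OF b'(2)] in \<open>simp_all add: a'(1) b'(1) transpose_functor_def\<close>)
      ultimately show "a = b" by (simp add: a'(1) b'(1))
    qed
    show "fa ?\<Phi> ` Ar (ICat_hom D h A) = Ar ?L"
    proof (intro equalityI subsetI)
      fix x assume "x \<in> fa ?\<Phi> ` Ar (ICat_hom D h A)"
      then obtain f \<tau> g where a: "internal_nat D h A f g \<tau>" "x = (transpose_algebra one A f, tr one \<tau>, transpose_algebra one A g)"
        by (auto simp: transpose_functor_def)
      note fg = P.F.B.internal_nat_functors[OF a(1)]
      show "x \<in> Ar ?L"
        using lax_transpose_algebra[OF h fg(1)] lax_transpose_algebra[OF h fg(2)] a(1) nat_iff_lax_transformation[OF h fg, of \<tau>]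
        by (simp add: a(2) transpose_algebra_eq)
    next
      fix x assume "x \<in> Ar ?L"
      then obtain F \<phi> t G \<psi> where x: "x = ((F, \<phi>), t, (G, \<psi>))"
          and F: "lax_morphism E T (terminal_cat_alg E T one) (map_icat d A) F \<phi>"
          and G: "lax_morphism E T (terminal_cat_alg E T one) (map_icat d A) G \<psi>"
          and t: "lax_transformation E T (terminal_cat_alg E T one) (map_icat d A) (F, \<phi>) (G, \<psi>) t"
        by auto
      obtain f where f: "internal_functor D h A f" "(F, \<phi>) = transpose_algebra one A f" using F by (rule lax_cases[OF h])
      obtain g where g: "internal_functor D h A g" "(G, \<psi>) = transpose_algebra one A g" using G by (rule lax_cases[OF h])
      have ty: "t \<in> hom E one (fo V (ic1 A))"
        using t by (simp add: lax_transformation_def internal_nat_def carrier_image)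
      obtain \<tau> where \<tau>: "\<tau> \<in> Ar D" "Dom D \<tau> = fo L one" "Cod D \<tau> = ic1 A" "tr one \<tau> = t"
        by (rule V.transpose_surj[of "ic1 A" t one]) (use ty in \<open>simp_all add: hom_def\<close>)
      have "internal_nat D h A f g \<tau>"
        using nat_iff_lax_transformation[OF h f(1) g(1), of \<tau>] t \<tau> f(2) g(2) by (simp add: hom_def transpose_algebra_eq)
      then show "x \<in> fa ?\<Phi> ` Ar (ICat_hom D h A)"
        using f(2) g(2) \<tau> by (intro image_eqI[of _ _ "(f, \<tau>, g)"]) (simp_all add: x transpose_functor_def)
    qed
  qed
  show "Dom ?L (fa ?\<Phi> a) = fo ?\<Phi> (Dom (ICat_hom D h A) a)" "Cod ?L (fa ?\<Phi> a) = fo ?\<Phi> (Cod (ICat_hom D h A) a)"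
    if "a \<in> Ar (ICat_hom D h A)" for a
    using that by (auto simp: transpose_functor_def)
  show "Idt ?L (fo ?\<Phi> f) = fa ?\<Phi> (Idt (ICat_hom D h A) f)" if f: "f \<in> Ob (ICat_hom D h A)" for f
  proof -
    have "internal_functor D h A f" using f by simp
    then have "if0 f \<in> Ar D" "Dom D (if0 f) = fo L one" "Cod D (if0 f) = ic0 A"
      by (simp_all add: functor_iff_internal_algebra[OF h] hom_def)
    then show ?thesis
      by (simp add: transpose_functor_def transpose_algebra_eq carrier_image V.transpose_post)
  qed
  show "fa ?\<Phi> b \<cdot>\<^bsub>?L\<^esub> fa ?\<Phi> a = fa ?\<Phi> (b \<cdot>\<^bsub>ICat_hom D h A\<^esub> a)"
    if ab: "a \<in> Ar (ICat_hom D h A)" "b \<in> Ar (ICat_hom D h A)" "Cod (ICat_hom D h A) a = Dom (ICat_hom D h A) b" for a b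
  proof -
    obtain f \<tau> g where a: "a = (f, \<tau>, g)" "internal_nat D h A f g \<tau>" using ab(1) by auto
    obtain k \<sigma> where b: "b = (g, \<sigma>, k)" "internal_nat D h A g k \<sigma>" using ab(2,3) a(1) by auto
    have "isrc A \<cdot>\<^bsub>D\<^esub> \<sigma> = itgt A \<cdot>\<^bsub>D\<^esub> \<tau>" using a(2) b(2) by (simp add: internal_nat_def)
    then show ?thesis using nat_ty[OF a(2)] nat_ty[OF b(2)]
      by (simp add: a(1) b(1) transpose_functor_def carrier_image VA.transpose_icomp)
  qed
qed

end

text \<open>Postcomposition with morphisms and transformations of \<open>D\<close> corresponds to \<open>push_lax\<close> because
  transposition is natural in the target.\<close>

locale representing = adjoint_to_algebras E T D p d u' v'
  for E :: "('p, 'n) cat" and T and D :: "('o, 'm) cat" and p d u' v' +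
  fixes one :: 'p
  assumes terminal: "terminal E one"
    and internal: "internal_category D (map_icat p (HT E T one))"
begin

lemma target: "internal_category D A \<Longrightarrow> transposed_target E T D p d u' v' A one"
  by (intro transposed_target.intro transposed_target_axioms.intro adjoint_to_algebras_axioms
      P.F.B.icat_intro terminal)

lemma represents_internal_algebras:
  "represents (ICat D) (precomp d (IAlg E T one)) (map_icat p (HT E T one))"
proof (rule representation.represents, intro representation.intro representation_axioms.intro)
  let ?h = "map_icat p (HT E T one)"
  show "two_category (ICat D)" by (rule P.F.B.two_category_ICat)
  show "?h \<in> Ob2 (ICat D)" by (simp add: internal)
  show "cat_bij (Hom2 (ICat D) ?h A) (on0 (precomp d (IAlg E T one)) A) (transpose_functor one A)"
    if "A \<in> Ob2 (ICat D)" for A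
    using transposed_target.transpose_bij[OF target internal] that by (simp add: precomp_def IAlg_def)
  fix A B k assume "A \<in> Ob2 (ICat D)" "B \<in> Ob2 (ICat D)"
  then have AB: "internal_category D A" "internal_category D B" by simp_all
  interpret A: transposed_target E T D p d u' v' A one by (rule target) fact
  have nat_ty: "\<tau> \<in> Ar D" "Dom D \<tau> = fo L one" "Cod D \<tau> = ic1 A" "isrc A \<cdot>\<^bsub>D\<^esub> \<tau> = if0 f" "itgt A \<cdot>\<^bsub>D\<^esub> \<tau> = if0 g"
    if "internal_nat D ?h A f g \<tau>" for f g \<tau>
    using that by (auto simp: internal_nat_def hom_def A.h_simps)
  have fun_ty: "if0 f \<in> Ar D" "Dom D (if0 f) = fo L one" "Cod D (if0 f) = ic0 A"
      "if1 f \<in> Ar D" "Dom D (if1 f) = fo L (mo T one)" "Cod D (if1 f) = ic1 A"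
    if "internal_functor D ?h A f" for f
    using that by (auto simp: internal_functor_def hom_def A.h_simps)
  have push: "push_lax E (map_ifun d k) (transpose_algebra one A f) = transpose_algebra one B (comp_ifun D k f)"
    if f: "internal_functor D ?h A f" and k: "internal_functor D A B k" for f k
  proof -
    interpret k: ifun D A B k by (intro P.F.B.ifun_intro AB k)
    have "fa V (if1 k) \<cdot>\<^bsub>E\<^esub> fa V (iide A) = fa V (iide B) \<cdot>\<^bsub>E\<^esub> fa V (if0 k)"
      by (simp flip: V.U.fa_comp')
    then have "fa V (if1 k) \<cdot>\<^bsub>E\<^esub> fa V (iide A) \<cdot>\<^bsub>E\<^esub> A.tr one (if0 f) = fa V (iide B) \<cdot>\<^bsub>E\<^esub> fa V (if0 k) \<cdot>\<^bsub>E\<^esub> A.tr one (if0 f)"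
      using fun_ty[OF f] by (subst T.A.comp_reassoc[where k = "fa V (iide B) \<cdot>\<^bsub>E\<^esub> fa V (if0 k)"]) (simp_all add: T.A.comp_assoc)
    then show ?thesis using fun_ty[OF f]
      by (simp add: push_lax_def transpose_algebra_def comp_ifun_def map_ifun_def V.transpose_post)
        (simp add: V_ar)
  qed
  show "fo (on1 (precomp d (IAlg E T one)) A B k) (fo (transpose_functor one A) f)
      = fo (transpose_functor one B) (comp1 (ICat D) ?h A B k f)"
    if "k \<in> Ob (Hom2 (ICat D) A B)" "f \<in> Ob (Hom2 (ICat D) ?h A)" for f k
    using push that by (simp add: precomp_def IAlg_def transpose_functor_def)
  show "fa (on1 (precomp d (IAlg E T one)) A B k) (fa (transpose_functor one A) \<alpha>)
      = fa (transpose_functor one B) (comp2 (ICat D) ?h A B (Idt (Hom2 (ICat D) A B) k) \<alpha>)"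
    if el: "k \<in> Ob (Hom2 (ICat D) A B)" "\<alpha> \<in> Ar (Hom2 (ICat D) ?h A)" for k \<alpha>
  proof -
    have k: "internal_functor D A B k" using el(1) by simp
    interpret k: ifun D A B k by (intro P.F.B.ifun_intro AB k)
    obtain f \<tau> g where a: "\<alpha> = (f, \<tau>, g)" "internal_nat D ?h A f g \<tau>" using el(2) by auto
    note fg = P.F.B.internal_nat_functors[OF a(2)]
    have "icomp D B ((iide B \<cdot>\<^bsub>D\<^esub> if0 k) \<cdot>\<^bsub>D\<^esub> if0 g) (if1 k \<cdot>\<^bsub>D\<^esub> \<tau>) = if1 k \<cdot>\<^bsub>D\<^esub> \<tau>"
      using nat_ty[OF a(2)] fun_ty[OF fg(2)] by (simp add: P.F.B.comp_assoc)
    then show ?thesis using push[OF fg(1) k] push[OF fg(2) k] nat_ty[OF a(2)]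
      by (simp add: precomp_def IAlg_def transpose_functor_def a(1) V.transpose_post)
        (simp add: map_ifun_def V_ar)
  qed
  show "on2 (precomp d (IAlg E T one)) A B \<sigma> (fo (transpose_functor one A) f)
      = fa (transpose_functor one B) (comp2 (ICat D) ?h A B \<sigma> (Idt (Hom2 (ICat D) ?h A) f))"
    if el: "\<sigma> \<in> Ar (Hom2 (ICat D) A B)" "f \<in> Ob (Hom2 (ICat D) ?h A)" for \<sigma> f
  proof -
    have f: "internal_functor D ?h A f" using el(2) by simp
    obtain k \<rho> l where s: "\<sigma> = (k, \<rho>, l)" "internal_nat D A B k l \<rho>" using el(1) by auto
    interpret s: inat D A B k l \<rho> by (intro P.F.B.inat_intro AB s(2))
    have "icomp D B (\<rho> \<cdot>\<^bsub>D\<^esub> if0 f) (if1 k \<cdot>\<^bsub>D\<^esub> iide A \<cdot>\<^bsub>D\<^esub> if0 f) = \<rho> \<cdot>\<^bsub>D\<^esub> if0 f"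
      using fun_ty[OF f] by (simp add: P.F.B.comp_assoc)
    then show ?thesis
      using push[OF f s.F.internal_functor] push[OF f s.G.internal_functor] fun_ty[OF f]
      by (simp add: precomp_def IAlg_def transpose_functor_def s(1) V.transpose_post)
        (simp add: transpose_algebra_def V_ar)
  qed
qed

end

section \<open>The canonical action and the representing object\<close>

text \<open>Composing adjunctions in two ways makes \<open>p F\<^sup>T\<close> and \<open>G = F\<^sup>S c\<close> left adjoint to \<open>U\<^sup>T d = w U\<^sup>S\<close>;
  \<open>compare : p F\<^sup>T \<Rightarrow> G\<close> is the resulting isomorphism.\<close>

locale canonical = S: mon C S + adjoint_to_algebras E T "Alg C S" p d u' v' + cw: adj E C c w u v
  for C :: "('o, 'm) cat" and S and E :: "('p, 'n) cat" and T and p d u' v' and c w u v +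
  assumes over: "eq_fnc (Alg C S) (comp_fnc forget d) (comp_fnc w forget)"
begin

definition G :: "('p, 'n, ('o, 'm) alg, ('o, 'm) alg_mor) fnc" where "G = comp_fnc (free C S) c"

definition unit_G :: "'p \<Rightarrow> 'n" where "unit_G a = fa w (unt S (fo c a)) \<cdot>\<^bsub>E\<^esub> u a"

definition counit_G :: "('o, 'm) alg \<Rightarrow> ('o, 'm) alg_mor" where
  "counit_G A = (free_alg S (fst A), snd A, A) \<cdot>\<^bsub>Alg C S\<^esub> fa (free C S) (v (fst A))"

sublocale two_adjs E "Alg C S" L G V "comp_fnc w forget" unit unit_G counit counit_G
  using adjunction_comp[OF cw.adjunction S.FU.adjunction] over
  by unfold_locales (simp_all add: G_def V_def unit_G_def[abs_def] counit_G_def[abs_def] del: S.Alg_simps S.free_simps)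

abbreviation "canon \<equiv> canonical_action C E S T w c u v d"

lemma d_over: "A \<in> Alg_ob C S \<Longrightarrow> fst (fo d A) = fo w (fst A)"
  using over by (simp add: eq_fnc_def)

lemma monad_map_ar:
  assumes "x \<in> Ob E"
  shows "monad_map E S T w c u d x \<in> Ar E" "Dom E (monad_map E S T w c u d x) = mo T x"
    "Cod E (monad_map E S T w c u d x) = fo w (mo S (fo c x))"
  using assms Alg_obD[of "fo d (free_alg S (fo c x))"] P.U.fo_in[of "free_alg S (fo c x)"]
  by (simp_all add: monad_map_def d_over)

text \<open>The two successive transpositions in the definition of the canonical action amount to one
  transposition along the composite adjunction.\<close>

lemma canonical_action_eq:
  assumes x: "x \<in> Ob E"
  shows "canon x = counit_G (fo G x) \<cdot>\<^bsub>Alg C S\<^esub> fa G (monad_map E S T w c u d x)"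
  using x monad_map_ar[OF x]
  by (simp add: canonical_action_def counit_G_def G_def S.T.A.comp_assoc)

lemma transpose_canonical_action:
  assumes x: "x \<in> Ob E"
  shows "R.transpose (mo T x) (canon x) = monad_map E S T w c u d x"
  unfolding canonical_action_eq[OF x]
  by (rule R.transpose_counit) (use x monad_map_ar[OF x] in \<open>simp_all add: G_def\<close>)

text \<open>Both sides transpose along the adjunction of \<open>p F\<^sup>T\<close> and \<open>V\<close> to the monad map,
  the extension of the unit \<open>x \<rightarrow> V (G x)\<close> to the free algebra \<open>T x\<close>.\<close>

lemma compare_action:
  assumes x: "x \<in> Ob E"
  shows "compare x \<cdot>\<^bsub>Alg C S\<^esub> act x = canon x \<cdot>\<^bsub>Alg C S\<^esub> compare (mo T x)"
proof (rule V.transpose_inj[of "mo T x"])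
  let ?m = "monad_map E S T w c u d x"
  have fst_G: "fst (fo G x) = mo S (fo c x)" by (simp add: G_def)
  have canon: "canon x \<in> Ar (Alg C S)" "Dom (Alg C S) (canon x) = fo G (mo T x)" "Cod (Alg C S) (canon x) = fo G x"
    unfolding canonical_action_eq[OF x]
    using x monad_map_ar[OF x] fst_G by (simp_all del: S.Alg_simps)
  have "V.transpose (mo T x) (compare x \<cdot>\<^bsub>Alg C S\<^esub> act x) = snd (fo d (fo G x)) \<cdot>\<^bsub>E\<^esub> ma T (unit_G x)"
    using x by (simp add: transpose_action transpose_compare del: S.Alg_simps(2-))
  also have "\<dots> = ?m" by (simp add: monad_map_def unit_G_def G_def)
  also have "\<dots> = V.transpose (mo T x) (canon x \<cdot>\<^bsub>Alg C S\<^esub> compare (mo T x))"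
    using x canon by (simp add: transpose_comp_compare transpose_canonical_action del: S.Alg_simps(2-))
  finally show "V.transpose (mo T x) (compare x \<cdot>\<^bsub>Alg C S\<^esub> act x) = V.transpose (mo T x) (canon x \<cdot>\<^bsub>Alg C S\<^esub> compare (mo T x))" .
  show "compare x \<cdot>\<^bsub>Alg C S\<^esub> act x \<in> Ar (Alg C S)" "canon x \<cdot>\<^bsub>Alg C S\<^esub> compare (mo T x) \<in> Ar (Alg C S)"
    "Dom (Alg C S) (compare x \<cdot>\<^bsub>Alg C S\<^esub> act x) = fo L (mo T x)"
    "Dom (Alg C S) (canon x \<cdot>\<^bsub>Alg C S\<^esub> compare (mo T x)) = fo L (mo T x)"
    "Cod (Alg C S) (compare x \<cdot>\<^bsub>Alg C S\<^esub> act x) = Cod (Alg C S) (canon x \<cdot>\<^bsub>Alg C S\<^esub> compare (mo T x))"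
    using x canon by (simp_all del: S.Alg_simps(2-))
qed (use x in simp)

text \<open>Cartesianness of the canonical action is carried over to \<open>p\<close> of the free action, whose bar
  construction equals \<open>p\<close> of the cotriple resolution.\<close>

lemma representable_if_cartesian:
  assumes one: "terminal E one"
    and cart: "cartesian_nat_trans E (Alg C S) (comp_fnc G (mfn T)) G canon"
  shows "represents (ICat (Alg C S)) (precomp d (IAlg E T one)) (map_icat p (HT E T one))"
    and "is_nerve (Alg C S) (map_icat p (HT E T one)) (map_simp p (bar_TT1 E T one))"
    and "simp_isomorphic (Alg C S) (map_simp p (bar_TT1 E T one)) (bar E T one G canon)"
proof -
  have "right_action E T (Alg C S) L act"
    using right_action_map[OF right_action_free monad P.F.is_functor_axioms] by (simp add: L_def act_def[abs_def])
  then interpret B: bar_data E T "Alg C S" L act one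
    using one by unfold_locales
  interpret I: action_iso E T "Alg C S" L act one G canon compare
  proof
    show "nat_trans E (Alg C S) (comp_fnc G (mfn T)) G canon" using cart by (simp add: cartesian_nat_trans_def)
  qed (simp_all add: compare_iso compare_nat compare_action del: S.Alg_simps(2-))
  have bar: "map_simp p (bar_TT1 E T one) = bar E T one L act"
    by (simp add: bar_TT1_def map_simp_bar L_def act_def[abs_def])
  have trunc: "map_icat p (HT E T one) = simp_trunc (map_simp p (bar_TT1 E T one))"
    by (simp add: map_icat_def HT_def simp_trunc_def map_simp_def Let_def)
  interpret X: segal "Alg C S" "bar E T one L act"
    by (rule B.segal_bar, rule I.cartesian_transport)
      (use cart in \<open>simp_all add: cartesian_nat_trans_def del: S.Alg_simps(2-)\<close>)
  show "is_nerve (Alg C S) (map_icat p (HT E T one)) (map_simp p (bar_TT1 E T one))"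
    unfolding trunc bar by (rule X.is_nerve_trunc)
  then interpret representing E T "Alg C S" p d u' v' one
    using one by unfold_locales (simp_all add: is_nerve_def)
  show "represents (ICat (Alg C S)) (precomp d (IAlg E T one)) (map_icat p (HT E T one))"
    by (rule represents_internal_algebras)
  show "simp_isomorphic (Alg C S) (map_simp p (bar_TT1 E T one)) (bar E T one G canon)"
    unfolding bar by (rule I.simp_isomorphic_bar)
qed

end

theorem theorem7p3:
  fixes C :: "('o, 'm) cat" and E :: "('p, 'n) cat"
    and S :: "('o, 'm) mnd" and T :: "('p, 'n) mnd"
    and w :: "('o, 'm, 'p, 'n) fnc" and c :: "('p, 'n, 'o, 'm) fnc"
    and u :: "'p \<Rightarrow> 'n" and v :: "'o \<Rightarrow> 'm"
    and d :: "(('o, 'm) alg, ('o, 'm) alg_mor, ('p, 'n) alg, ('p, 'n) alg_mor) fnc"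
    and p :: "(('p, 'n) alg, ('p, 'n) alg_mor, ('o, 'm) alg, ('o, 'm) alg_mor) fnc"
    and u' :: "('p, 'n) alg \<Rightarrow> ('p, 'n) alg_mor" and v' :: "('o, 'm) alg \<Rightarrow> ('o, 'm) alg_mor"
    and one :: 'p
  assumes "category C" and "cocomplete TYPE('u) C" and "has_finite_limits C"
    and "category E" and "cocomplete TYPE('u) E" and "has_finite_limits E"
    and "cartesian_monad C S" and "finitary TYPE('u) C C (mfn S)"
    and "cartesian_monad E T" and "finitary TYPE('u) E E (mfn T)"
    and "terminal E one"
    and "adjunction E C c w u v"
    and "is_functor (Alg C S) (Alg E T) d"
    and "eq_fnc (Alg C S) (comp_fnc forget d) (comp_fnc w forget)"
    and "adjunction (Alg E T) (Alg C S) p d u' v'"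
  defines "G \<equiv> comp_fnc (free C S) c"
    and "act \<equiv> canonical_action C E S T w c u v d"
    and "h \<equiv> map_icat p (HT E T one)"
  assumes "cartesian_nat_trans E (Alg C S) (comp_fnc G (mfn T)) G act"
  shows "represents (CAlg C S) (precomp d (IAlg E T one)) h
    \<and> is_nerve (Alg C S) h (map_simp p (bar_TT1 E T one))
    \<and> simp_isomorphic (Alg C S) (map_simp p (bar_TT1 E T one)) (bar E T one G act)"
proof -
  have S: "monad C S" and T: "monad E T"
    using assms(7,9) by (simp_all add: cartesian_monad_def)
  interpret canonical C S E T p d u' v' c w u v
    using S T assms(12,14,15) by (intro canonical.intro canonical_axioms.intro adjoint_to_algebras.intro mon.intro adj.intro)
  have "cartesian_nat_trans E (Alg C S) (comp_fnc (comp_fnc (free C S) c) (mfn T)) (comp_fnc (free C S) c)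
      (canonical_action C E S T w c u v d)"
    using assms(16-) by simp
  then show ?thesis
    using representable_if_cartesian[OF \<open>terminal E one\<close>] assms(16-) by (simp add: G_def CAlg_def)
qed

end
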